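(* Let $d\in\mathbb{N}$. Let $(U_n)_{n\in\mathbb{Z}_+}$ and $(B_n)_{n\in\mathbb{Z}_+}$ be $\mathbb{R}^d$-valued and $\mathbb{R}^{d\times d}$-valued stochastic processes, respectively, defined on a probability space $(\Omega,\mathcal{F},\mathbb{P})$ and adapted to a filtration $(\mathcal{F}_n)_{n\in\mathbb{Z}_+}$, and let $\mathcal{F}_\infty:=\sigma(\bigcup_{k=0}^\infty\mathcal{F}_k)$. Suppose that $B_n$ is invertible for all sufficiently large $n\in\mathbb{N}$. Let $(Q_n)_{n\in\mathbb{N}}$ be a (deterministic) sequence in $\mathbb{R}^{d\times d}$ such that $Q_n\to 0$ as $n\to\infty$ and $Q_n$ is invertible for all sufficiently large $n\in\mathbb{N}$. Assume that: (i) there exists an $\mathbb{R}^{d\times d}$-valued, $\mathcal{F}_\infty$-measurable random matrix $\eta$ such that $\mathbb{P}(\exists\,\eta^{-1})>0$ and $Q_nB_n^{-1}\to\eta$ in $\mathbb{P}$-probability as $n\to\infty$; (ii) $\lim_{K\to\infty}\sup_{n\in\mathbb{N}}\mathbb{P}_{\{\exists\,\eta^{-1}\}}(\|Q_nU_n\|>K)=0$; (iii) there exists an invertible matrix $P\in\mathbb{R}^{d\times d}$ with $\varrho(P)<1$ such that for each $r\in\mathbb{N}$, $B_nB_{n-r}^{-1}\to P^r$ in $\mathbb{P}$-probability as $n\to\infty$; (iv') there exist a probability measure $\mu$ on $(\mathbb{R}^d,\mathcal{B}(\mathbb{R}^d))$ with $\int_{\mathbb{R}^d}\log^+(\|x\|)\,\mu(dx)<\infty$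 and an $\mathcal{F}_\infty$-measurable, $\mathbb{R}^{d\times d}$-valued discrete random variable $S$ such that for all $\theta\in\mathbb{R}^d$, $$\mathbb{E}_{\mathbb{P}}\bigl(e^{i\langle\theta,B_n\Delta U_n\rangle}\mid\mathcal{F}_{n-1}\bigr)\to\int_{\mathbb{R}^d}e^{i\langle\theta,Sx\rangle}\,\mu(dx)\quad\text{in }\mathbb{P}_{\{\exists\,\eta^{-1}\}}\text{-probability as }n\to\infty.$$ Then $$B_nU_n\to\sum_{j=0}^\infty P^jSZ_j\quad\mathcal{F}_\infty\text{-stably under }\mathbb{P}_{\{\exists\,\eta^{-1}\}}\text{ as }n\to\infty,$$ and $$Q_nU_n\to\eta\sum_{j=0}^\infty P^jSZ_j\quad\mathcal{F}_\infty\text{-stably under }\mathbb{P}_{\{\exists\,\eta^{-1}\}}\text{ as }n\to\infty,$$ where $(Z_j)_{j\in\mathbb{Z}_+}$ denotes a $\mathbb{P}$-independent and identically distributed sequence of $\mathbb{R}^d$-valued random vectors, $\mathbb{P}$-independent of $\mathcal{F}_\infty$, with $\mathbb{P}(Z_0\in B)=\mu(B)$ for all $B\in\mathcal{B}(\mathbb{R}^d)$.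
   Context: $\mathbb{Z}_+$ is the set of non-negative integers, $\mathbb{N}$ the set of positive integers. $\|\cdot\|$ and $\langle\cdot,\cdot\rangle$ are the Euclidean norm and inner product on $\mathbb{R}^d$; $\varrho(P)$ is the spectral radius of $P$. For $x\ge 0$, $\log^+(x):=\log(x)$ if $x\ge1$ and $0$ if $0\le x<1$. $\Delta U_0:=0$ and $\Delta U_n:=U_n-U_{n-1}$ for $n\in\mathbb{N}$. $\{\exists\,\eta^{-1}\}$ is the event that $\eta$ is invertible. For an event $A$ with $\mathbb{P}(A)>0$, $\mathbb{P}_A(\cdot):=\mathbb{P}(\cdot\cap A)/\mathbb{P}(A)$. A discrete random variable is one with countable range. Every random variable is defined on a (suitable) probability space $(\Omega,\mathcal{F},\mathbb{P})$; in particular this space is assumed to carry the sequence $(Z_j)_{j\in\mathbb{Z}_+}$. Stable convergence: let $\mathbb{Q}$ be a probability measure on $(\Omega,\mathcal{F})$, $\mathcal{G}\subset\mathcal{F}$ a sub-$\sigma$-field, and $X_n$ ($n\in\mathbb{N}$), $X$ be $\mathbb{R}^d$-valued random variables on $(\Omega,\mathcal{F})$. $X_n\to X$ $\mathcal{G}$-stably under $\mathbb{Q}$ as $n\to\infty$ if $\lim_{n\to\infty}\mathbb{E}_{\mathbb{Q}}(\xi\,\mathbb{E}_{\mathbb{Q}}(h(X_n)\mid\mathcal{G}))=\mathbb{E}_{\mathbb{Q}}(\xi\,\mathbb{E}_{\mathbb{Q}}(h(X)\mid\mathcal{G}))$ for all random variables $\xi:\Omega\to\mathbb{R}$ with $\mathbb{E}_{\mathbb{Q}}(|\xi|)<\infty$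 and all bounded continuous $h:\mathbb{R}^d\to\mathbb{R}$ (equivalently, $\lim_n\mathbb{E}_{\mathbb{Q}}(\xi h(X_n))=\mathbb{E}_{\mathbb{Q}}(\xi h(X))$ for all $\mathcal{G}$-measurable $\mathbb{Q}$-integrable real $\xi$ and all bounded continuous $h$). *)

theory Defs
  imports "HOL-Probability.Probability"
begin

definition log_plus :: "real \<Rightarrow> real" where
  "log_plus x = (if 1 \<le> x then ln x else 0)"

text \<open>The type of square matrices over a vector type carries the componentwise product as \<open>*\<close>,
  so \<open>A ^ r\<close> would be the entrywise power; this is the power for the matrix product \<open>**\<close>.\<close>

definition matrix_power :: "real^'d^'d \<Rightarrow> nat \<Rightarrow> real^'d^'d" where
  "matrix_power A r = (((**) A) ^^ r) (mat 1)"

text \<open>Real matrices are regarded as complex ones, so that non-real eigenvalues are counted.\<close>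

definition complex_eigenvalues :: "real^'d^'d \<Rightarrow> complex set" where
  "complex_eigenvalues A =
     {z. \<exists>v :: complex^'d. v \<noteq> 0 \<and> map_matrix complex_of_real A *v v = z *s v}"

definition real_matrix_spectral_radius :: "real^'d^'d \<Rightarrow> real" where
  "real_matrix_spectral_radius A = Max (cmod ` complex_eigenvalues A)"

definition increment :: "(nat \<Rightarrow> 'a \<Rightarrow> 'b::real_vector) \<Rightarrow> nat \<Rightarrow> 'a \<Rightarrow> 'b" where
  "increment U n \<omega> = (if n = 0 then 0 else U n \<omega> - U (n - 1) \<omega>)"

definition filtration_limit :: "'a measure \<Rightarrow> (nat \<Rightarrow> 'a measure) \<Rightarrow> 'a measure" where
  "filtration_limit M F = sigma (space M) (\<Union>k. sets (F k))"

definition converges_in_prob ::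
  "'a measure \<Rightarrow> (nat \<Rightarrow> 'a \<Rightarrow> 'b::metric_space) \<Rightarrow> ('a \<Rightarrow> 'b) \<Rightarrow> bool" where
  "converges_in_prob M X Y \<longleftrightarrow>
     (\<forall>\<epsilon>>0. (\<lambda>n. measure M {\<omega> \<in> space M. dist (X n \<omega>) (Y \<omega>) > \<epsilon>}) \<longlonglongrightarrow> 0)"

definition complex_cond_exp ::
  "'a measure \<Rightarrow> 'a measure \<Rightarrow> ('a \<Rightarrow> complex) \<Rightarrow> 'a \<Rightarrow> complex" where
  "complex_cond_exp M G f \<omega> =
     Complex (real_cond_exp M G (\<lambda>x. Re (f x)) \<omega>) (real_cond_exp M G (\<lambda>x. Im (f x)) \<omega>)"

definition converges_stably ::
  "'a measure \<Rightarrow> 'a measure \<Rightarrow> (nat \<Rightarrow> 'a \<Rightarrow> 'b::euclidean_space) \<Rightarrow> ('a \<Rightarrow> 'b) \<Rightarrow> bool" where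
  "converges_stably Q G X Y \<longleftrightarrow>
     (\<forall>(\<xi> :: 'a \<Rightarrow> real) (h :: 'b \<Rightarrow> real).
        integrable Q \<xi> \<longrightarrow> continuous_on UNIV h \<longrightarrow> bounded (range h) \<longrightarrow>
        (\<lambda>n. \<integral>\<omega>. \<xi> \<omega> * real_cond_exp Q G (\<lambda>x. h (X n x)) \<omega> \<partial>Q)
          \<longlonglongrightarrow> (\<integral>\<omega>. \<xi> \<omega> * real_cond_exp Q G (\<lambda>x. h (Y x)) \<omega> \<partial>Q))"

definition generated_sigma ::
  "'a measure \<Rightarrow> (nat \<Rightarrow> 'a \<Rightarrow> 'b::topological_space) \<Rightarrow> 'a measure" where
  "generated_sigma M Z = sigma (space M) (\<Union>j. sets (vimage_algebra (space M) (Z j) borel))"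

end

theory Submission
  imports Defs "HOL-Computational_Algebra.Fundamental_Theorem_Algebra"
begin

text \<open>
  Put \<open>W n = B n *v U n\<close> and \<open>Y n = B n *v increment U n\<close>. Assumptions (i) and (ii) make \<open>W\<close> tight
  on the event that \<open>\<eta>\<close> is invertible, and (iii) with \<open>r = 1\<close> turns
  \<open>W n = Y n + B n *v U (n - 1)\<close> into the recursion \<open>W n = Y n + P *v W (n - 1) + D n\<close> with
  \<open>D n \<rightarrow> 0\<close> in probability. Hence \<open>W n\<close> is close to \<open>\<Sum>j<r. P\<^sup>j *v Y (n - j)\<close> for large \<open>r\<close>.

  The joint characteristic function of \<open>Y n, \<dots>, Y (n - r + 1)\<close>, weighted by a bounded
  \<open>\<sigma>(\<Union>F)\<close>-measurable \<open>\<zeta>\<close>, is computed one factor at a time: by (iv') the factor of \<open>Y n\<close> may be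
  replaced by the limit \<open>\<phi> \<theta>\<close> of its conditional characteristic function, and \<open>\<phi> \<theta>\<close> is then absorbed
  into the weight \<open>\<zeta>\<close>. Since the weight is arbitrary, \<open>S\<close> may be random. Tightness and the
  Stone-Weierstrass theorem pass from characteristic functions to bounded continuous functions; applied
  to the pair \<open>(\<eta>, W n)\<close>, this also gives the limit of \<open>\<eta> *v W n\<close>, from which \<open>Q n *v U n\<close> differs by a
  term tending to \<open>0\<close> in probability.
\<close>

section \<open>Powers of a matrix of spectral radius less than one\<close>

text \<open>The event that \<open>\<eta>\<close> is invertible lies in the limit sigma-field but in
  general in no \<open>F n\<close>, while (iv') conditions under \<open>M\<close> and converges only
  on this event. So nothing is conditioned under the restricted measure: integrals are taken under
  \<open>M\<close> against weights vanishing off the event, and a factor centred given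
  \<open>F (n - 1)\<close> is shown to be negligible against every such weight. No continuity
  theorem for characteristic functions is involved: the limit is a given variable on the same space,
  its weighted characteristic functions follow from independence, and tightness comes from the
  assumptions. Tightness of \<open>W\<close> needs an absorption argument, because the error in
  writing \<open>Q n *v U n\<close> as \<open>\<eta> *v W n\<close> is itself a vanishing matrix
  times \<open>W n\<close>. The logarithmic moment enters only through Borel-Cantelli: almost surely
  \<open>Z j\<close> grows more slowly than any exponential, which the geometric decay of the powers
  of \<open>P\<close> outweighs. That decay is obtained without a normal form, from one polynomial
  that annihilates \<open>P\<close> over the complex numbers.\<close>

lemma norm_matrix_vector_mult_le:
  fixes A :: "real^'n^'m"
  shows "norm (A *v x) \<le> norm A * norm x"
proof -
  have "norm (A *v x) = L2_set (\<lambda>i. norm (A $ i \<bullet> x)) UNIV"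
    by (simp add: norm_vec_def matrix_vector_mul_component)
  also have "\<dots> \<le> L2_set (\<lambda>i. norm x * norm (A $ i)) UNIV"
    by (intro L2_set_mono) (simp_all add: Cauchy_Schwarz_ineq2 mult.commute[of "norm x"])
  also have "\<dots> = norm x * L2_set (\<lambda>i. norm (A $ i)) UNIV"
    by (simp add: L2_set_right_distrib)
  also have "\<dots> = norm A * norm x"
    unfolding norm_vec_def[of A] by simp
  finally show ?thesis .
qed

lemma matrix_power_0: "matrix_power A 0 = mat 1"
  and matrix_power_Suc: "matrix_power A (Suc n) = A ** matrix_power A n"
  by (simp_all add: matrix_power_def)

text \<open>Horner's rule for \<open>p(A) v\<close>. Acting on a vector avoids a polynomial ring
  over matrices, whose \<open>*\<close> is the componentwise product.\<close>

definition poly_apply :: "complex^'d^'d \<Rightarrow> complex poly \<Rightarrow> complex^'d \<Rightarrow> complex^'d" where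
  "poly_apply A p v = fold_coeffs (\<lambda>a w. a *s v + A *v w) p 0"

lemma poly_apply_0 [simp]: "poly_apply A 0 v = 0"
  by (simp add: poly_apply_def)

lemma poly_apply_pCons [simp]: "poly_apply A (pCons a p) v = a *s v + A *v poly_apply A p v"
  by (cases "p = 0 \<and> a = 0") (auto simp: poly_apply_def)

lemma poly_apply_add: "poly_apply A (p + q) v = poly_apply A p v + poly_apply A q v"
  by (induction p q rule: poly_induct2)
     (simp_all add: matrix_vector_right_distrib vec.scale_left_distrib algebra_simps)

lemma matrix_vector_mult_smult: "A *v (c *s v) = c *s (A *v v)" for A :: "complex^'d^'d"
  by (simp add: vec.scale)

lemma poly_apply_smult: "poly_apply A (smult c p) v = c *s poly_apply A p v"
  by (induction p) (simp_all add: matrix_vector_mult_smult vec.scale_right_distrib)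

lemma poly_apply_sum: "poly_apply A (sum f I) v = (\<Sum>i\<in>I. poly_apply A (f i) v)"
  by (induction I rule: infinite_finite_induct) (simp_all add: poly_apply_add)

lemma poly_apply_monom: "poly_apply A (monom c k) v = c *s (((*v) A) ^^ k) v"
  by (induction k) (simp_all add: monom_0 monom_Suc matrix_vector_mult_smult)

lemma poly_apply_diff_right: "poly_apply A p (v - w) = poly_apply A p v - poly_apply A p w"
  by (induction p) (simp_all add: matrix_vector_mult_diff_distrib vec.scale_right_diff_distrib add_diff_add)

lemma poly_apply_smult_right: "poly_apply A p (c *s v) = c *s poly_apply A p v"
  by (induction p) (simp_all add: matrix_vector_mult_smult vec.scale_right_distrib mult.commute)

lemma poly_apply_mult_right: "poly_apply A p (A *v v) = A *v poly_apply A p v"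
  by (induction p) (simp_all add: matrix_vector_mult_smult matrix_vector_right_distrib)

text \<open>\<open>A\<close> commutes with polynomials in \<open>A\<close>, so the factor
  \<open>A - l\<close> can be peeled off on either side. Inside it changes the vector; outside it
  yields an eigenvector equation for \<open>l\<close>.\<close>

lemma poly_apply_linear_factor:
  "poly_apply A ([:-l, 1:] * p) v = poly_apply A p (A *v v - l *s v)"
  "poly_apply A ([:-l, 1:] * p) v = A *v poly_apply A p v - l *s poly_apply A p v"
proof -
  have "[:-l, 1:] * p = smult (- l) p + pCons 0 p" by simp
  then show "poly_apply A ([:-l, 1:] * p) v = A *v poly_apply A p v - l *s poly_apply A p v"
    by (simp only: poly_apply_add poly_apply_smult poly_apply_pCons) simp
  then show "poly_apply A ([:-l, 1:] * p) v = poly_apply A p (A *v v - l *s v)"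
    by (simp only: poly_apply_diff_right poly_apply_mult_right poly_apply_smult_right)
qed

text \<open>Serves to place every eigenvalue among the roots of an annihilating polynomial.\<close>

lemma poly_apply_eigenvector:
  assumes "A *v v = z *s v"
  shows "poly_apply A p v = poly p z *s v"
  by (induction p) (simp_all add: matrix_vector_mult_smult assms vec.scale_left_distrib mult.commute)

text \<open>The gap between \<open>l\<close> and \<open>r\<close> absorbs an inhomogeneity of rate
  \<open>r\<close>; for \<open>l = r\<close> a factor linear in \<open>n\<close> would
  appear.\<close>

lemma geometric_recurrence_bound:
  fixes a :: "nat \<Rightarrow> real"
  assumes "0 \<le> l" "l < r" and rec: "\<And>n. a (Suc n) \<le> l * a n + C * r ^ n"
  shows "\<exists>K. \<forall>n. a n \<le> K * r ^ n"
proof -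
  \<comment> \<open>\<open>C / (r - l)\<close> is the smallest \<open>K\<close> with
    \<open>l * K + C \<le> r * K\<close>, the inequality that carries the induction;
    \<open>a 0\<close> starts it.\<close>
  define K where "K = max (a 0) (C / (r - l))"
  have C: "C \<le> (r - l) * K"
    using assms by (simp add: K_def max_def field_simps)
  have "a n \<le> K * r ^ n" for n
  proof (induction n)
    case 0
    then show ?case by (simp add: K_def)
  next
    case (Suc n)
    have "a (Suc n) \<le> l * (K * r ^ n) + C * r ^ n"
      using rec[of n] mult_left_mono[OF Suc assms(1)] by linarith
    also have "\<dots> = (l * K + C) * r ^ n" by (simp add: algebra_simps)
    also have "\<dots> \<le> (r * K) * r ^ n"
      using C assms by (intro mult_right_mono) (auto simp: algebra_simps)
    finally show ?case by (simp add: algebra_simps)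
  qed
  then show ?thesis by blast
qed

text \<open>The degree of an annihilating polynomial of \<open>v\<close> is lowered by a linear factor \<open>A - l\<close>:
  this factor is injective if \<open>l\<close> is no eigenvalue, and otherwise the orbit of \<open>v\<close> is controlled
  by that of \<open>(A - l) v\<close> through a scalar recurrence.\<close>

lemma iterates_geometric_bound:
  fixes A :: "complex^'d^'d"
  assumes eig: "\<And>z v. v \<noteq> 0 \<Longrightarrow> A *v v = z *s v \<Longrightarrow> cmod z < r"
    and "p \<noteq> 0" "poly_apply A p v = 0" "0 < r"
  shows "\<exists>K. \<forall>n. norm ((((*v) A) ^^ n) v) \<le> K * r ^ n"
  using assms(2,3)
proof (induction "degree p" arbitrary: p v)
  case 0
  then obtain c where "p = [:c:]" "c \<noteq> 0"
    by (metis degree_eq_zeroE pCons_0_0)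
  then have "v = 0"
    using 0 by (auto simp: vec_eq_iff)
  moreover have "(((*v) A) ^^ n) 0 = 0" for n
    by (induction n) auto
  ultimately show ?case by (intro exI[of _ 0]) auto
next
  case (Suc d)
  have "\<not> constant (poly p)"
    using Suc.hyps(2) by (simp add: constant_degree)
  then obtain l where "poly p l = 0"
    using fundamental_theorem_of_algebra by blast
  then obtain q where q: "p = [:-l, 1:] * q"
    by (metis poly_eq_0_iff_dvd dvd_def)
  with Suc have q0: "q \<noteq> 0" and d: "d = degree q"
    by (auto simp: degree_mult_eq simp del: mult_pCons_left)
  show ?case
  proof (cases "\<exists>w. w \<noteq> 0 \<and> A *v w = l *s w")
    case True
    then have l: "cmod l < r" using eig by blast
    define w where "w = A *v v - l *s v"
    have "poly_apply A q w = 0"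
      using Suc.prems(2) unfolding w_def q poly_apply_linear_factor(1) .
    then obtain C where C: "\<And>n. norm ((((*v) A) ^^ n) w) \<le> C * r ^ n"
      using Suc.hyps(1)[OF d q0] by blast
    have w: "(((*v) A) ^^ n) w = (((*v) A) ^^ Suc n) v - l *s (((*v) A) ^^ n) v" for n
      by (induction n) (simp_all add: w_def matrix_vector_mult_diff_distrib matrix_vector_mult_smult)
    have norm_smult: "norm (l *s x) = cmod l * norm x" for x :: "complex^'d"
      by (simp add: norm_vec_def norm_mult L2_set_right_distrib)
    have "norm ((((*v) A) ^^ Suc n) v) \<le> cmod l * norm ((((*v) A) ^^ n) v) + C * r ^ n" for n
    proof -
      have "(((*v) A) ^^ Suc n) v = l *s (((*v) A) ^^ n) v + (((*v) A) ^^ n) w"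
        by (simp add: w)
      then show ?thesis
        using norm_triangle_ineq[of "l *s (((*v) A) ^^ n) v" "(((*v) A) ^^ n) w"] C[of n]
        by (simp add: norm_smult del: funpow.simps)
    qed
    from geometric_recurrence_bound[OF norm_ge_zero l this] show ?thesis .
  next
    case False
    have "A *v poly_apply A q v = l *s poly_apply A q v"
      using Suc.prems(2) unfolding q poly_apply_linear_factor(2) by simp
    with False have "poly_apply A q v = 0" by blast
    then show ?thesis using Suc.hyps(1)[OF d q0] by blast
  qed
qed

text \<open>There are more powers than the dimension of the matrix space. This count replaces the
  Cayley-Hamilton theorem, since any annihilating polynomial will do.\<close>

lemma matrix_powers_dependent:
  fixes A :: "real^'d^'d"
  shows "\<exists>(c :: nat \<Rightarrow> real) N. (\<exists>k\<le>N. c k \<noteq> 0) \<and> (\<Sum>k\<le>N. c k *\<^sub>R matrix_power A k) = 0"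
proof -
  define N where "N = DIM(real^'d^'d)"
  show ?thesis
  proof (cases "inj_on (matrix_power A) {..N}")
    case True
    let ?S = "matrix_power A ` {..N}"
    have "dependent ?S"
      using True by (intro dependent_biggerset) (simp add: card_image N_def)
    then obtain u where "\<exists>v\<in>?S. u v \<noteq> 0" "(\<Sum>v\<in>?S. u v *\<^sub>R v) = 0"
      using real_vector.dependent_finite[of ?S] by auto
    then show ?thesis
      using True by (intro exI[of _ "\<lambda>k. u (matrix_power A k)"] exI[of _ N])
        (auto simp: sum.reindex)
  next
    \<comment> \<open>A repeated power makes the set of powers too small for the dimension count,
      but the repetition is itself a relation.\<close>
    case False
    then obtain i j where ij: "i \<le> N" "j \<le> N" "i \<noteq> j" "matrix_power A i = matrix_power A j"
      by (auto simp: inj_on_def)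
    have "(\<Sum>k\<le>N. (if k = i then 1 else if k = j then - 1 else 0) *\<^sub>R matrix_power A k) =
      (\<Sum>k\<in>{i,j}. (if k = i then 1 else if k = j then - 1 else 0) *\<^sub>R matrix_power A k)"
      using ij by (intro sum.mono_neutral_right) auto
    also have "\<dots> = 0" using ij by simp
    finally show ?thesis
      using ij by (intro exI[of _ "\<lambda>k. if k = i then 1 else if k = j then - 1 else 0"] exI[of _ N])
        auto
  qed
qed

lemma map_matrix_of_real_mult:
  "map_matrix complex_of_real (A ** B) = map_matrix complex_of_real A ** map_matrix complex_of_real B"
  by (simp add: vec_eq_iff map_matrix_def matrix_matrix_mult_def)

lemma map_matrix_of_real_power:
  "map_matrix complex_of_real (matrix_power A n) *v v = (((*v) (map_matrix complex_of_real A)) ^^ n) v"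
proof (induction n)
  case 0
  have "map_matrix complex_of_real (mat 1) = (mat 1 :: complex^'a^'a)"
    by (simp add: vec_eq_iff map_matrix_def mat_def)
  then show ?case by (simp add: matrix_power_0)
next
  case (Suc n)
  then show ?case
    by (simp add: matrix_power_Suc map_matrix_of_real_mult flip: matrix_vector_mul_assoc)
qed

text \<open>The real relation among powers is carried over entry by entry, so that the polynomial
  annihilates complex vectors too, where non-real eigenvalues have their eigenvectors.\<close>

lemma annihilating_polynomial:
  fixes A :: "real^'d^'d"
  shows "\<exists>p. p \<noteq> 0 \<and> (\<forall>v. poly_apply (map_matrix complex_of_real A) p v = 0)"
proof -
  let ?A = "map_matrix complex_of_real A"
  obtain c N where c: "\<exists>k\<le>N. c k \<noteq> 0" and 0: "(\<Sum>k\<le>N. c k *\<^sub>R matrix_power A k) = 0"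
    using matrix_powers_dependent by blast
  define p where "p = (\<Sum>k\<le>N. monom (complex_of_real (c k)) k)"
  have "coeff p k = of_real (c k)" if "k \<le> N" for k
    using that by (simp add: p_def coeff_sum if_distrib cong: if_cong)
  with c have "p \<noteq> 0" by force
  moreover have "poly_apply ?A p v = 0" for v
  proof -
    have "poly_apply ?A p v $ i = 0" for i
    proof -
      have 0: "(\<Sum>k\<le>N. c k * matrix_power A k $ i $ j) = 0" for j
        using arg_cong[OF 0, of "\<lambda>M. M $ i $ j"] by simp
      have "poly_apply ?A p v $ i =
          (\<Sum>k\<le>N. \<Sum>j\<in>UNIV. of_real (c k) * (of_real (matrix_power A k $ i $ j) * v $ j))"
        by (simp add: p_def poly_apply_sum poly_apply_monom flip: map_matrix_of_real_power)
           (simp add: map_matrix_def matrix_vector_mult_def sum_distrib_left)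
      also have "\<dots> = (\<Sum>j\<in>UNIV. of_real (\<Sum>k\<le>N. c k * matrix_power A k $ i $ j) * v $ j)"
        by (subst sum.swap) (simp add: sum_distrib_right mult.assoc)
      finally show ?thesis by (simp add: 0)
    qed
    then show ?thesis by (simp add: vec_eq_iff)
  qed
  ultimately show ?thesis by blast
qed

text \<open>Each orbit decays at any rate above the spectral radius, with a constant depending on
  the vector; expansion in the finite basis makes the constant uniform.\<close>

lemma matrix_power_geometric_bound:
  fixes P :: "real^'d^'d"
  assumes "real_matrix_spectral_radius P < 1"
  shows "\<exists>C r. 0 < r \<and> r < 1 \<and> 0 \<le> C \<and> (\<forall>n x. norm (matrix_power P n *v x) \<le> C * r ^ n * norm x)"
proof -
  let ?P = "map_matrix complex_of_real P"
  obtain p where p: "p \<noteq> 0" "\<And>v. poly_apply ?P p v = 0"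
    using annihilating_polynomial by blast
  have "complex_eigenvalues P \<subseteq> {z. poly p z = 0}"
  proof
    fix z assume "z \<in> complex_eigenvalues P"
    then obtain v where v: "v \<noteq> 0" "?P *v v = z *s v"
      by (auto simp: complex_eigenvalues_def)
    then show "z \<in> {z. poly p z = 0}"
      using p(2)[of v] poly_apply_eigenvector[OF v(2), of p] by simp
  qed
  \<comment> \<open>\<open>Max\<close> is a genuine upper bound only on a finite set.\<close>
  then have fin: "finite (complex_eigenvalues P)"
    using poly_roots_finite[OF p(1)] finite_subset by blast
  \<comment> \<open>Midway between the spectral radius and 1; \<open>max 0\<close> gives positivity
    without showing that an eigenvalue exists.\<close>
  define r where "r = (max 0 (real_matrix_spectral_radius P) + 1) / 2"
  have r: "0 < r" "r < 1" "real_matrix_spectral_radius P < r"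
    using assms by (auto simp: r_def)
  have eig: "cmod z < r" if "v \<noteq> 0" "?P *v v = z *s v" for v z
  proof -
    have "cmod z \<le> real_matrix_spectral_radius P"
      unfolding real_matrix_spectral_radius_def
      using that fin by (intro Max_ge) (auto simp: complex_eigenvalues_def)
    with r show ?thesis by simp
  qed
  have "\<exists>K. \<forall>n. norm (matrix_power P n *v x) \<le> K * r ^ n" for x
  proof -
    define v where "v = (\<chi> i. complex_of_real (x $ i))"
    obtain K where K: "\<And>n. norm ((((*v) ?P) ^^ n) v) \<le> K * r ^ n"
      using iterates_geometric_bound[OF _ p(1) p(2) r(1), where v=v] eig by metis
    have "(((*v) ?P) ^^ n) v = (\<chi> i. complex_of_real ((matrix_power P n *v x) $ i))" for n
      unfolding map_matrix_of_real_power[symmetric]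
      by (simp add: vec_eq_iff v_def map_matrix_def matrix_vector_mult_def)
    then have "norm (matrix_power P n *v x) = norm ((((*v) ?P) ^^ n) v)" for n
      by (simp add: norm_vec_def)
    then show ?thesis using K by auto
  qed
  then obtain K where K: "\<And>x n. norm (matrix_power P n *v x) \<le> K x * r ^ n"
    by metis
  define C where "C = (\<Sum>b\<in>Basis. \<bar>K b\<bar>)"
  have "norm (matrix_power P n *v x) \<le> C * r ^ n * norm x" for n x
  proof -
    have "matrix_power P n *v x = (\<Sum>b\<in>Basis. (x \<bullet> b) *\<^sub>R (matrix_power P n *v b))"
      by (subst euclidean_representation[of x, symmetric])
         (simp only: linear_sum[OF matrix_vector_mul_linear] linear_cmul[OF matrix_vector_mul_linear])
    also have "norm \<dots> \<le> (\<Sum>b\<in>Basis. norm x * (\<bar>K b\<bar> * r ^ n))"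
    proof (intro sum_norm_le)
      fix b :: "real^'d" assume "b \<in> Basis"
      then have "\<bar>x \<bullet> b\<bar> \<le> norm x" by (rule Basis_le_norm)
      moreover have "norm (matrix_power P n *v b) \<le> \<bar>K b\<bar> * r ^ n"
        using K[of n b] r by (smt (verit) mult_right_mono zero_le_power)
      ultimately show "norm ((x \<bullet> b) *\<^sub>R (matrix_power P n *v b)) \<le> norm x * (\<bar>K b\<bar> * r ^ n)"
        by (auto intro!: mult_mono)
    qed
    finally show ?thesis
      by (simp add: C_def sum_distrib_right sum_distrib_left mult_ac)
  qed
  moreover have "0 \<le> C" by (simp add: C_def sum_nonneg)
  ultimately show ?thesis using r by blast
qed

section \<open>Measurability of matrix operations\<close>

lemma borel_measurable_vecI:
  fixes f :: "'a \<Rightarrow> 'b::euclidean_space^'n"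
  assumes "\<And>i. (\<lambda>x. f x $ i) \<in> borel_measurable M"
  shows "f \<in> borel_measurable M"
  unfolding borel_measurable_euclidean_space[of f]
  using assms by (auto simp: Basis_vec_def inner_axis intro!: borel_measurable_inner)

lemma borel_measurable_vec_nth [measurable]:
  "(\<lambda>x :: 'b::euclidean_space^'n. x $ i) \<in> borel_measurable borel"
  by (intro borel_measurable_continuous_onI continuous_intros)

lemma borel_measurable_vec_nth' [measurable (raw)]:
  fixes f :: "'a \<Rightarrow> 'b::euclidean_space^'n"
  assumes "f \<in> borel_measurable M"
  shows "(\<lambda>x. f x $ i) \<in> borel_measurable M"
  using measurable_compose[OF assms borel_measurable_vec_nth] .

lemma borel_measurable_matrix_vector_mult [measurable (raw)]:
  fixes A :: "'a \<Rightarrow> real^'n^'m"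
  assumes [measurable]: "A \<in> borel_measurable M" "v \<in> borel_measurable M"
  shows "(\<lambda>x. A x *v v x) \<in> borel_measurable M"
  by (intro borel_measurable_vecI) (simp add: matrix_vector_mult_def)

lemma borel_measurable_matrix_matrix_mult [measurable (raw)]:
  fixes A :: "'a \<Rightarrow> real^'n^'m" and B :: "'a \<Rightarrow> real^'k^'n"
  assumes [measurable]: "A \<in> borel_measurable M" "B \<in> borel_measurable M"
  shows "(\<lambda>x. A x ** B x) \<in> borel_measurable M"
  by (intro borel_measurable_vecI) (simp add: matrix_matrix_mult_def)

lemma borel_measurable_det [measurable (raw)]:
  fixes A :: "'a \<Rightarrow> real^'n^'n"
  assumes [measurable]: "A \<in> borel_measurable M"
  shows "(\<lambda>x. det (A x)) \<in> borel_measurable M"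
  unfolding det_def by measurable

lemma matrix_inv_left_right:
  fixes A :: "real^'n^'n"
  assumes "invertible A"
  shows "A ** matrix_inv A = mat 1" "matrix_inv A ** A = mat 1"
proof -
  have "\<exists>A'. A ** A' = mat 1 \<and> A' ** A = mat 1"
    using assms by (simp add: invertible_def)
  from someI_ex[OF this] show "A ** matrix_inv A = mat 1" "matrix_inv A ** A = mat 1"
    by (simp_all add: matrix_inv_def)
qed

text \<open>Column \<open>j\<close> of the inverse solves \<open>A *v x = axis j 1\<close>. Cramer's
  rule makes its entries quotients of determinants, hence measurable in \<open>A\<close>.\<close>

lemma matrix_inv_cramer:
  fixes A :: "real^'n^'n"
  assumes "invertible A"
  shows "matrix_inv A $ i $ j =
    det (\<chi> k l. if l = i then axis j 1 $ k else A $ k $ l) / det A"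
proof -
  have "A *v (matrix_inv A *v axis j 1) = axis j 1"
    using assms by (simp add: matrix_vector_mul_assoc matrix_inv_left_right)
  then have "matrix_inv A *v axis j 1 =
      (\<chi> i. det (\<chi> k l. if l = i then axis j 1 $ k else A $ k $ l) / det A)"
    using assms by (subst cramer[symmetric]) (auto simp: invertible_det_nz)
  moreover have "(matrix_inv A *v axis j 1) $ i = matrix_inv A $ i $ j"
    by (simp add: matrix_vector_mul_component inner_axis)
  ultimately show ?thesis by (simp add: vec_eq_iff)
qed

text \<open>On singular matrices the choice operator in \<^const>\<open>matrix_inv\<close> is applied to the empty
  predicate, so that its value there is one fixed matrix.\<close>

lemma matrix_inv_not_invertible:
  fixes A :: "real^'n^'n"
  assumes "\<not> invertible A"
  shows "matrix_inv A = (SOME _. False)"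
proof -
  have "(\<lambda>A'. A ** A' = mat 1 \<and> A' ** A = mat 1) = (\<lambda>_. False)"
    using assms by (auto simp: invertible_def)
  then show ?thesis by (simp add: matrix_inv_def)
qed

lemma borel_measurable_matrix_inv [measurable (raw)]:
  fixes A :: "'a \<Rightarrow> real^'n^'n"
  assumes [measurable]: "A \<in> borel_measurable M"
  shows "(\<lambda>x. matrix_inv (A x)) \<in> borel_measurable M"
proof (intro borel_measurable_vecI)
  fix i j
  have "matrix_inv (A x) $ i $ j = (if det (A x) \<noteq> 0 then
      det (\<chi> k l. if l = i then axis j 1 $ k else A x $ k $ l) / det (A x)
      else (SOME _. False) $ i $ j)" for x
    using matrix_inv_cramer[of "A x" i j] matrix_inv_not_invertible[of "A x"]
    by (auto simp: invertible_det_nz)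
  moreover have "(\<lambda>x. \<chi> k l. if l = i then axis j 1 $ k else A x $ k $ l) \<in> borel_measurable M"
    by (intro borel_measurable_vecI) simp
  ultimately show "(\<lambda>x. matrix_inv (A x) $ i $ j) \<in> borel_measurable M"
    by simp
qed

lemma sets_invertible [measurable (raw)]:
  fixes A :: "'a \<Rightarrow> real^'n^'n"
  assumes [measurable]: "A \<in> borel_measurable M"
  shows "{x \<in> space M. invertible (A x)} \<in> sets M"
  unfolding invertible_det_nz by measurable

section \<open>Convergence in probability and tightness\<close>

text \<open>Only late indices count, because the relations between the processes hold only once
  \<open>B n\<close> is almost surely invertible.\<close>

definition tight_seq :: "'a measure \<Rightarrow> (nat \<Rightarrow> 'a \<Rightarrow> 'b::real_normed_vector) \<Rightarrow> bool" where
  "tight_seq M X \<longleftrightarrow>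
     (\<forall>\<epsilon>>0. \<exists>K. \<forall>\<^sub>F n in sequentially. measure M {\<omega> \<in> space M. norm (X n \<omega>) > K} < \<epsilon>)"

lemma tight_seqD:
  assumes "tight_seq M X" "\<epsilon> > 0"
  obtains K where "\<forall>\<^sub>F n in sequentially. measure M {\<omega> \<in> space M. norm (X n \<omega>) > K} < \<epsilon>"
  using assms by (auto simp: tight_seq_def)

lemma converges_in_prob_diff_zero:
  fixes X :: "nat \<Rightarrow> 'a \<Rightarrow> 'b::real_normed_vector"
  shows "converges_in_prob M X Y \<longleftrightarrow> converges_in_prob M (\<lambda>n \<omega>. X n \<omega> - Y \<omega>) (\<lambda>_. 0)"
  by (simp add: converges_in_prob_def dist_norm)

lemma converges_in_prob_zero_iff:
  fixes X :: "nat \<Rightarrow> 'a \<Rightarrow> 'b::real_normed_vector"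
  shows "converges_in_prob M X (\<lambda>_. 0) \<longleftrightarrow>
    (\<forall>\<delta>>0. \<forall>\<epsilon>>0. \<forall>\<^sub>F n in sequentially. measure M {\<omega> \<in> space M. norm (X n \<omega>) > \<delta>} < \<epsilon>)"
proof -
  have "(\<lambda>n. measure M (A n)) \<longlonglongrightarrow> 0 \<longleftrightarrow> (\<forall>\<epsilon>>0. \<forall>\<^sub>F n in sequentially. measure M (A n) < \<epsilon>)" for A
    unfolding tendsto_iff by simp
  then show ?thesis unfolding converges_in_prob_def by simp
qed

lemmas converges_in_prob_zeroD = converges_in_prob_zero_iff[THEN iffD1, rule_format]

lemma converges_in_prob_shift:
  assumes "converges_in_prob M X Y"
  shows "converges_in_prob M (\<lambda>n. X (n - k)) Y"
  unfolding converges_in_prob_def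
proof (intro allI impI)
  fix e :: real assume "e > 0"
  then have "(\<lambda>n. measure M {\<omega> \<in> space M. e < dist (X n \<omega>) (Y \<omega>)}) \<longlonglongrightarrow> 0"
    using assms by (simp add: converges_in_prob_def)
  then show "(\<lambda>n. measure M {\<omega> \<in> space M. e < dist (X (n - k) \<omega>) (Y \<omega>)}) \<longlonglongrightarrow> 0"
    by (rule filterlim_compose) (rule filterlim_minus_const_nat_at_top)
qed

lemma tight_seq_shift:
  assumes "tight_seq M X"
  shows "tight_seq M (\<lambda>n. X (n - k))"
  unfolding tight_seq_def
proof (intro allI impI)
  fix e :: real assume "e > 0"
  then obtain K where "\<forall>\<^sub>F n in sequentially. measure M {\<omega> \<in> space M. norm (X n \<omega>) > K} < e"
    using assms by (auto simp: tight_seq_def)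
  then have "\<forall>\<^sub>F n in sequentially. measure M {\<omega> \<in> space M. norm (X (n - k) \<omega>) > K} < e"
    by (rule eventually_compose_filterlim) (rule filterlim_minus_const_nat_at_top)
  then show "\<exists>K. \<forall>\<^sub>F n in sequentially. measure M {\<omega> \<in> space M. norm (X (n - k) \<omega>) > K} < e" ..
qed

context prob_space
begin

text \<open>Only the two covering events must be measurable, since \<open>measure\<close> is 0 on a
  non-measurable set; dominated processes below can therefore be left arbitrary.\<close>

lemma prob_le_add:
  assumes "{\<omega> \<in> space M. Q1 \<omega>} \<in> events" "{\<omega> \<in> space M. Q2 \<omega>} \<in> events"
    and "AE \<omega> in M. P \<omega> \<longrightarrow> Q1 \<omega> \<or> Q2 \<omega>"
  shows "prob {\<omega> \<in> space M. P \<omega>} \<le> prob {\<omega> \<in> space M. Q1 \<omega>} + prob {\<omega> \<in> space M. Q2 \<omega>}"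
proof -
  have "prob {\<omega> \<in> space M. P \<omega>} \<le> prob ({\<omega> \<in> space M. Q1 \<omega>} \<union> {\<omega> \<in> space M. Q2 \<omega>})"
    using assms by (intro finite_measure_mono_AE) auto
  also have "\<dots> \<le> prob {\<omega> \<in> space M. Q1 \<omega>} + prob {\<omega> \<in> space M. Q2 \<omega>}"
    by (rule measure_Un_le) (use assms in auto)
  finally show ?thesis .
qed

lemma converges_in_prob_zero_bound:
  fixes X :: "nat \<Rightarrow> 'a \<Rightarrow> 'b::euclidean_space" and Y :: "nat \<Rightarrow> 'a \<Rightarrow> 'c::euclidean_space"
  assumes X: "converges_in_prob M X (\<lambda>_. 0)" and [measurable]: "\<And>n. X n \<in> borel_measurable M"
    and le: "\<forall>\<^sub>F n in sequentially. AE \<omega> in M. norm (Y n \<omega>) \<le> C * norm (X n \<omega>)"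
  shows "converges_in_prob M Y (\<lambda>_. 0)"
  unfolding converges_in_prob_zero_iff
proof (intro allI impI)
  fix d e :: real assume d: "d > 0" and e: "e > 0"
  define C' where "C' = max 1 C"
  have C': "C' > 0" "C \<le> C'" by (auto simp: C'_def)
  have "\<forall>\<^sub>F n in sequentially. measure M {\<omega> \<in> space M. norm (X n \<omega>) > d / C'} < e"
    using C' d e by (intro converges_in_prob_zeroD[OF X]) auto
  with le show "\<forall>\<^sub>F n in sequentially. measure M {\<omega> \<in> space M. norm (Y n \<omega>) > d} < e"
  proof eventually_elim
    case (elim n)
    have "prob {\<omega> \<in> space M. norm (Y n \<omega>) > d} \<le> prob {\<omega> \<in> space M. norm (X n \<omega>) > d / C'}"
    proof (intro finite_measure_mono_AE)
      show "AE \<omega> in M. \<omega> \<in> {\<omega> \<in> space M. norm (Y n \<omega>) > d} \<longrightarrow>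
          \<omega> \<in> {\<omega> \<in> space M. norm (X n \<omega>) > d / C'}"
        using elim(1)
      proof eventually_elim
        case (elim \<omega>)
        have "norm (Y n \<omega>) \<le> C' * norm (X n \<omega>)"
          using elim C'(2) by (meson mult_right_mono norm_ge_zero order_trans)
        then show ?case using C'(1) by (auto simp: field_simps)
      qed
    qed measurable
    with elim show ?case by simp
  qed
qed

lemma converges_in_prob_zero_add:
  fixes X Y :: "nat \<Rightarrow> 'a \<Rightarrow> 'b::euclidean_space"
  assumes X: "converges_in_prob M X (\<lambda>_. 0)" and [measurable]: "\<And>n. X n \<in> borel_measurable M"
    and Y: "converges_in_prob M Y (\<lambda>_. 0)" and [measurable]: "\<And>n. Y n \<in> borel_measurable M"
  shows "converges_in_prob M (\<lambda>n \<omega>. X n \<omega> + Y n \<omega>) (\<lambda>_. 0)"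
  unfolding converges_in_prob_zero_iff
proof (intro allI impI)
  fix d e :: real assume d: "d > 0" and e: "e > 0"
  have "\<forall>\<^sub>F n in sequentially. prob {\<omega> \<in> space M. norm (X n \<omega>) > d / 2} < e / 2"
    "\<forall>\<^sub>F n in sequentially. prob {\<omega> \<in> space M. norm (Y n \<omega>) > d / 2} < e / 2"
    by (rule converges_in_prob_zeroD[OF X] converges_in_prob_zeroD[OF Y]; use d e in simp)+
  then show "\<forall>\<^sub>F n in sequentially. prob {\<omega> \<in> space M. norm (X n \<omega> + Y n \<omega>) > d} < e"
  proof eventually_elim
    case (elim n)
    have "prob {\<omega> \<in> space M. norm (X n \<omega> + Y n \<omega>) > d} \<le>
        prob {\<omega> \<in> space M. norm (X n \<omega>) > d / 2} + prob {\<omega> \<in> space M. norm (Y n \<omega>) > d / 2}"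
    proof (rule prob_le_add; (intro AE_I2 impI)?)
      fix \<omega> assume "d < norm (X n \<omega> + Y n \<omega>)"
      then show "d / 2 < norm (X n \<omega>) \<or> d / 2 < norm (Y n \<omega>)"
        using norm_triangle_ineq[of "X n \<omega>" "Y n \<omega>"] by linarith
    qed measurable
    with elim show ?case by simp
  qed
qed

lemma converges_in_prob_zero_sum:
  fixes X :: "'i \<Rightarrow> nat \<Rightarrow> 'a \<Rightarrow> 'b::euclidean_space"
  assumes "finite I" "\<And>i. i \<in> I \<Longrightarrow> converges_in_prob M (X i) (\<lambda>_. 0)"
    and [measurable]: "\<And>i n. X i n \<in> borel_measurable M"
  shows "converges_in_prob M (\<lambda>n \<omega>. \<Sum>i\<in>I. X i n \<omega>) (\<lambda>_. 0)"
  using assms(1,2)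
proof (induction I rule: finite_induct)
  case empty
  then show ?case by (simp add: converges_in_prob_def)
next
  case (insert i I)
  have "converges_in_prob M (\<lambda>n \<omega>. X i n \<omega> + (\<Sum>i\<in>I. X i n \<omega>)) (\<lambda>_. 0)"
    by (intro converges_in_prob_zero_add insert.IH insert.prems) auto
  then show ?case
    using insert.hyps by simp
qed

text \<open>Where the tight factor is at most \<open>K\<close>, the product exceeds \<open>d\<close>
  only if the vanishing factor exceeds \<open>d / K\<close>.\<close>

lemma converges_in_prob_zero_mult_tight:
  fixes X :: "nat \<Rightarrow> 'a \<Rightarrow> 'b::euclidean_space" and W :: "nat \<Rightarrow> 'a \<Rightarrow> 'c::euclidean_space"
    and Y :: "nat \<Rightarrow> 'a \<Rightarrow> 'd::euclidean_space"
  assumes X: "converges_in_prob M X (\<lambda>_. 0)" and [measurable]: "\<And>n. X n \<in> borel_measurable M"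
    and W: "tight_seq M W" and [measurable]: "\<And>n. W n \<in> borel_measurable M"
    and le: "\<And>n \<omega>. norm (Y n \<omega>) \<le> norm (X n \<omega>) * norm (W n \<omega>)"
  shows "converges_in_prob M Y (\<lambda>_. 0)"
  unfolding converges_in_prob_zero_iff
proof (intro allI impI)
  fix d e :: real assume d: "d > 0" and e: "e > 0"
  obtain K0 where K0: "\<forall>\<^sub>F n in sequentially. prob {\<omega> \<in> space M. norm (W n \<omega>) > K0} < e / 2"
    using tight_seqD[OF W, of "e / 2"] e by auto
  define K where "K = max 1 K0"
  have K: "K > 0" "K0 \<le> K" by (auto simp: K_def)
  have "\<forall>\<^sub>F n in sequentially. prob {\<omega> \<in> space M. norm (X n \<omega>) > d / K} < e / 2"
    using d e K by (intro converges_in_prob_zeroD[OF X]) auto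
  with K0 show "\<forall>\<^sub>F n in sequentially. prob {\<omega> \<in> space M. norm (Y n \<omega>) > d} < e"
  proof eventually_elim
    case (elim n)
    have "prob {\<omega> \<in> space M. norm (Y n \<omega>) > d} \<le>
        prob {\<omega> \<in> space M. norm (X n \<omega>) > d / K} + prob {\<omega> \<in> space M. norm (W n \<omega>) > K0}"
    proof (rule prob_le_add; (intro AE_I2 impI)?)
      fix \<omega> assume *: "d < norm (Y n \<omega>)"
      show "d / K < norm (X n \<omega>) \<or> K0 < norm (W n \<omega>)"
      proof (rule ccontr)
        assume "\<not> ?thesis"
        then have "norm (X n \<omega>) \<le> d / K" "norm (W n \<omega>) \<le> K" using K by auto
        then have "norm (X n \<omega>) * norm (W n \<omega>) \<le> d / K * K"
          using d K by (intro mult_mono) auto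
        with * le[of n \<omega>] K show False by simp
      qed
    qed measurable
    with elim show ?case by simp
  qed
qed

lemma prob_norm_gt_tendsto_0:
  fixes X :: "'a \<Rightarrow> 'b::euclidean_space"
  assumes [measurable]: "X \<in> borel_measurable M"
  shows "(\<lambda>k. prob {\<omega> \<in> space M. norm (X \<omega>) > real k}) \<longlonglongrightarrow> 0"
proof -
  have "(\<lambda>k. prob {\<omega> \<in> space M. norm (X \<omega>) > real k}) \<longlonglongrightarrow>
      prob (\<Inter>k. {\<omega> \<in> space M. norm (X \<omega>) > real k})"
    by (intro finite_Lim_measure_decseq) (auto simp: decseq_def)
  moreover have "(\<Inter>k. {\<omega> \<in> space M. norm (X \<omega>) > real k}) = {}"
    by auto (metis reals_Archimedean2 not_less_iff_gr_or_eq)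
  ultimately show ?thesis by simp
qed

lemma tight_seq_const:
  fixes X :: "'a \<Rightarrow> 'b::euclidean_space"
  assumes [measurable]: "X \<in> borel_measurable M"
  shows "tight_seq M (\<lambda>_. X)"
  unfolding tight_seq_def
proof (intro allI impI)
  fix e :: real assume "e > 0"
  then have "\<forall>\<^sub>F k in sequentially. prob {\<omega> \<in> space M. norm (X \<omega>) > real k} < e"
    by (rule order_tendstoD(2)[OF prob_norm_gt_tendsto_0[OF assms]])
  then show "\<exists>K. \<forall>\<^sub>F n in sequentially. prob {\<omega> \<in> space M. norm (X \<omega>) > K} < e"
    by (auto simp: eventually_sequentially)
qed

lemma tight_seq_Pair:
  fixes X :: "nat \<Rightarrow> 'a \<Rightarrow> 'b::euclidean_space" and Y :: "nat \<Rightarrow> 'a \<Rightarrow> 'c::euclidean_space"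
  assumes X: "tight_seq M X" and [measurable]: "\<And>n. X n \<in> borel_measurable M"
    and Y: "tight_seq M Y" and [measurable]: "\<And>n. Y n \<in> borel_measurable M"
  shows "tight_seq M (\<lambda>n \<omega>. (X n \<omega>, Y n \<omega>))"
  unfolding tight_seq_def
proof (intro allI impI)
  fix e :: real assume e: "e > 0"
  obtain K where K: "\<forall>\<^sub>F n in sequentially. prob {\<omega> \<in> space M. norm (X n \<omega>) > K} < e / 2"
    using tight_seqD[OF X, of "e / 2"] e by auto
  obtain L where L: "\<forall>\<^sub>F n in sequentially. prob {\<omega> \<in> space M. norm (Y n \<omega>) > L} < e / 2"
    using tight_seqD[OF Y, of "e / 2"] e by auto
  from K L have "\<forall>\<^sub>F n in sequentially. prob {\<omega> \<in> space M. norm (X n \<omega>, Y n \<omega>) > K + L} < e"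
  proof eventually_elim
    case (elim n)
    have "prob {\<omega> \<in> space M. norm (X n \<omega>, Y n \<omega>) > K + L} \<le>
        prob {\<omega> \<in> space M. norm (X n \<omega>) > K} + prob {\<omega> \<in> space M. norm (Y n \<omega>) > L}"
    proof (rule prob_le_add; (intro AE_I2 impI)?)
      fix \<omega> assume "K + L < norm (X n \<omega>, Y n \<omega>)"
      then show "K < norm (X n \<omega>) \<or> L < norm (Y n \<omega>)"
        using norm_Pair_le[of "X n \<omega>" "Y n \<omega>"] by linarith
    qed measurable
    with elim show ?case by simp
  qed
  then show "\<exists>K. \<forall>\<^sub>F n in sequentially. prob {\<omega> \<in> space M. norm (X n \<omega>, Y n \<omega>) > K} < e" ..
qed

text \<open>For a sequence bounded in terms of itself: once \<open>H\<close> is at most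
  \<open>L\<close> and \<open>D n\<close> is small, the term with \<open>W n\<close> on the right is
  absorbed into the left side.\<close>

lemma tight_seq_self_bound:
  fixes H :: "'a \<Rightarrow> real" and D :: "nat \<Rightarrow> 'a \<Rightarrow> 'b::euclidean_space"
    and V :: "nat \<Rightarrow> 'a \<Rightarrow> 'c::euclidean_space" and W :: "nat \<Rightarrow> 'a \<Rightarrow> 'd::euclidean_space"
  assumes [measurable]: "H \<in> borel_measurable M" "\<And>n. D n \<in> borel_measurable M"
      "\<And>n. V n \<in> borel_measurable M"
    and D: "converges_in_prob M D (\<lambda>_. 0)" and V: "tight_seq M V"
    and le: "\<forall>\<^sub>F n in sequentially. AE \<omega> in M.
      norm (W n \<omega>) \<le> H \<omega> * (norm (V n \<omega>) + norm (D n \<omega>) * norm (W n \<omega>))"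
  shows "tight_seq M W"
  unfolding tight_seq_def
proof (intro allI impI)
  fix e :: real assume e: "e > 0"
  obtain K0 where K0: "\<forall>\<^sub>F n in sequentially. prob {\<omega> \<in> space M. norm (V n \<omega>) > K0} < e / 3"
    using tight_seqD[OF V, of "e / 3"] e by auto
  obtain L0 where L0: "\<forall>\<^sub>F n in sequentially. prob {\<omega> \<in> space M. norm (H \<omega>) > L0} < e / 3"
    using tight_seqD[OF tight_seq_const[OF assms(1)], of "e / 3"] e by auto
  define L where "L = max 1 L0"
  have L: "L > 0" "L0 \<le> L" by (auto simp: L_def)
  \<comment> \<open>At this threshold the absorbed term is at most half of
    \<open>norm (W n \<omega>)\<close>, which leaves the bound \<open>2 * L * K0\<close>.\<close>
  have "\<forall>\<^sub>F n in sequentially. prob {\<omega> \<in> space M. norm (D n \<omega>) > 1 / (2 * L)} < e / 3"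
    using e L by (intro converges_in_prob_zeroD[OF D]) auto
  with K0 L0 le have "\<forall>\<^sub>F n in sequentially. prob {\<omega> \<in> space M. norm (W n \<omega>) > 2 * L * K0} < e"
  proof eventually_elim
    case (elim n)
    have "prob {\<omega> \<in> space M. norm (W n \<omega>) > 2 * L * K0} \<le>
        prob {\<omega> \<in> space M. norm (V n \<omega>) > K0} +
        prob {\<omega> \<in> space M. norm (H \<omega>) > L0 \<or> norm (D n \<omega>) > 1 / (2 * L)}"
    proof (rule prob_le_add)
      show "AE \<omega> in M. 2 * L * K0 < norm (W n \<omega>) \<longrightarrow>
          K0 < norm (V n \<omega>) \<or> L0 < norm (H \<omega>) \<or> 1 / (2 * L) < norm (D n \<omega>)"
        using elim(3)
      proof eventually_elim
        case (elim \<omega>)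
        show ?case
        proof (intro impI, rule ccontr)
          assume *: "2 * L * K0 < norm (W n \<omega>)"
            and "\<not> (K0 < norm (V n \<omega>) \<or> L0 < norm (H \<omega>) \<or> 1 / (2 * L) < norm (D n \<omega>))"
          then have b: "norm (V n \<omega>) \<le> K0" "H \<omega> \<le> L" "norm (D n \<omega>) \<le> 1 / (2 * L)"
            using L by auto
          have "norm (W n \<omega>) \<le> L * (norm (V n \<omega>) + norm (D n \<omega>) * norm (W n \<omega>))"
            using elim b(2) by (meson add_nonneg_nonneg mult_nonneg_nonneg mult_right_mono norm_ge_zero order_trans)
          also have "\<dots> \<le> L * (K0 + 1 / (2 * L) * norm (W n \<omega>))"
            using b L by (intro mult_left_mono add_mono mult_right_mono) auto
          also have "\<dots> = L * K0 + norm (W n \<omega>) / 2"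
            using L by (simp add: field_simps)
          finally show False using * by simp
        qed
      qed
    qed measurable
    moreover have "prob {\<omega> \<in> space M. norm (H \<omega>) > L0 \<or> norm (D n \<omega>) > 1 / (2 * L)} \<le>
        prob {\<omega> \<in> space M. norm (H \<omega>) > L0} + prob {\<omega> \<in> space M. norm (D n \<omega>) > 1 / (2 * L)}"
      by (rule prob_le_add) auto
    ultimately show ?case using elim by simp
  qed
  then show "\<exists>K. \<forall>\<^sub>F n in sequentially. prob {\<omega> \<in> space M. norm (W n \<omega>) > K} < e" ..
qed

text \<open>Bounded convergence in probability: the uniform bound pays for the unlikely event on
  which \<open>X n\<close> exceeds \<open>e / 2\<close>.\<close>

lemma converges_in_prob_bounded_expectation:
  fixes X :: "nat \<Rightarrow> 'a \<Rightarrow> 'b::euclidean_space"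
  assumes [measurable]: "\<And>n. X n \<in> borel_measurable M"
    and X: "converges_in_prob M X (\<lambda>_. 0)"
    and bound: "\<And>n. AE \<omega> in M. norm (X n \<omega>) \<le> C"
  shows "(\<lambda>n. expectation (\<lambda>\<omega>. norm (X n \<omega>))) \<longlonglongrightarrow> 0"
proof -
  define C' where "C' = max 1 C"
  have C': "C' > 0" "C \<le> C'" by (auto simp: C'_def)
  have "\<forall>\<^sub>F n in sequentially. expectation (\<lambda>\<omega>. norm (X n \<omega>)) < e" if e: "e > 0" for e
  proof -
    have "\<forall>\<^sub>F n in sequentially. prob {\<omega> \<in> space M. norm (X n \<omega>) > e / 2} < e / (2 * C')"
      using e C' by (intro converges_in_prob_zeroD[OF X]) auto
    then show ?thesis
    proof eventually_elim
      case (elim n)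
      let ?A = "{\<omega> \<in> space M. norm (X n \<omega>) > e / 2}"
      have [measurable]: "?A \<in> events" by measurable
      have int: "integrable M (\<lambda>\<omega>. norm (X n \<omega>))"
        using bound[of n] by (intro integrable_const_bound[where B = C]) auto
      have "expectation (\<lambda>\<omega>. norm (X n \<omega>)) \<le> expectation (\<lambda>\<omega>. e / 2 + C' * indicator ?A \<omega>)"
      proof (rule integral_mono_AE[OF int])
        show "AE \<omega> in M. norm (X n \<omega>) \<le> e / 2 + C' * indicator ?A \<omega>"
          using bound[of n] AE_space
          by eventually_elim (use C' e in \<open>auto split: split_indicator\<close>)
      qed (intro Bochner_Integration.integrable_add integrable_mult_right integrable_real_indicator,
          auto simp: less_top[symmetric])
      also have "\<dots> = e / 2 + C' * prob ?A"
        by (subst Bochner_Integration.integral_add) (auto simp: prob_space less_top[symmetric] intro!: integrable_mult_right integrable_real_indicator)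
      also have "\<dots> < e / 2 + C' * (e / (2 * C'))"
        using elim C' by (intro add_strict_left_mono mult_strict_left_mono) auto
      also have "\<dots> = e" using C' by (simp add: field_simps)
      finally show ?case .
    qed
  qed
  then show ?thesis
    unfolding tendsto_iff by simp
qed

end

section \<open>Characteristic functions of tight sequences\<close>

text \<open>Only sums are generated. Closure under products follows because exponentials multiply,
  so convergence of expectations has to be checked just for one exponential and for a sum.\<close>

inductive trig_sum :: "('b::euclidean_space \<Rightarrow> complex) \<Rightarrow> bool" where
  iexp: "trig_sum (\<lambda>x. c * iexp (\<theta> \<bullet> x))"
| add: "trig_sum f \<Longrightarrow> trig_sum g \<Longrightarrow> trig_sum (\<lambda>x. f x + g x)"

lemma trig_sum_const: "trig_sum (\<lambda>_. c)"
  using trig_sum.iexp[of c 0] by simp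

lemma trig_sum_iexp_mult: "trig_sum g \<Longrightarrow> trig_sum (\<lambda>x. (c * iexp (\<theta> \<bullet> x)) * g x)"
proof (induction rule: trig_sum.induct)
  case (iexp d \<theta>')
  have "(\<lambda>x. (c * iexp (\<theta> \<bullet> x)) * (d * iexp (\<theta>' \<bullet> x))) = (\<lambda>x. (c * d) * iexp ((\<theta> + \<theta>') \<bullet> x))"
    by (simp add: fun_eq_iff inner_add_left algebra_simps exp_add)
  then show ?case by (simp only: trig_sum.iexp)
next
  case (add f g)
  then show ?case using trig_sum.add by (fastforce simp: distrib_left)
qed

lemma trig_sum_mult: "trig_sum f \<Longrightarrow> trig_sum g \<Longrightarrow> trig_sum (\<lambda>x. f x * g x)"
proof (induction rule: trig_sum.induct)
  case (iexp c \<theta>)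
  then show ?case by (rule trig_sum_iexp_mult)
next
  case (add f1 f2)
  then show ?case using trig_sum.add by (fastforce simp: distrib_right)
qed

lemma trig_sum_sum: "(\<And>i. i \<in> I \<Longrightarrow> trig_sum (f i)) \<Longrightarrow> trig_sum (\<lambda>x. \<Sum>i\<in>I. f i x)"
  by (induction I rule: infinite_finite_induct) (auto intro: trig_sum_const trig_sum.add)

lemma trig_sum_sin: "trig_sum (\<lambda>x. of_real (sin (\<theta> \<bullet> x)))"
proof -
  have "complex_of_real (sin t) = (-\<i>/2) * iexp t + (\<i>/2) * iexp (-t)" for t
    by (simp add: complex_eq_iff Re_exp Im_exp)
  then have "(\<lambda>x. complex_of_real (sin (\<theta> \<bullet> x))) = (\<lambda>x. (-\<i>/2) * iexp (\<theta> \<bullet> x) + (\<i>/2) * iexp ((-\<theta>) \<bullet> x))"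
    by (simp add: inner_minus_left)
  then show ?thesis by (simp only: trig_sum.intros)
qed

text \<open>The coordinatewise sine maps the whole space into a cube, so a polynomial on the cube
  becomes a bounded trigonometric polynomial.\<close>

lemma trig_sum_polynomial_sin:
  fixes g :: "'b::euclidean_space \<Rightarrow> real"
  assumes "real_polynomial_function g"
  shows "trig_sum (\<lambda>x :: 'b. of_real (g (\<Sum>b\<in>Basis. sin (x \<bullet> b / L) *\<^sub>R b)))"
  using assms
proof (induction rule: real_polynomial_function.induct)
  case (linear f)
  interpret f: bounded_linear f by fact
  have "trig_sum (\<lambda>x. \<Sum>b\<in>Basis. of_real (sin ((b /\<^sub>R L) \<bullet> x)) * of_real (f b))"
    by (intro trig_sum_sum trig_sum_mult trig_sum_sin trig_sum_const)
  then show ?case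
    by (simp add: f.sum f.scaleR inner_commute field_simps)
next
  case (const c)
  show ?case by (rule trig_sum_const)
next
  case (add f g)
  then show ?case using trig_sum.add by fastforce
next
  case (mult f g)
  then show ?case using trig_sum_mult by fastforce
qed

lemma norm_integral_le_AE:
  fixes f :: "'a \<Rightarrow> 'b::{banach,second_countable_topology}"
  assumes "integrable M f" "integrable M g" "AE x in M. norm (f x) \<le> g x"
  shows "norm (\<integral>x. f x \<partial>M) \<le> (\<integral>x. g x \<partial>M)"
  using integral_norm_bound[of M f] integral_mono_AE[OF integrable_norm[OF assms(1)] assms(2,3)]
  by linarith

lemma trig_sum_continuous: "trig_sum g \<Longrightarrow> continuous_on UNIV g"
  by (induction rule: trig_sum.induct) (auto intro!: continuous_intros)

text \<open>Since \<open>x = L arcsin (sin (x / L))\<close> for small \<open>x\<close>, a polynomial approximating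
  \<open>y \<mapsto> h (L arcsin y)\<close> on the cube \<open>[-1, 1]\<^sup>d\<close> yields a trigonometric polynomial that is close to
  \<open>h\<close> on a ball and that stays bounded everywhere.\<close>

lemma trig_sum_approx:
  fixes h :: "'b::euclidean_space \<Rightarrow> real"
  assumes h: "continuous_on UNIV h" "\<And>x. \<bar>h x\<bar> \<le> C" and "R > 0" "e > 0"
  shows "\<exists>g. trig_sum g \<and> (\<forall>x. cmod (g x) \<le> C + e) \<and>
    (\<forall>x. norm x \<le> R \<longrightarrow> cmod (g x - of_real (h x)) \<le> e)"
proof -
  \<comment> \<open>The scale at which \<open>norm x \<le> R\<close> puts every
    \<open>x \<bullet> b / L\<close> between \<open>- pi / 2\<close> and \<open>pi / 2\<close>,
    where \<open>arcsin\<close> inverts \<open>sin\<close>.\<close>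
  define L where "L = 2 * R / pi"
  have L: "L > 0" using \<open>R > 0\<close> by (simp add: L_def)
  define H where "H y = h (\<Sum>b\<in>Basis. (L * arcsin (y \<bullet> b)) *\<^sub>R b)" for y :: 'b
  have "continuous_on (cbox (- One) One) H"
    unfolding H_def
    by (intro continuous_on_compose2[OF h(1)] continuous_intros) (auto simp: mem_box)
  then obtain p where p: "real_polynomial_function p"
    "\<And>y. y \<in> cbox (- One) One \<Longrightarrow> \<bar>H y - p y\<bar> < e"
    using Stone_Weierstrass_real_polynomial_function[OF compact_cbox _ \<open>e > 0\<close>] by metis
  define s where "s x = (\<Sum>b\<in>Basis. sin (x \<bullet> b / L) *\<^sub>R b)" for x :: 'b
  have s_inner: "s x \<bullet> b = sin (x \<bullet> b / L)" if "b \<in> Basis" for x b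
    using that by (simp add: s_def)
  then have s: "s x \<in> cbox (- One) One" for x
    by (simp add: mem_box)
  \<comment> \<open>All values of \<open>s\<close> lie in the cube, and there \<open>p\<close> is
    within \<open>e\<close> of a value of \<open>h\<close>; hence a bound for every
    \<open>x\<close>.\<close>
  have "cmod (of_real (p (s x))) \<le> C + e" for x
    using p(2)[OF s, of x] h(2)[of "\<Sum>b\<in>Basis. (L * arcsin (s x \<bullet> b)) *\<^sub>R b"]
    by (simp add: H_def)
  moreover have "cmod (of_real (p (s x)) - of_real (h x)) \<le> e" if "norm x \<le> R" for x
  proof -
    have "(L * arcsin (s x \<bullet> b)) *\<^sub>R b = (x \<bullet> b) *\<^sub>R b" if b: "b \<in> Basis" for b
    proof -
      have "\<bar>x \<bullet> b\<bar> \<le> R" using Basis_le_norm[OF b, of x] \<open>norm x \<le> R\<close> by linarith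
      then have "\<bar>x \<bullet> b / L\<bar> \<le> pi / 2"
        using L \<open>R > 0\<close> by (simp add: L_def field_simps abs_mult)
      then have "arcsin (sin (x \<bullet> b / L)) = x \<bullet> b / L"
        by (intro arcsin_sin; linarith)
      then show ?thesis using L b by (simp add: s_inner)
    qed
    then have "(\<Sum>b\<in>Basis. (L * arcsin (s x \<bullet> b)) *\<^sub>R b) = x"
      by (metis (no_types, lifting) euclidean_representation sum.cong)
    then have "H (s x) = h x"
      by (simp add: H_def)
    then show ?thesis
      using p(2)[OF s, of x] by (simp flip: of_real_diff)
  qed
  moreover have "trig_sum (\<lambda>x. of_real (p (s x)))"
    unfolding s_def by (rule trig_sum_polynomial_sin[OF p(1)])
  ultimately show ?thesis by blast
qed

section \<open>From characteristic functions to bounded continuous functions\<close>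

context prob_space
begin

lemma integrable_bounded_mult:
  fixes f g :: "'a \<Rightarrow> complex"
  assumes [measurable]: "f \<in> borel_measurable M" "g \<in> borel_measurable M"
    and "\<And>\<omega>. norm (f \<omega>) \<le> C" "\<And>\<omega>. norm (g \<omega>) \<le> D"
  shows "integrable M (\<lambda>\<omega>. f \<omega> * g \<omega>)"
proof (rule integrable_const_bound[where B = "C * D"])
  have "0 \<le> C" using assms(3) norm_ge_zero order_trans by blast
  then show "AE \<omega> in M. norm (f \<omega> * g \<omega>) \<le> C * D"
    using assms(3,4) by (auto simp: norm_mult intro!: mult_mono)
qed simp

lemma expectation_diff_bound:
  fixes \<xi> :: "'a \<Rightarrow> complex" and X :: "'a \<Rightarrow> 'b::euclidean_space" and f g :: "'b \<Rightarrow> complex"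
  assumes [measurable]: "\<xi> \<in> borel_measurable M" "X \<in> borel_measurable M"
      "f \<in> borel_measurable borel" "g \<in> borel_measurable borel"
    and \<xi>: "\<And>\<omega>. norm (\<xi> \<omega>) \<le> C"
    and f: "\<And>x. norm (f x) \<le> D" and g: "\<And>x. norm (g x) \<le> D"
    and fg: "\<And>x. norm x \<le> R \<Longrightarrow> norm (f x - g x) \<le> d" and d: "d \<ge> 0"
  shows "norm ((\<integral>\<omega>. \<xi> \<omega> * f (X \<omega>) \<partial>M) - (\<integral>\<omega>. \<xi> \<omega> * g (X \<omega>) \<partial>M)) \<le>
    C * (d + 2 * D * prob {\<omega> \<in> space M. norm (X \<omega>) > R})"
proof -
  let ?A = "{\<omega> \<in> space M. norm (X \<omega>) > R}"
  have C: "0 \<le> C" using \<xi> norm_ge_zero order_trans by blast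
  have D: "0 \<le> D" using f norm_ge_zero order_trans by blast
  have int: "integrable M (\<lambda>\<omega>. \<xi> \<omega> * f (X \<omega>))" "integrable M (\<lambda>\<omega>. \<xi> \<omega> * g (X \<omega>))"
    by (rule integrable_bounded_mult[where C = C and D = D]; use \<xi> f g in simp)+
  have "norm ((\<integral>\<omega>. \<xi> \<omega> * f (X \<omega>) \<partial>M) - (\<integral>\<omega>. \<xi> \<omega> * g (X \<omega>) \<partial>M)) =
      norm (\<integral>\<omega>. \<xi> \<omega> * f (X \<omega>) - \<xi> \<omega> * g (X \<omega>) \<partial>M)"
    using int by simp
  also have "\<dots> \<le> (\<integral>\<omega>. C * (d + 2 * D * indicator ?A \<omega>) \<partial>M)"
  proof (rule norm_integral_le_AE, goal_cases)
    case 3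
    show ?case
    proof (rule AE_I2)
    fix \<omega> assume "\<omega> \<in> space M"
    have "norm (\<xi> \<omega> * f (X \<omega>) - \<xi> \<omega> * g (X \<omega>)) = norm (\<xi> \<omega>) * norm (f (X \<omega>) - g (X \<omega>))"
      by (simp flip: right_diff_distrib norm_mult)
    also have "\<dots> \<le> C * (d + 2 * D * indicator ?A \<omega>)"
    proof (intro mult_mono \<xi> C)
      show "norm (f (X \<omega>) - g (X \<omega>)) \<le> d + 2 * D * indicator ?A \<omega>"
      proof (cases "norm (X \<omega>) \<le> R")
        case True
        then show ?thesis using fg by simp
      next
        case False
        then have "norm (f (X \<omega>) - g (X \<omega>)) \<le> D + D"
          using f[of "X \<omega>"] g[of "X \<omega>"] norm_triangle_ineq4[of "f (X \<omega>)" "g (X \<omega>)"] by linarith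
        then show ?thesis using False \<open>\<omega> \<in> space M\<close> d by simp
      qed
    qed simp
    finally show "norm (\<xi> \<omega> * f (X \<omega>) - \<xi> \<omega> * g (X \<omega>)) \<le> C * (d + 2 * D * indicator ?A \<omega>)" .
    qed
  next
    case 2
    show "integrable M (\<lambda>\<omega>. C * (d + 2 * D * indicator ?A \<omega>))"
      by (intro integrable_mult_right Bochner_Integration.integrable_add integrable_real_indicator)
         (auto simp: less_top[symmetric])
  qed (use int in simp)
  also have "\<dots> = C * (d + 2 * D * prob ?A)"
    by (subst integral_mult_right_zero, subst Bochner_Integration.integral_add)
       (auto simp: prob_space less_top[symmetric] intro!: integrable_mult_right integrable_real_indicator)
  finally show ?thesis .
qed

lemma trig_sum_bounded: "trig_sum g \<Longrightarrow> \<exists>C. \<forall>x. norm (g x) \<le> C"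
proof (induction rule: trig_sum.induct)
  case (iexp c \<theta>)
  show ?case by (intro exI[of _ "norm c"]) (simp add: norm_mult)
next
  case (add f g)
  then obtain C D where "\<And>x. norm (f x) \<le> C" "\<And>x. norm (g x) \<le> D" by blast
  then show ?case
    by (intro exI[of _ "C + D"]) (auto intro: norm_triangle_mono)
qed

lemma trig_sum_expectation_tendsto:
  fixes \<xi> :: "'a \<Rightarrow> complex" and X :: "nat \<Rightarrow> 'a \<Rightarrow> 'b::euclidean_space"
  assumes "trig_sum g"
    and [measurable]: "\<xi> \<in> borel_measurable M" "\<And>n. X n \<in> borel_measurable M" "Y \<in> borel_measurable M"
    and \<xi>: "\<And>\<omega>. norm (\<xi> \<omega>) \<le> C"
    and lim: "\<And>\<theta>. (\<lambda>n. \<integral>\<omega>. \<xi> \<omega> * iexp (\<theta> \<bullet> X n \<omega>) \<partial>M) \<longlonglongrightarrow> (\<integral>\<omega>. \<xi> \<omega> * iexp (\<theta> \<bullet> Y \<omega>) \<partial>M)"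
  shows "(\<lambda>n. \<integral>\<omega>. \<xi> \<omega> * g (X n \<omega>) \<partial>M) \<longlonglongrightarrow> (\<integral>\<omega>. \<xi> \<omega> * g (Y \<omega>) \<partial>M)"
  using assms(1)
proof (induction rule: trig_sum.induct)
  case (iexp c \<theta>)
  have "(\<lambda>n. c * (\<integral>\<omega>. \<xi> \<omega> * iexp (\<theta> \<bullet> X n \<omega>) \<partial>M)) \<longlonglongrightarrow> c * (\<integral>\<omega>. \<xi> \<omega> * iexp (\<theta> \<bullet> Y \<omega>) \<partial>M)"
    by (intro tendsto_mult_left lim)
  then show ?case
    by (simp add: mult.left_commute flip: integral_mult_right_zero)
next
  case (add f g)
  have [measurable]: "f \<in> borel_measurable borel" "g \<in> borel_measurable borel"
    using add.hyps by (auto intro!: borel_measurable_continuous_onI trig_sum_continuous)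
  obtain Cf Cg where "\<And>x. norm (f x) \<le> Cf" "\<And>x. norm (g x) \<le> Cg"
    using add.hyps trig_sum_bounded by metis
  then have "integrable M (\<lambda>\<omega>. \<xi> \<omega> * f (Z \<omega>))" "integrable M (\<lambda>\<omega>. \<xi> \<omega> * g (Z \<omega>))"
    if "Z \<in> borel_measurable M" for Z
    using that \<xi> by (auto intro!: integrable_bounded_mult)
  then show ?case
    using tendsto_add[OF add.IH] by (simp add: distrib_left)
qed

text \<open>A trigonometric polynomial close to \<open>h\<close> on a large ball keeps nearly the
  bound of \<open>h\<close> elsewhere, so the tails, whose probability is small for all late
  \<open>n\<close>, cost little.\<close>

lemma tight_charfun_imp_expectation_tendsto:
  fixes \<xi> :: "'a \<Rightarrow> complex" and X :: "nat \<Rightarrow> 'a \<Rightarrow> 'b::euclidean_space" and h :: "'b \<Rightarrow> real"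
  assumes [measurable]: "\<xi> \<in> borel_measurable M" "\<And>n. X n \<in> borel_measurable M" "Y \<in> borel_measurable M"
    and \<xi>: "\<And>\<omega>. norm (\<xi> \<omega>) \<le> C"
    and tight: "tight_seq M X"
    and lim: "\<And>\<theta>. (\<lambda>n. \<integral>\<omega>. \<xi> \<omega> * iexp (\<theta> \<bullet> X n \<omega>) \<partial>M) \<longlonglongrightarrow> (\<integral>\<omega>. \<xi> \<omega> * iexp (\<theta> \<bullet> Y \<omega>) \<partial>M)"
    and h: "continuous_on UNIV h" "\<And>x. \<bar>h x\<bar> \<le> D"
  shows "(\<lambda>n. \<integral>\<omega>. \<xi> \<omega> * of_real (h (X n \<omega>)) \<partial>M) \<longlonglongrightarrow> (\<integral>\<omega>. \<xi> \<omega> * of_real (h (Y \<omega>)) \<partial>M)"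
proof -
  have C: "0 \<le> C" using \<xi> norm_ge_zero order_trans by blast
  have D: "0 \<le> D" using h(2) abs_ge_zero order_trans by blast
  have [measurable]: "h \<in> borel_measurable borel"
    using h(1) by (rule borel_measurable_continuous_onI)
  have "\<forall>\<^sub>F n in sequentially. norm ((\<integral>\<omega>. \<xi> \<omega> * of_real (h (X n \<omega>)) \<partial>M) -
      (\<integral>\<omega>. \<xi> \<omega> * of_real (h (Y \<omega>)) \<partial>M)) < e" if e: "e > 0" for e
  proof -
    \<comment> \<open>\<open>D + 1\<close> bounds both \<open>h\<close> and its approximation, as
      \<open>d \<le> 1\<close>; the error is then \<open>(E - 1) * d\<close>. The summand 1 permits
      division by \<open>E\<close> also if \<open>C = 0\<close>.\<close>
    define E where "E = C * (1 + 2 * (D + 1)) + 1"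
    have E: "E \<ge> 1" unfolding E_def using C D by simp
    define d where "d = min 1 (e / (3 * E))"
    have d: "d > 0" "d \<le> 1" "E * d \<le> e / 3"
      using e E by (auto simp: d_def min_def field_simps)
    obtain K where K: "\<forall>\<^sub>F n in sequentially. prob {\<omega> \<in> space M. norm (X n \<omega>) > K} < d"
      using tight_seqD[OF tight d(1)] .
    obtain L where "\<forall>\<^sub>F n::nat in sequentially. prob {\<omega> \<in> space M. norm (Y \<omega>) > L} < d"
      using tight_seqD[OF tight_seq_const d(1), of Y] by auto
    then have L: "prob {\<omega> \<in> space M. norm (Y \<omega>) > L} < d"
      by (auto simp: eventually_sequentially)
    define R where "R = max 1 (max K L)"
    obtain g where g: "trig_sum g" "\<And>x. cmod (g x) \<le> D + d"
      "\<And>x. norm x \<le> R \<Longrightarrow> cmod (g x - of_real (h x)) \<le> d"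
    proof -
      have "R > 0" by (simp add: R_def)
      from trig_sum_approx[OF h this d(1)] that show ?thesis by blast
    qed
    have [measurable]: "g \<in> borel_measurable borel"
      using g(1) by (intro borel_measurable_continuous_onI trig_sum_continuous)
    have approx: "norm ((\<integral>\<omega>. \<xi> \<omega> * of_real (h (Z \<omega>)) \<partial>M) - (\<integral>\<omega>. \<xi> \<omega> * g (Z \<omega>) \<partial>M)) \<le> e / 3"
      if [measurable]: "Z \<in> borel_measurable M"
        and k: "k \<le> R" "prob {\<omega> \<in> space M. norm (Z \<omega>) > k} < d" for Z k
    proof -
      have "norm ((\<integral>\<omega>. \<xi> \<omega> * of_real (h (Z \<omega>)) \<partial>M) - (\<integral>\<omega>. \<xi> \<omega> * g (Z \<omega>) \<partial>M)) \<le>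
          C * (d + 2 * (D + 1) * prob {\<omega> \<in> space M. norm (Z \<omega>) > R})"
      proof (rule expectation_diff_bound[where f = "\<lambda>x. of_real (h x)"])
        show "norm (g x) \<le> D + 1" for x using g(2)[of x] d by simp
        show "norm (complex_of_real (h x)) \<le> D + 1" for x using h(2)[of x] by simp
      qed (use \<xi> g(3) d in \<open>auto simp: norm_minus_commute\<close>)
      also have "prob {\<omega> \<in> space M. norm (Z \<omega>) > R} \<le> prob {\<omega> \<in> space M. norm (Z \<omega>) > k}"
        using k(1) by (intro finite_measure_mono) auto
      also have "\<dots> \<le> d" using k(2) by simp
      also have "C * (d + 2 * (D + 1) * d) = (E - 1) * d"
        by (simp add: E_def algebra_simps)
      also have "\<dots> \<le> e / 3" using d by (simp add: algebra_simps)
      finally show ?thesis using C D by (simp add: mult_left_mono)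
    qed
    have "\<forall>\<^sub>F n in sequentially. norm ((\<integral>\<omega>. \<xi> \<omega> * g (X n \<omega>) \<partial>M) - (\<integral>\<omega>. \<xi> \<omega> * g (Y \<omega>) \<partial>M)) < e / 3"
      using tendstoD[OF trig_sum_expectation_tendsto[OF g(1) assms(1-3) \<xi> lim], of "e / 3"] e
      unfolding dist_norm by simp
    with K show ?thesis
    proof eventually_elim
      case (elim n)
      have "norm ((\<integral>\<omega>. \<xi> \<omega> * of_real (h (X n \<omega>)) \<partial>M) - (\<integral>\<omega>. \<xi> \<omega> * g (X n \<omega>) \<partial>M)) \<le> e / 3"
        by (rule approx[OF _ _ elim(1)]) (auto simp: R_def)
      moreover have "norm ((\<integral>\<omega>. \<xi> \<omega> * of_real (h (Y \<omega>)) \<partial>M) - (\<integral>\<omega>. \<xi> \<omega> * g (Y \<omega>) \<partial>M)) \<le> e / 3"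
        by (rule approx[OF _ _ L]) (auto simp: R_def)
      ultimately show ?case
        using elim(2) by norm
    qed
  qed
  then show ?thesis
    unfolding tendsto_iff by (simp add: dist_norm)
qed

end

section \<open>Weights measurable for the limit of a filtration\<close>

text \<open>An interchange of limits: the comparison sequence may depend on the accuracy, and its
  limit need only be near \<open>l\<close>.\<close>

lemma tendsto_uniform_approx:
  fixes a :: "nat \<Rightarrow> 'b::real_normed_vector"
  assumes "\<And>e. e > 0 \<Longrightarrow> \<exists>b m. b \<longlonglongrightarrow> m \<and> (\<forall>\<^sub>F n in sequentially. norm (a n - b n) \<le> e) \<and> norm (l - m) \<le> e"
  shows "a \<longlonglongrightarrow> l"
  unfolding tendsto_iff dist_norm
proof (intro allI impI)
  fix e :: real assume e: "e > 0"
  then obtain b m where "b \<longlonglongrightarrow> m" and b: "\<forall>\<^sub>F n in sequentially. norm (a n - b n) \<le> e / 4"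
    and m: "norm (l - m) \<le> e / 4"
    using assms[of "e / 4"] by auto
  then have "\<forall>\<^sub>F n in sequentially. norm (b n - m) < e / 4"
    using tendstoD[of b m sequentially "e / 4"] e by (simp add: dist_norm)
  with b show "\<forall>\<^sub>F n in sequentially. norm (a n - l) < e"
  proof eventually_elim
    case (elim n)
    have "norm (a n - l) \<le> norm (a n - b n) + norm (b n - m) + norm (m - l)"
      by norm
    then show ?case using elim m e by (simp add: norm_minus_commute)
  qed
qed

lemma integral_complex_eq:
  fixes f :: "'a \<Rightarrow> complex"
  assumes "integrable M f"
  shows "(\<integral>x. f x \<partial>M) = Complex (\<integral>x. Re (f x) \<partial>M) (\<integral>x. Im (f x) \<partial>M)"
  using assms by (simp add: complex_eq_iff)

text \<open>Turns the restricted measure into a weight, so that conditional expectations under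
  \<open>M\<close> remain usable.\<close>

lemma integral_uniform_measure:
  fixes f :: "'a \<Rightarrow> 'b::{banach, second_countable_topology}"
  assumes "prob_space M" and [measurable]: "A \<in> sets M" "f \<in> borel_measurable M"
    and pos: "measure M A > 0"
  shows "(\<integral>x. f x \<partial>uniform_measure M A) = (\<integral>x. indicator A x *\<^sub>R f x \<partial>M) /\<^sub>R measure M A"
proof -
  interpret prob_space M by fact
  have "uniform_measure M A = density M (\<lambda>x. ennreal (indicator A x / measure M A))"
    unfolding uniform_measure_def
    by (intro density_cong) (auto simp: emeasure_eq_measure divide_ennreal pos
        ennreal_indicator[symmetric] split: split_indicator)
  then have "(\<integral>x. f x \<partial>uniform_measure M A) =
      (\<integral>x. (indicator A x / measure M A) *\<^sub>R f x \<partial>M)"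
    using pos by (simp add: integral_density)
  also have "\<dots> = (\<integral>x. (1 / measure M A) *\<^sub>R (indicator A x *\<^sub>R f x) \<partial>M)"
    by (intro Bochner_Integration.integral_cong) auto
  also have "\<dots> = (1 / measure M A) *\<^sub>R (\<integral>x. indicator A x *\<^sub>R f x \<partial>M)"
    by (rule integral_scaleR_right)
  finally show ?thesis
    by (simp only: inverse_eq_divide)
qed

context prob_space
begin

lemma sigma_finite_subalgebraI: "subalgebra M G \<Longrightarrow> sigma_finite_subalgebra M G"
  by (intro finite_measure_subalgebra_is_sigma_finite finite_measure_subalgebra.intro
      finite_measure_subalgebra_axioms.intro) unfold_locales

lemma complex_cond_exp_measurable:
  "complex_cond_exp M G f \<in> borel_measurable G"
  unfolding complex_cond_exp_def[abs_def] Complex_eq by measurable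

text \<open>Real and imaginary parts are each bounded by \<open>C\<close>. The crude factor 2 is
  harmless, as only some uniform bound is wanted.\<close>

lemma complex_cond_exp_norm_le:
  assumes "subalgebra M G" and [measurable]: "f \<in> borel_measurable M"
    and f: "\<And>x. norm (f x) \<le> C"
  shows "AE x in M. norm (complex_cond_exp M G f x) \<le> 2 * C"
proof -
  interpret G: sigma_finite_subalgebra M G
    using assms by (intro sigma_finite_subalgebraI)
  have b: "\<bar>Re (f x)\<bar> \<le> C" "\<bar>Im (f x)\<bar> \<le> C" for x
    using f[of x] abs_Re_le_cmod[of "f x"] abs_Im_le_cmod[of "f x"] by linarith+
  have int: "integrable M (\<lambda>x. Re (f x))" "integrable M (\<lambda>x. Im (f x))"
    using b by (auto intro!: integrable_const_bound[where B = C])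
  have "AE x in M. real_cond_exp M G (\<lambda>x. Re (f x)) x \<le> C"
    "AE x in M. real_cond_exp M G (\<lambda>x. Im (f x)) x \<le> C"
    "AE x in M. real_cond_exp M G (\<lambda>x. Re (f x)) x \<ge> - C"
    "AE x in M. real_cond_exp M G (\<lambda>x. Im (f x)) x \<ge> - C"
    using b by (auto intro!: G.real_cond_exp_le_c G.real_cond_exp_ge_c int simp: abs_le_iff minus_le_iff)
  then show ?thesis
  proof eventually_elim
    case (elim x)
    then show ?case
      using cmod_le[of "complex_cond_exp M G f x"] by (simp add: complex_cond_exp_def)
  qed
qed

text \<open>\<open>complex_cond_exp\<close> treats real and imaginary parts separately, so the
  complex product is split into four real ones.\<close>

lemma complex_cond_exp_intg:
  assumes "subalgebra M G" and [measurable]: "W \<in> borel_measurable G" "f \<in> borel_measurable M"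
    and W: "\<And>x. norm (W x) \<le> C" and f: "\<And>x. norm (f x) \<le> D"
  shows "(\<integral>x. W x * complex_cond_exp M G f x \<partial>M) = (\<integral>x. W x * f x \<partial>M)"
proof -
  interpret G: sigma_finite_subalgebra M G
    using assms by (intro sigma_finite_subalgebraI)
  have [measurable]: "W \<in> borel_measurable M"
    using assms(1,2) by (rule measurable_from_subalg)
  have meas: "(\<lambda>x. a (W x)) \<in> borel_measurable G" "(\<lambda>x. b (f x)) \<in> borel_measurable M"
    if "a \<in> {Re, Im}" "b \<in> {Re, Im}" for a b
    using that by auto
  have int: "integrable M (\<lambda>x. a (W x) * b (f x))" if "a \<in> {Re, Im}" "b \<in> {Re, Im}" for a b
  proof (rule integrable_const_bound[where B = "C * D"])
    have a: "\<bar>a (W x)\<bar> \<le> C" "\<bar>b (f x)\<bar> \<le> D" for x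
      using that W[of x] f[of x] abs_Re_le_cmod[of "f x"] abs_Im_le_cmod[of "f x"]
        abs_Re_le_cmod[of "W x"] abs_Im_le_cmod[of "W x"] by fastforce+
    have "0 \<le> C" using W norm_ge_zero order_trans by blast
    with a show "AE x in M. norm (a (W x) * b (f x)) \<le> C * D"
      by (auto simp: abs_mult intro!: mult_mono)
  qed (use that in auto)
  have int': "integrable M (\<lambda>x. a (W x) * real_cond_exp M G (\<lambda>x. b (f x)) x)"
    and eq: "(\<integral>x. a (W x) * real_cond_exp M G (\<lambda>x. b (f x)) x \<partial>M) = (\<integral>x. a (W x) * b (f x) \<partial>M)"
    if "a \<in> {Re, Im}" "b \<in> {Re, Im}" for a b
    by (rule G.real_cond_exp_intg[OF int[OF that] meas[OF that]])+
  note int = int[of Re Re, simplified] int[of Re Im, simplified]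
      int[of Im Re, simplified] int[of Im Im, simplified]
  note int' = int'[of Re Re, simplified] int'[of Re Im, simplified]
      int'[of Im Re, simplified] int'[of Im Im, simplified]
  note eq = eq[of Re Re, simplified] eq[of Re Im, simplified]
      eq[of Im Re, simplified] eq[of Im Im, simplified]
  have "integrable M (\<lambda>x. W x * f x)"
    using W f by (intro integrable_bounded_mult) auto
  then have r: "(\<integral>x. W x * f x \<partial>M) = Complex
      ((\<integral>x. Re (W x) * Re (f x) \<partial>M) - (\<integral>x. Im (W x) * Im (f x) \<partial>M))
      ((\<integral>x. Re (W x) * Im (f x) \<partial>M) + (\<integral>x. Im (W x) * Re (f x) \<partial>M))"
    using int by (simp add: integral_complex_eq)
  let ?R = "real_cond_exp M G (\<lambda>x. Re (f x))" and ?I = "real_cond_exp M G (\<lambda>x. Im (f x))"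
  have "integrable M (\<lambda>x. Complex (Re (W x) * ?R x - Im (W x) * ?I x) (Re (W x) * ?I x + Im (W x) * ?R x))"
    unfolding Complex_eq using int'
    by (intro Bochner_Integration.integrable_add Bochner_Integration.integrable_diff
        integrable_mult_right integrable_of_real) auto
  moreover have "(\<lambda>x. W x * complex_cond_exp M G f x) =
      (\<lambda>x. Complex (Re (W x) * ?R x - Im (W x) * ?I x) (Re (W x) * ?I x + Im (W x) * ?R x))"
    by (simp add: fun_eq_iff complex_eq_iff complex_cond_exp_def)
  ultimately have l: "(\<integral>x. W x * complex_cond_exp M G f x \<partial>M) = Complex
      ((\<integral>x. Re (W x) * ?R x \<partial>M) - (\<integral>x. Im (W x) * ?I x \<partial>M))
      ((\<integral>x. Re (W x) * ?I x \<partial>M) + (\<integral>x. Im (W x) * ?R x \<partial>M))"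
    using int' by (simp add: integral_complex_eq)
  show ?thesis
    unfolding l r using eq by simp
qed

end

locale filtered_prob_space = prob_space M + filtration "space M" F
  for M :: "'a measure" and F :: "nat \<Rightarrow> 'a measure" +
  assumes subalgebra_F: "\<And>n. subalgebra M (F n)"
begin

abbreviation "Finf \<equiv> filtration_limit M F"

lemma Union_F_Pow: "(\<Union>k. sets (F k)) \<subseteq> Pow (space M)"
  using sets.space_closed[of "F _"] by (auto simp: space_F)

lemma space_Finf: "space Finf = space M"
  by (simp add: filtration_limit_def space_measure_of_conv)

lemma sets_Finf: "sets Finf = sigma_sets (space M) (\<Union>k. sets (F k))"
  unfolding filtration_limit_def by (rule sets_measure_of[OF Union_F_Pow])

lemma subalgebra_Finf: "subalgebra M Finf"
  unfolding subalgebra_def space_Finf sets_Finf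
  using subalgebra_F by (auto simp: subalgebra_def intro!: sets.sigma_sets_subset)

lemma measurable_F_mono: "f \<in> measurable (F i) N \<Longrightarrow> i \<le> j \<Longrightarrow> f \<in> measurable (F j) N"
  using sets_F_mono[of i j] by (auto simp: measurable_def space_F)

text \<open>Conditional centring at ever later times makes a bounded sequence weakly null against every
  \<open>Finf\<close>-measurable weight; the Dynkin argument replaces martingale convergence.\<close>

lemma weakly_null_if_eventually_orthogonal:
  fixes g :: "nat \<Rightarrow> 'a \<Rightarrow> complex"
  assumes [measurable]: "\<And>n. g n \<in> borel_measurable M"
    and bound: "\<And>n. AE \<omega> in M. norm (g n \<omega>) \<le> C"
    and orth: "\<And>k D. D \<in> sets (F k) \<Longrightarrow> \<forall>\<^sub>F n in sequentially. (\<integral>\<omega>. indicator D \<omega> * g n \<omega> \<partial>M) = 0"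
    and \<zeta>: "\<zeta> \<in> borel_measurable Finf" "integrable M \<zeta>"
  shows "(\<lambda>n. \<integral>\<omega>. \<zeta> \<omega> * g n \<omega> \<partial>M) \<longlonglongrightarrow> 0"
proof -
  \<comment> \<open>The weights for which the claim holds. They are shown to be a linear class,
    closed under dominated limits and containing the indicators of \<open>Finf\<close>.\<close>
  define P where "P f \<longleftrightarrow> (\<lambda>n. \<integral>\<omega>. f \<omega> * g n \<omega> \<partial>M) \<longlonglongrightarrow> 0" for f :: "'a \<Rightarrow> complex"
  have C: "0 \<le> C"
  proof -
    have "AE \<omega> in M. 0 \<le> C"
      using bound[of 0] by eventually_elim (use norm_ge_zero order_trans in blast)
    then show ?thesis by simp
  qed
  have int: "integrable M (\<lambda>\<omega>. f \<omega> * g n \<omega>)" if "integrable M f" for f n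
  proof (rule Bochner_Integration.integrable_bound)
    show "integrable M (\<lambda>\<omega>. C * norm (f \<omega>))" using that by simp
    show "AE \<omega> in M. norm (f \<omega> * g n \<omega>) \<le> norm (C * norm (f \<omega>))"
      using bound[of n] by eventually_elim
        (simp add: C norm_mult mult.commute[of C] mult_left_mono)
    have [measurable]: "f \<in> borel_measurable M" using that by simp
    show "(\<lambda>\<omega>. f \<omega> * g n \<omega>) \<in> borel_measurable M" by simp
  qed
  have P_add: "P (\<lambda>x. f x + h x)" if "integrable M f" "integrable M h" "P f" "P h" for f h
    using tendsto_add[OF that(3,4)[unfolded P_def]] int[OF that(1)] int[OF that(2)]
    by (simp add: P_def distrib_right)
  have P_cmult: "P (\<lambda>x. f x * c)" if "P f" for f c
    using tendsto_mult_right[OF that[unfolded P_def], of c]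
    by (simp add: P_def mult.commute mult.left_commute flip: integral_mult_right_zero)
  \<comment> \<open>Since \<open>g n\<close> is bounded by \<open>C\<close>, replacing the weight
    costs at most \<open>C\<close> times the L1 distance, uniformly in \<open>n\<close>.\<close>
  have P_lim: "P f" if s: "\<And>i. integrable M (s i)" "\<And>i. P (s i)"
    and lim: "\<And>x. x \<in> space M \<Longrightarrow> (\<lambda>i. s i x) \<longlonglongrightarrow> f x"
    and w: "integrable M w" "\<And>i x. x \<in> space M \<Longrightarrow> norm (s i x) \<le> w x"
    and f: "integrable M f" for f s and w :: "'a \<Rightarrow> real"
    unfolding P_def
  proof (rule tendsto_uniform_approx)
    fix e :: real assume e: "e > 0"
    have [measurable]: "\<And>i. s i \<in> borel_measurable M" "f \<in> borel_measurable M"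
      using s f by auto
    have "(\<lambda>i. \<integral>x. norm (f x - s i x) \<partial>M) \<longlonglongrightarrow> (\<integral>x. 0 \<partial>M)"
    proof (rule integral_dominated_convergence[where w = "\<lambda>x. norm (f x) + w x"])
      show "AE x in M. (\<lambda>i. norm (f x - s i x)) \<longlonglongrightarrow> 0"
        using lim by (intro AE_I2 tendsto_norm_zero) (auto intro!: tendsto_eq_intros)
      show "AE x in M. norm (norm (f x - s i x)) \<le> norm (f x) + w x" for i
        using w(2)[of _ i] norm_triangle_ineq4[of "f _" "s i _"] by (intro AE_I2) (simp, smt (verit))
    qed (use w f in auto)
    then have "\<forall>\<^sub>F i in sequentially. (\<integral>x. norm (f x - s i x) \<partial>M) < e / (C + 1)"
      using e C by (intro order_tendstoD(2)[of _ 0]) auto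
    then obtain i where i: "(\<integral>x. norm (f x - s i x) \<partial>M) < e / (C + 1)"
      by (auto simp: eventually_sequentially)
    have "norm ((\<integral>\<omega>. f \<omega> * g n \<omega> \<partial>M) - (\<integral>\<omega>. s i \<omega> * g n \<omega> \<partial>M)) \<le> e" for n
    proof -
      have "(\<integral>\<omega>. f \<omega> * g n \<omega> \<partial>M) - (\<integral>\<omega>. s i \<omega> * g n \<omega> \<partial>M) = (\<integral>\<omega>. (f \<omega> - s i \<omega>) * g n \<omega> \<partial>M)"
        using int[OF f] int[OF s(1)] by (simp add: left_diff_distrib)
      also have "norm \<dots> \<le> (\<integral>\<omega>. C * norm (f \<omega> - s i \<omega>) \<partial>M)"
      proof (rule norm_integral_le_AE)
        show "AE \<omega> in M. norm ((f \<omega> - s i \<omega>) * g n \<omega>) \<le> C * norm (f \<omega> - s i \<omega>)"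
          using bound[of n] by eventually_elim
            (simp add: norm_mult mult.commute[of C] mult_left_mono)
      qed (use f s int in auto)
      also have "\<dots> = C * (\<integral>x. norm (f x - s i x) \<partial>M)" by simp
      also have "\<dots> \<le> C * (e / (C + 1))" using i C by (intro mult_left_mono) auto
      also have "\<dots> \<le> e" using C e by (simp add: field_simps)
      finally show ?thesis .
    qed
    then show "\<exists>b m. b \<longlonglongrightarrow> m \<and>
        (\<forall>\<^sub>F n in sequentially. norm ((\<integral>\<omega>. f \<omega> * g n \<omega> \<partial>M) - b n) \<le> e) \<and> norm (0 - m) \<le> e"
      using s(2)[of i] e unfolding P_def
      by (intro exI[of _ "\<lambda>n. \<integral>\<omega>. s i \<omega> * g n \<omega> \<partial>M"] exI[of _ 0]) auto
  qed
  have P_0: "P (\<lambda>_. 0)" by (simp add: P_def)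
  have Finf_events: "D \<in> events" if "D \<in> sigma_sets (space M) (\<Union>k. sets (F k))" for D
    using that subalgebra_Finf by (auto simp: subalgebra_def sets_Finf)
  have int_indicator: "integrable M (indicator D :: 'a \<Rightarrow> complex)"
    if "D \<in> sigma_sets (space M) (\<Union>k. sets (F k))" for D
    using Finf_events[OF that] by (intro integrable_const_bound[where B = 1]) (auto simp: indicator_def)
  have P_basic: "P (indicator D)" if "D \<in> sets (F k)" for D k
    unfolding P_def using orth[OF that] by (rule tendsto_eventually)
  have P_indicator: "P (indicator D)" if "D \<in> sets Finf" for D
  proof -
    have "Int_stable (\<Union>k. sets (F k))"
    proof (rule Int_stableI)
      fix a b assume "a \<in> (\<Union>k. sets (F k))" "b \<in> (\<Union>k. sets (F k))"
      then obtain i j where "a \<in> sets (F i)" "b \<in> sets (F j)" by auto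
      then have "a \<in> sets (F (max i j))" "b \<in> sets (F (max i j))"
        using sets_F_mono[of i "max i j"] sets_F_mono[of j "max i j"] by auto
      then show "a \<inter> b \<in> (\<Union>k. sets (F k))" by blast
    qed
    moreover note Union_F_Pow
    moreover have "D \<in> sigma_sets (space M) (\<Union>k. sets (F k))"
      using that by (simp add: sets_Finf)
    ultimately show ?thesis
    proof (induction rule: sigma_sets_induct_disjoint)
      case (basic A)
      then show ?case using P_basic by auto
    next
      case empty
      then show ?case using P_0 by (simp add: indicator_def[abs_def])
    next
      case (compl A)
      have "P (\<lambda>x. indicator (space M) x + indicator A x * (-1))"
        using compl P_basic[of "space M" 0] space_F[of 0] sets.top[of "F 0"]
        by (intro P_add P_cmult) (auto intro!: int_indicator sigma_sets_top integrable_mult_left)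
      moreover have "indicator (space M) x + indicator A x * (-1) = (indicator (space M - A) x :: complex)" for x
        using sets.sets_into_space[OF Finf_events[OF compl(1)]] by (auto simp: indicator_def)
      ultimately show ?case by (simp add: P_def)
    next
      case (union A)
      have un: "(\<Union>i<k. A i) \<in> sigma_sets (space M) (\<Union>k. sets (F k))" for k
        using union(2) unfolding sets_Finf[symmetric] by auto
      \<comment> \<open>Finite disjoint unions follow by additivity; the countable union is then a
        dominated limit of indicators.\<close>
      have Pk: "P (indicator (\<Union>i<k. A i))" for k
      proof (induction k)
        case 0
        then show ?case using P_0 by (simp add: indicator_def[abs_def])
      next
        case (Suc k)
        have "A i \<inter> A k = {}" if "i < k" for i
          using union(1) that by (simp add: disjoint_family_on_def)
        then have "(\<Union>i<k. A i) \<inter> A k = {}" by blast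
        then have "indicator (\<Union>i<Suc k. A i) x = indicator (\<Union>i<k. A i) x + (indicator (A k) x :: complex)" for x
          by (auto simp: indicator_def less_Suc_eq)
        moreover have "P (\<lambda>x. indicator (\<Union>i<k. A i) x + indicator (A k) x)"
          using Suc union un by (intro P_add int_indicator) auto
        ultimately show ?case by (simp add: P_def)
      qed
      have "(\<Union>i. A i) \<in> sigma_sets (space M) (\<Union>k. sets (F k))"
        using union(2) unfolding sets_Finf[symmetric] by auto
      note un' = int_indicator[OF this]
      show ?case
        by (rule P_lim[of "\<lambda>k. indicator (\<Union>i<k. A i)" _ "\<lambda>_. 1",
              OF int_indicator[OF un] Pk LIMSEQ_indicator_UN])
          (use un' in \<open>auto split: split_indicator\<close>)
    qed
  qed
  \<comment> \<open>Over the restricted measure the induction starts from sets of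
    \<open>Finf\<close>, for which the claim is known.\<close>
  have "integrable (restr_to_subalg M Finf) \<zeta>"
    using subalgebra_Finf \<zeta> by (intro integrable_in_subalg)
  then have "P \<zeta>"
  proof (induction rule: integrable_induct)
    case (base A c)
    then have "A \<in> sets Finf" using subalgebra_Finf by (simp add: sets_restr_to_subalg)
    then have "P (\<lambda>x. indicator A x * c)" by (intro P_cmult P_indicator)
    moreover have "indicator A x *\<^sub>R c = indicator A x * c" for x
      by (simp add: indicator_def)
    ultimately show ?case by simp
  next
    case (add f h)
    then show ?case using subalgebra_Finf by (intro P_add) (auto intro: integrable_from_subalg)
  next
    case (lim f t)
    show ?case
      by (rule P_lim[of t f "\<lambda>x. 2 * norm (f x)"])
         (use lim subalgebra_Finf in \<open>auto intro: integrable_from_subalg simp: space_restr_to_subalg\<close>)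
  qed
  then show ?thesis by (simp add: P_def)
qed

end

section \<open>Weighted joint characteristic functions of the last \<open>r\<close> terms\<close>

context filtered_prob_space
begin

text \<open>Insert the conditional expectation \<open>c n\<close>: the part \<open>e n - c n\<close>
  is orthogonal to what is known at time \<open>n - 1\<close>, hence weakly null; the part
  \<open>c n - \<phi>\<close> tends to 0 in probability on \<open>A\<close>, outside which
  \<open>\<zeta>\<close> vanishes.\<close>

lemma conditional_charfun_step:
  fixes e V :: "nat \<Rightarrow> 'a \<Rightarrow> complex"
  assumes A: "A \<in> events" "prob A > 0"
    and e: "\<And>n. e n \<in> borel_measurable M" "\<And>n \<omega>. norm (e n \<omega>) \<le> 1"
    and V: "\<And>n. V n \<in> borel_measurable (F (n - 1))" "\<And>n \<omega>. norm (V n \<omega>) \<le> 1"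
    and \<phi>: "\<phi> \<in> borel_measurable Finf" "\<And>\<omega>. norm (\<phi> \<omega>) \<le> 1"
    and conv: "converges_in_prob (uniform_measure M A) (\<lambda>n. complex_cond_exp M (F (n - 1)) (e n)) \<phi>"
    and \<zeta>: "\<zeta> \<in> borel_measurable Finf" "\<And>\<omega>. norm (\<zeta> \<omega>) \<le> C" "\<And>\<omega>. \<omega> \<notin> A \<Longrightarrow> \<zeta> \<omega> = 0"
  shows "(\<lambda>n. (\<integral>\<omega>. \<zeta> \<omega> * (V n \<omega> * e n \<omega>) \<partial>M) - (\<integral>\<omega>. \<zeta> \<omega> * (V n \<omega> * \<phi> \<omega>) \<partial>M)) \<longlonglongrightarrow> 0"
proof -
  define c where "c n = complex_cond_exp M (F (n - 1)) (e n)" for n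
  have c_F: "c n \<in> borel_measurable (F (n - 1))" for n
    unfolding c_def by (rule complex_cond_exp_measurable)
  note [measurable] = e(1) A(1) measurable_from_subalg[OF subalgebra_F c_F]
    measurable_from_subalg[OF subalgebra_F V(1)]
    measurable_from_subalg[OF subalgebra_Finf \<phi>(1)]
    measurable_from_subalg[OF subalgebra_Finf \<zeta>(1)]
  have C: "0 \<le> C" using \<zeta>(2) norm_ge_zero order_trans by blast
  have c_bound: "AE \<omega> in M. norm (c n \<omega>) \<le> 2" for n
    using complex_cond_exp_norm_le[OF subalgebra_F e(1) e(2), of "n - 1" n] by (simp add: c_def)
  have e_bound: "AE \<omega> in M. norm (e n \<omega>) \<le> 2" for n
    by (rule AE_I2, rule order_trans[OF e(2)]) simp
  have \<phi>_bound: "AE \<omega> in M. norm (\<phi> \<omega>) \<le> 2"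
    by (rule AE_I2, rule order_trans[OF \<phi>(2)]) simp
  have int_V: "integrable M (\<lambda>\<omega>. f \<omega> * (V n \<omega> * g \<omega>))"
    if [measurable]: "f \<in> borel_measurable M" "g \<in> borel_measurable M"
      and f: "\<And>\<omega>. norm (f \<omega>) \<le> K" and g: "AE \<omega> in M. norm (g \<omega>) \<le> 2" for f g n K
  proof (rule integrable_const_bound[where B = "K * (1 * 2)"])
    have "0 \<le> K" using f norm_ge_zero order_trans by blast
    with g show "AE \<omega> in M. norm (f \<omega> * (V n \<omega> * g \<omega>)) \<le> K * (1 * 2)"
      by (elim eventually_mono) (unfold norm_mult, intro mult_mono f V(2), auto)
  qed measurable
  \<comment> \<open>The constant 3, here and below, adds the bound 2 for \<open>c n\<close> to the
    bound 1 for \<open>e n\<close> or \<open>\<phi>\<close>.\<close>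
  have "(\<lambda>n. \<integral>\<omega>. \<zeta> \<omega> * (V n \<omega> * (e n \<omega> - c n \<omega>)) \<partial>M) \<longlonglongrightarrow> 0"
  proof (rule weakly_null_if_eventually_orthogonal[where C = 3])
    fix n
    show "AE \<omega> in M. norm (V n \<omega> * (e n \<omega> - c n \<omega>)) \<le> 3"
      using c_bound[of n]
    proof eventually_elim
      case (elim \<omega>)
      have "norm (V n \<omega> * (e n \<omega> - c n \<omega>)) \<le> 1 * (1 + 2)"
        unfolding norm_mult using elim e(2)[of n \<omega>] norm_triangle_ineq4[of "e n \<omega>" "c n \<omega>"]
        by (intro mult_mono V(2)) auto
      then show ?case by simp
    qed
  next
    fix k D assume D: "D \<in> sets (F k)"
    show "\<forall>\<^sub>F n in sequentially. (\<integral>\<omega>. indicator D \<omega> * (V n \<omega> * (e n \<omega> - c n \<omega>)) \<partial>M) = 0"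
      \<comment> \<open>From \<open>n > k\<close> on, \<open>D\<close> is known at time
        \<open>n - 1\<close>, so the indicator of \<open>D\<close> times \<open>V n\<close> is an
        admissible factor for the conditional expectation.\<close>
      using eventually_gt_at_top[of k]
    proof eventually_elim
      case (elim n)
      then have "k \<le> n - 1" by simp
      then have [measurable]: "D \<in> sets (F (n - 1))"
        using D sets_F_mono by blast
      then have [measurable]: "D \<in> events" using subalgebra_F by (auto simp: subalgebra_def)
      have DV: "(\<lambda>\<omega>. indicator D \<omega> * V n \<omega>) \<in> borel_measurable (F (n - 1))"
        using V(1) by measurable
      have "norm (indicator D \<omega> * V n \<omega>) \<le> 1" for \<omega>
        using V(2)[of n \<omega>] by (simp add: indicator_def)
      from complex_cond_exp_intg[OF subalgebra_F DV e(1) this e(2), of n]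
      have "(\<integral>\<omega>. indicator D \<omega> * (V n \<omega> * c n \<omega>) \<partial>M) = (\<integral>\<omega>. indicator D \<omega> * (V n \<omega> * e n \<omega>) \<partial>M)"
        by (simp add: c_def mult.assoc)
      moreover have "integrable M (\<lambda>\<omega>. indicator D \<omega> * (V n \<omega> * c n \<omega>))"
        by (rule int_V[of _ _ 1]) (use c_bound in \<open>auto simp: indicator_def\<close>)
      moreover have "integrable M (\<lambda>\<omega>. indicator D \<omega> * (V n \<omega> * e n \<omega>))"
        by (rule int_V[of _ _ 1]) (use e_bound in \<open>auto simp: indicator_def\<close>)
      ultimately show ?case by (simp add: right_diff_distrib)
    qed
  next
    show "integrable M \<zeta>"
      using \<zeta>(2) by (intro integrable_const_bound[where B = C]) auto
  qed (use \<zeta> in auto)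
  moreover have "(\<lambda>n. \<integral>\<omega>. \<zeta> \<omega> * (V n \<omega> * (c n \<omega> - \<phi> \<omega>)) \<partial>M) \<longlonglongrightarrow> 0"
  proof (rule Lim_null_comparison)
    let ?N = "uniform_measure M A"
    interpret N: prob_space ?N
      using A by (intro prob_space_uniform_measure) (auto simp: emeasure_eq_measure)
    have "(\<lambda>n. N.expectation (\<lambda>\<omega>. norm (c n \<omega> - \<phi> \<omega>))) \<longlonglongrightarrow> 0"
    proof (rule N.converges_in_prob_bounded_expectation[where C = 3])
      show "converges_in_prob ?N (\<lambda>n \<omega>. c n \<omega> - \<phi> \<omega>) (\<lambda>_. 0)"
        using conv unfolding c_def[symmetric] by (subst (asm) converges_in_prob_diff_zero)
      fix n show "AE \<omega> in ?N. norm (c n \<omega> - \<phi> \<omega>) \<le> 3"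
        using c_bound[of n] A(1)
        by (intro AE_uniform_measureI) (auto elim!: eventually_mono
          intro: order_trans[OF norm_triangle_ineq4] add_mono[OF _ \<phi>(2), of _ 2, simplified])
    qed measurable
    then have "(\<lambda>n. C * (prob A * N.expectation (\<lambda>\<omega>. norm (c n \<omega> - \<phi> \<omega>)))) \<longlonglongrightarrow> 0"
      by (auto intro!: tendsto_eq_intros)
    then show "(\<lambda>n. C * (\<integral>\<omega>. indicator A \<omega> * norm (c n \<omega> - \<phi> \<omega>) \<partial>M)) \<longlonglongrightarrow> 0"
      using A by (simp add: integral_uniform_measure[OF prob_space_axioms] flip: mult.assoc)
    show "\<forall>\<^sub>F n in sequentially. norm (\<integral>\<omega>. \<zeta> \<omega> * (V n \<omega> * (c n \<omega> - \<phi> \<omega>)) \<partial>M)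
        \<le> C * (\<integral>\<omega>. indicator A \<omega> * norm (c n \<omega> - \<phi> \<omega>) \<partial>M)"
    proof (intro always_eventually allI)
      fix n
      have b3: "AE \<omega> in M. norm (c n \<omega> - \<phi> \<omega>) \<le> 3"
        using c_bound[of n] by (auto elim!: eventually_mono
          intro: order_trans[OF norm_triangle_ineq4] add_mono[OF _ \<phi>(2), of _ 2, simplified])
      have "norm (\<integral>\<omega>. \<zeta> \<omega> * (V n \<omega> * (c n \<omega> - \<phi> \<omega>)) \<partial>M)
          \<le> (\<integral>\<omega>. C * (indicator A \<omega> * norm (c n \<omega> - \<phi> \<omega>)) \<partial>M)"
      proof (rule norm_integral_le_AE)
        show "AE \<omega> in M. norm (\<zeta> \<omega> * (V n \<omega> * (c n \<omega> - \<phi> \<omega>))) \<le> C * (indicator A \<omega> * norm (c n \<omega> - \<phi> \<omega>))"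
        proof (rule AE_I2)
          fix \<omega>
          have "norm (\<zeta> \<omega>) * (norm (V n \<omega>) * norm (c n \<omega> - \<phi> \<omega>)) \<le> C * (1 * norm (c n \<omega> - \<phi> \<omega>))"
            using C by (intro mult_mono \<zeta>(2) V(2)) auto
          then show "norm (\<zeta> \<omega> * (V n \<omega> * (c n \<omega> - \<phi> \<omega>))) \<le> C * (indicator A \<omega> * norm (c n \<omega> - \<phi> \<omega>))"
            using \<zeta>(3)[of \<omega>] by (cases "\<omega> \<in> A") (auto simp: norm_mult)
        qed
        show "integrable M (\<lambda>\<omega>. C * (indicator A \<omega> * norm (c n \<omega> - \<phi> \<omega>)))"
          using b3 by (intro integrable_mult_right integrable_const_bound[where B = 3])
            (auto elim!: eventually_mono simp: indicator_def)
        show "integrable M (\<lambda>\<omega>. \<zeta> \<omega> * (V n \<omega> * (c n \<omega> - \<phi> \<omega>)))"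
        proof (rule integrable_const_bound[where B = "C * (1 * 3)"])
          show "AE \<omega> in M. norm (\<zeta> \<omega> * (V n \<omega> * (c n \<omega> - \<phi> \<omega>))) \<le> C * (1 * 3)"
            using b3 C
            by (elim eventually_mono) (unfold norm_mult, intro mult_mono \<zeta>(2) V(2), auto)
        qed measurable
      qed
      then show "norm (\<integral>\<omega>. \<zeta> \<omega> * (V n \<omega> * (c n \<omega> - \<phi> \<omega>)) \<partial>M)
          \<le> C * (\<integral>\<omega>. indicator A \<omega> * norm (c n \<omega> - \<phi> \<omega>) \<partial>M)"
        by simp
    qed
  qed
  ultimately have "(\<lambda>n. (\<integral>\<omega>. \<zeta> \<omega> * (V n \<omega> * (e n \<omega> - c n \<omega>)) \<partial>M) +
      (\<integral>\<omega>. \<zeta> \<omega> * (V n \<omega> * (c n \<omega> - \<phi> \<omega>)) \<partial>M)) \<longlonglongrightarrow> 0"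
    by (auto intro!: tendsto_eq_intros)
  moreover have "(\<integral>\<omega>. \<zeta> \<omega> * (V n \<omega> * (e n \<omega> - c n \<omega>)) \<partial>M) + (\<integral>\<omega>. \<zeta> \<omega> * (V n \<omega> * (c n \<omega> - \<phi> \<omega>)) \<partial>M) =
      (\<integral>\<omega>. \<zeta> \<omega> * (V n \<omega> * e n \<omega>) \<partial>M) - (\<integral>\<omega>. \<zeta> \<omega> * (V n \<omega> * \<phi> \<omega>) \<partial>M)" for n
  proof -
    have "integrable M (\<lambda>\<omega>. \<zeta> \<omega> * (V n \<omega> * e n \<omega>))" "integrable M (\<lambda>\<omega>. \<zeta> \<omega> * (V n \<omega> * c n \<omega>))"
      "integrable M (\<lambda>\<omega>. \<zeta> \<omega> * (V n \<omega> * \<phi> \<omega>))"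
      using int_V[OF _ _ \<zeta>(2) e_bound] int_V[OF _ _ \<zeta>(2) c_bound] int_V[OF _ _ \<zeta>(2) \<phi>_bound]
      by simp_all
    then show ?thesis by (simp add: right_diff_distrib)
  qed
  ultimately show ?thesis by simp
qed

text \<open>The newest factor goes first, because the older ones are then known at time
  \<open>n - 1\<close>. What remains has the same shape with \<open>n - 1\<close> for
  \<open>n\<close> and weight \<open>\<zeta> * \<phi> (\<theta> 0)\<close>, so
  \<open>\<zeta>\<close> and \<open>\<theta>\<close> must vary in the induction.\<close>

lemma joint_charfun_tendsto:
  fixes Y :: "nat \<Rightarrow> 'a \<Rightarrow> 'b::euclidean_space" and \<phi> :: "'b \<Rightarrow> 'a \<Rightarrow> complex"
  assumes A: "A \<in> events" "prob A > 0"
    and Y: "\<And>n. Y n \<in> borel_measurable (F n)"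
    and \<phi>: "\<And>\<theta>. \<phi> \<theta> \<in> borel_measurable Finf" "\<And>\<theta> \<omega>. norm (\<phi> \<theta> \<omega>) \<le> 1"
    and conv: "\<And>\<theta>. converges_in_prob (uniform_measure M A)
      (\<lambda>n. complex_cond_exp M (F (n - 1)) (\<lambda>\<omega>. iexp (\<theta> \<bullet> Y n \<omega>))) (\<phi> \<theta>)"
    and \<zeta>: "\<zeta> \<in> borel_measurable Finf" "\<And>\<omega>. norm (\<zeta> \<omega>) \<le> C" "\<And>\<omega>. \<omega> \<notin> A \<Longrightarrow> \<zeta> \<omega> = 0"
  shows "(\<lambda>n. \<integral>\<omega>. \<zeta> \<omega> * (\<Prod>j<r. iexp (\<theta> j \<bullet> Y (n - j) \<omega>)) \<partial>M) \<longlonglongrightarrow>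
    (\<integral>\<omega>. \<zeta> \<omega> * (\<Prod>j<r. \<phi> (\<theta> j) \<omega>) \<partial>M)"
  using \<zeta>
proof (induction r arbitrary: \<zeta> \<theta>)
  case 0
  then show ?case by simp
next
  case (Suc r)
  define V where "V n \<omega> = (\<Prod>j<r. iexp (\<theta> (Suc j) \<bullet> Y (n - 1 - j) \<omega>))" for n \<omega>
  have [measurable]: "Y n \<in> borel_measurable M" for n
    using measurable_from_subalg[OF subalgebra_F Y] .
  have step: "(\<lambda>n. (\<integral>\<omega>. \<zeta> \<omega> * (V n \<omega> * iexp (\<theta> 0 \<bullet> Y n \<omega>)) \<partial>M) -
      (\<integral>\<omega>. \<zeta> \<omega> * (V n \<omega> * \<phi> (\<theta> 0) \<omega>) \<partial>M)) \<longlonglongrightarrow> 0"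
  proof (rule conditional_charfun_step[OF A _ _ _ _ \<phi> conv Suc.prems])
    fix n
    have "Y (n - 1 - j) \<in> borel_measurable (F (n - 1))" for j
      by (rule measurable_F_mono[OF Y]) simp
    then show "V n \<in> borel_measurable (F (n - 1))"
      unfolding V_def by measurable
  qed (auto simp: V_def norm_mult simp flip: prod_norm)
  have "(\<lambda>n. \<integral>\<omega>. \<zeta> \<omega> * \<phi> (\<theta> 0) \<omega> * (\<Prod>j<r. iexp (\<theta> (Suc j) \<bullet> Y (n - j) \<omega>)) \<partial>M) \<longlonglongrightarrow>
      (\<integral>\<omega>. \<zeta> \<omega> * \<phi> (\<theta> 0) \<omega> * (\<Prod>j<r. \<phi> (\<theta> (Suc j)) \<omega>) \<partial>M)"
  proof (rule Suc.IH)
    show "norm (\<zeta> \<omega> * \<phi> (\<theta> 0) \<omega>) \<le> C" for \<omega>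
      using mult_mono[OF Suc.prems(2)[of \<omega>] \<phi>(2)[of "\<theta> 0" \<omega>]] Suc.prems(2)[of \<omega>] norm_ge_zero[of "\<zeta> \<omega>"]
      by (simp add: norm_mult)
  qed (use Suc.prems \<phi> in auto)
  \<comment> \<open>The induction hypothesis speaks of the terms up to \<open>n\<close>,
    \<open>V n\<close> of those up to \<open>n - 1\<close>; the shift leaves the limit
    unchanged.\<close>
  then have "(\<lambda>n. \<integral>\<omega>. \<zeta> \<omega> * \<phi> (\<theta> 0) \<omega> * (\<Prod>j<r. iexp (\<theta> (Suc j) \<bullet> Y (n - 1 - j) \<omega>)) \<partial>M) \<longlonglongrightarrow>
      (\<integral>\<omega>. \<zeta> \<omega> * \<phi> (\<theta> 0) \<omega> * (\<Prod>j<r. \<phi> (\<theta> (Suc j)) \<omega>) \<partial>M)"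
    by (rule filterlim_compose) (rule filterlim_minus_const_nat_at_top)
  then have "(\<lambda>n. \<integral>\<omega>. \<zeta> \<omega> * (V n \<omega> * \<phi> (\<theta> 0) \<omega>) \<partial>M) \<longlonglongrightarrow>
      (\<integral>\<omega>. \<zeta> \<omega> * (\<Prod>j<Suc r. \<phi> (\<theta> j) \<omega>) \<partial>M)"
    unfolding V_def prod.lessThan_Suc_shift by (simp add: ac_simps)
  from tendsto_add[OF step this]
  show ?case
    unfolding V_def prod.lessThan_Suc_shift by (simp add: ac_simps)
qed

end

section \<open>Integrals over independent sigma-fields\<close>

context prob_space
begin

text \<open>Independence says that the diagonal map sends \<open>M\<close> to a product measure on
  \<open>G\<close> and \<open>H\<close>; Fubini then separates the coordinates. The form with
  sigma-fields lets \<open>f\<close> combine any variables measurable for either of them.\<close>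

lemma indep_set_integral:
  fixes f :: "'a \<times> 'a \<Rightarrow> complex"
  assumes G: "subalgebra M G" and H: "subalgebra M H"
    and indep: "indep_set (sets G) (sets H)"
    and f: "f \<in> borel_measurable (G \<Otimes>\<^sub>M H)" "\<And>x. norm (f x) \<le> C"
  shows "(\<integral>\<omega>. f (\<omega>, \<omega>) \<partial>M) = (\<integral>\<omega>. (\<integral>\<omega>'. f (\<omega>', \<omega>) \<partial>M) \<partial>M)"
proof -
  have id: "(\<lambda>x. x) \<in> measurable M K"
    and vim: "sigma_sets (space M) {(\<lambda>x. x) -` A \<inter> space M | A. A \<in> sets K} = sets K"
    if "subalgebra M K" for K
  proof -
    show "(\<lambda>x. x) \<in> measurable M K"
      using that by (auto simp: measurable_def subalgebra_def)
    have "{(\<lambda>x. x) -` A \<inter> space M | A. A \<in> sets K} = sets K"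
    proof -
      have "(\<lambda>x. x) -` A \<inter> space M = A" if "A \<in> sets K" for A
        using sets.sets_into_space[OF that] \<open>subalgebra M K\<close> by (auto simp: subalgebra_def)
      then have "(\<lambda>A. (\<lambda>x. x) -` A \<inter> space M) ` sets K = (\<lambda>A. A) ` sets K"
        by (intro image_cong refl)
      then show ?thesis by (simp only: Setcompr_eq_image image_ident)
    qed
    then show "sigma_sets (space M) {(\<lambda>x. x) -` A \<inter> space M | A. A \<in> sets K} = sets K"
      using that sets.sigma_sets_eq[of K] by (simp add: subalgebra_def)
  qed
  have "indep_var G (\<lambda>x. x) H (\<lambda>x. x)"
    unfolding indep_var_eq vim[OF G] vim[OF H] using id G H indep by simp
  then have eq: "distr M G (\<lambda>x. x) \<Otimes>\<^sub>M distr M H (\<lambda>x. x) = distr M (G \<Otimes>\<^sub>M H) (\<lambda>x. (x, x))"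
    by (simp add: indep_var_distribution_eq)
  let ?G = "distr M G (\<lambda>x. x)" and ?H = "distr M H (\<lambda>x. x)"
  interpret G: prob_space ?G by (rule prob_space_distr[OF id[OF G]])
  interpret H: prob_space ?H by (rule prob_space_distr[OF id[OF H]])
  interpret GH: pair_prob_space ?G ?H ..
  have meas: "f \<in> borel_measurable (?G \<Otimes>\<^sub>M ?H)"
    using f(1) by (simp cong: measurable_cong_sets sets_pair_measure_cong)
  then have int: "integrable (?G \<Otimes>\<^sub>M ?H) (\<lambda>(x, y). f (x, y))"
    using f(2) by (intro GH.P.integrable_const_bound[where B = C]) auto
  have "(\<integral>\<omega>. f (\<omega>, \<omega>) \<partial>M) = (\<integral>x. f x \<partial>distr M (G \<Otimes>\<^sub>M H) (\<lambda>x. (x, x)))"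
    by (rule integral_distr[symmetric, OF measurable_Pair[OF id[OF G] id[OF H]] f(1)])
  also have "\<dots> = (\<integral>x. (case x of (x, y) \<Rightarrow> f (x, y)) \<partial>(?G \<Otimes>\<^sub>M ?H))"
    by (simp add: eq)
  also have "\<dots> = (\<integral>y. (\<integral>x. f (x, y) \<partial>?G) \<partial>?H)"
    by (rule GH.integral_snd[OF int, symmetric])
  also have "\<dots> = (\<integral>y. (\<integral>x. f (x, y) \<partial>?G) \<partial>M)"
  proof (rule integral_distr[OF id[OF H]])
    have "(\<lambda>(y, x). f (x, y)) \<in> borel_measurable (H \<Otimes>\<^sub>M ?G)"
      using measurable_compose[OF measurable_pair_swap' f(1), of ] 
      by (simp add: split_beta' cong: measurable_cong_sets sets_pair_measure_cong)
    then show "(\<lambda>y. \<integral>x. f (x, y) \<partial>?G) \<in> borel_measurable H"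
      by (rule G.borel_measurable_lebesgue_integral)
  qed
  also have "\<dots> = (\<integral>y. (\<integral>x. f (x, y) \<partial>M) \<partial>M)"
  proof (rule Bochner_Integration.integral_cong[OF refl], rule integral_distr[OF id[OF G]])
    fix y assume "y \<in> space M"
    then have "(\<lambda>x. (x, y)) \<in> measurable G (G \<Otimes>\<^sub>M H)"
      using H by (intro measurable_Pair2') (simp add: subalgebra_def)
    from measurable_compose[OF this f(1)] show "(\<lambda>x. f (x, y)) \<in> borel_measurable G" .
  qed
  finally show ?thesis .
qed

text \<open>Freezing the \<open>H\<close>-coordinate turns \<open>S\<close> into a constant matrix
  and leaves a product over the independent \<open>Z j\<close>.\<close>

lemma indep_charfun_product:
  fixes Z :: "nat \<Rightarrow> 'a \<Rightarrow> real^'n" and S :: "'a \<Rightarrow> real^'n^'m"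
  assumes H: "subalgebra M H" and Z: "indep_vars (\<lambda>_. borel) Z UNIV" "\<And>j. distr M borel (Z j) = \<mu>"
    and indep: "indep_set (sets (generated_sigma M Z)) (sets H)"
    and S: "S \<in> borel_measurable H"
    and \<zeta>: "\<zeta> \<in> borel_measurable H" "\<And>\<omega>. norm (\<zeta> \<omega> :: complex) \<le> C"
  shows "(\<integral>\<omega>. \<zeta> \<omega> * (\<Prod>j<r. iexp (\<theta> j \<bullet> (S \<omega> *v Z j \<omega>))) \<partial>M) =
    (\<integral>\<omega>. \<zeta> \<omega> * (\<Prod>j<r. \<integral>x. iexp (\<theta> j \<bullet> (S \<omega> *v x)) \<partial>\<mu>) \<partial>M)"
proof -
  let ?G = "generated_sigma M Z"
  have Z_M [measurable]: "Z j \<in> borel_measurable M" for j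
    using Z(1) by (simp add: indep_vars_def)
  have gen: "(\<Union>j. sets (vimage_algebra (space M) (Z j) borel)) \<subseteq> events"
    using Z_M by (auto simp: sets_vimage_algebra2 measurable_sets)
  then have G_pow: "(\<Union>j. sets (vimage_algebra (space M) (Z j) borel)) \<subseteq> Pow (space M)"
    using sets.space_closed by blast
  have space_G: "space ?G = space M"
    by (simp add: generated_sigma_def space_measure_of_conv)
  have sets_G: "sets ?G = sigma_sets (space M) (\<Union>j. sets (vimage_algebra (space M) (Z j) borel))"
    unfolding generated_sigma_def by (rule sets_measure_of[OF G_pow])
  have G: "subalgebra M ?G"
    unfolding subalgebra_def space_G sets_G using gen by (auto intro!: sets.sigma_sets_subset)
  have Z_G [measurable]: "Z j \<in> borel_measurable ?G" for j
  proof (rule measurableI)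
    fix B :: "(real^'n) set" assume "B \<in> sets borel"
    then have "Z j -` B \<inter> space M \<in> sets (vimage_algebra (space M) (Z j) borel)"
      by (simp add: in_vimage_algebra)
    then show "Z j -` B \<inter> space ?G \<in> sets ?G"
      unfolding space_G sets_G by (intro sigma_sets.Basic) blast
  qed simp
  note [measurable] = S \<zeta>(1)
  define f where "f p = \<zeta> (snd p) * (\<Prod>j<r. iexp (\<theta> j \<bullet> (S (snd p) *v Z j (fst p))))" for p
  have "f \<in> borel_measurable (?G \<Otimes>\<^sub>M H)"
    unfolding f_def by measurable
  moreover have "norm (f p) \<le> C" for p
    using \<zeta>(2) by (simp add: f_def norm_mult flip: prod_norm)
  ultimately have "(\<integral>\<omega>. f (\<omega>, \<omega>) \<partial>M) = (\<integral>\<omega>. (\<integral>\<omega>'. f (\<omega>', \<omega>) \<partial>M) \<partial>M)"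
    by (rule indep_set_integral[OF G H indep])
  moreover have "(\<integral>\<omega>'. f (\<omega>', \<omega>) \<partial>M) = \<zeta> \<omega> * (\<Prod>j<r. \<integral>x. iexp (\<theta> j \<bullet> (S \<omega> *v x)) \<partial>\<mu>)" for \<omega>
  proof -
    define s where "s = S \<omega>"
    have "indep_vars (\<lambda>_. borel) (\<lambda>j \<omega>'. iexp (\<theta> j \<bullet> (s *v Z j \<omega>'))) {..<r}"
      by (rule indep_vars_compose2[OF indep_vars_subset[OF Z(1) subset_UNIV], where Y = "\<lambda>j x. iexp (\<theta> j \<bullet> (s *v x))"])
         measurable
    then have "(\<integral>\<omega>'. (\<Prod>j<r. iexp (\<theta> j \<bullet> (s *v Z j \<omega>'))) \<partial>M) =
        (\<Prod>j<r. \<integral>\<omega>'. iexp (\<theta> j \<bullet> (s *v Z j \<omega>')) \<partial>M)"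
      by (intro indep_vars_lebesgue_integral) (auto intro!: integrable_const_bound[where B = 1])
    also have "\<dots> = (\<Prod>j<r. \<integral>x. iexp (\<theta> j \<bullet> (s *v x)) \<partial>distr M borel (Z j))"
      by (subst integral_distr) auto
    finally show ?thesis
      by (simp add: f_def s_def Z(2))
  qed
  ultimately have "(\<integral>\<omega>. f (\<omega>, \<omega>) \<partial>M) =
      (\<integral>\<omega>. \<zeta> \<omega> * (\<Prod>j<r. \<integral>x. iexp (\<theta> j \<bullet> (S \<omega> *v x)) \<partial>\<mu>) \<partial>M)"
    by simp
  then show ?thesis by (simp add: f_def)
qed

end

section \<open>Perturbed linear recursions\<close>

lemma norm_iexp_diff_le: "norm (iexp s - iexp t) \<le> \<bar>s - t\<bar>"
proof -
  have "norm (iexp s - iexp t) = norm (iexp t * (iexp (s - t) - 1))"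
    by (simp add: exp_diff right_diff_distrib)
  also have "\<dots> = norm (iexp (s - t) - 1)"
    by (simp add: norm_mult)
  also have "\<dots> \<le> \<bar>s - t\<bar>"
    using iexp_approx1[of "s - t" 0] by simp
  finally show ?thesis .
qed

lemma prod_iexp: "(\<Prod>j\<in>J. iexp (f j)) = iexp (\<Sum>j\<in>J. f j)"
  by (induction J rule: infinite_finite_induct) (simp_all add: exp_add distrib_left)

text \<open>The bound \<open>min (real n) t\<close> is what the induction needs: a new index is
  counted only if \<open>Suc n\<close> is still at most \<open>t\<close>, a case in which the bound
  \<open>t\<close> alone could be overshot.\<close>

lemma sum_indicator_le_self:
  fixes t :: real
  assumes "t \<ge> 0"
  shows "(\<Sum>j<n. of_bool (real (Suc j) \<le> t)) \<le> min (real n) t"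
proof (induction n)
  case (Suc n)
  then show ?case by (cases "real (Suc n) \<le> t") auto
qed (use assms in simp)

section \<open>Growth of the \<open>Z j\<close> and summability of the limit series\<close>

context prob_space
begin

text \<open>The probabilities that \<open>log_plus (norm (Z j \<omega>))\<close> reaches
  \<open>e * real (Suc j)\<close> sum to at most the logarithmic moment divided by \<open>e\<close>;
  Borel-Cantelli concludes.\<close>

lemma AE_norm_le_exp_if_log_moment:
  fixes Z :: "nat \<Rightarrow> 'a \<Rightarrow> 'b::euclidean_space"
  assumes [measurable]: "\<And>j. Z j \<in> borel_measurable M"
    and \<mu>: "\<And>j. distr M borel (Z j) = \<mu>"
    and log: "(\<integral>\<^sup>+x. ennreal (log_plus (norm x)) \<partial>\<mu>) < \<infinity>"
    and "e > 0"
  shows "AE \<omega> in M. \<forall>\<^sub>F j in sequentially. norm (Z j \<omega>) \<le> exp (e * real (Suc j))"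
proof -
  have [measurable]: "log_plus \<in> borel_measurable borel"
    unfolding log_plus_def by measurable
  have sets_\<mu> [measurable_cong]: "sets \<mu> = sets borel" and space_\<mu>: "space \<mu> = UNIV"
    using \<mu>[of 0] by auto
  define B where "B j = {x :: 'b. e * real (Suc j) \<le> log_plus (norm x)}" for j
  have B [measurable]: "B j \<in> sets borel" for j
    unfolding B_def by measurable
  define A where "A j = Z j -` B j \<inter> space M" for j
  have A [measurable]: "A j \<in> events" for j
    unfolding A_def by measurable
  have A_\<mu>: "emeasure M (A j) = emeasure \<mu> (B j)" for j
    unfolding A_def \<mu>[of j, symmetric] by (simp add: emeasure_distr)
  have le: "(\<Sum>j. indicator (B j) x) \<le> ennreal (log_plus (norm x) / e)" for x
  proof (rule suminf_le_const)
    fix n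
    have nonneg: "0 \<le> log_plus (norm x) / e" using \<open>e > 0\<close> by (auto simp: log_plus_def)
    have "indicator (B j) x = ennreal (of_bool (real (Suc j) \<le> log_plus (norm x) / e))" for j
      using \<open>e > 0\<close> by (auto simp: B_def indicator_def field_simps)
    then have "(\<Sum>j<n. indicator (B j) x :: ennreal) =
        (\<Sum>j<n. ennreal (of_bool (real (Suc j) \<le> log_plus (norm x) / e)))"
      by (simp only:)
    also have "\<dots> = ennreal (\<Sum>j<n. of_bool (real (Suc j) \<le> log_plus (norm x) / e))"
      by (rule sum_ennreal) simp
    also have "\<dots> \<le> ennreal (log_plus (norm x) / e)"
      using sum_indicator_le_self[OF nonneg, of n] by (intro ennreal_leI) simp
    finally show "(\<Sum>j<n. indicator (B j) x) \<le> ennreal (log_plus (norm x) / e)" .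
  qed simp
  have "(\<Sum>j. emeasure M (A j)) = (\<Sum>j. \<integral>\<^sup>+x. indicator (B j) x \<partial>\<mu>)"
    using B by (simp add: A_\<mu> sets_\<mu>)
  also have "\<dots> = (\<integral>\<^sup>+x. (\<Sum>j. indicator (B j) x) \<partial>\<mu>)"
    by (rule nn_integral_suminf[symmetric]) measurable
  also have "\<dots> \<le> (\<integral>\<^sup>+x. ennreal (1 / e) * ennreal (log_plus (norm x)) \<partial>\<mu>)"
    using le \<open>e > 0\<close> by (intro nn_integral_mono) (simp add: ennreal_mult'[symmetric])
  also have "\<dots> = ennreal (1 / e) * (\<integral>\<^sup>+x. ennreal (log_plus (norm x)) \<partial>\<mu>)"
    by (rule nn_integral_cmult) measurable
  also have "\<dots> < \<infinity>"
    using log by (simp add: ennreal_mult_less_top)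
  finally have "(\<Sum>j. ennreal (prob (A j))) \<noteq> top"
    by (simp add: emeasure_eq_measure)
  then have "summable (\<lambda>j. prob (A j))"
    by (intro summable_suminf_not_top) auto
  then have "AE \<omega> in M. \<forall>\<^sub>F j in sequentially. \<omega> \<in> space M - A j"
    by (intro borel_cantelli_AE1) (auto simp: less_top[symmetric])
  then show ?thesis
  proof eventually_elim
    case (elim \<omega>)
    then show ?case
    proof eventually_elim
      case (elim j)
      then have *: "log_plus (norm (Z j \<omega>)) < e * real (Suc j)"
        by (auto simp: A_def B_def)
      show ?case
      proof (cases "1 \<le> norm (Z j \<omega>)")
        case True
        then have pos: "0 < norm (Z j \<omega>)" by linarith
        have "ln (norm (Z j \<omega>)) \<le> e * real (Suc j)"
          using * True by (simp add: log_plus_def)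
        then have "exp (ln (norm (Z j \<omega>))) \<le> exp (e * real (Suc j))"
          by (simp only: exp_le_cancel_iff)
        then show ?thesis by (simp only: exp_ln[OF pos])
      next
        case False
        have "1 \<le> exp (e * real (Suc j))" using \<open>e > 0\<close> by simp
        then show ?thesis using False by linarith
      qed
    qed
  qed
qed

text \<open>Subexponential growth of \<open>Z j\<close> meets geometric decay; for each
  \<open>\<omega>\<close>, \<open>S\<close> contributes only a constant factor.\<close>

lemma AE_summable_matrix_power_series:
  fixes Z :: "nat \<Rightarrow> 'a \<Rightarrow> real^'d" and S :: "'a \<Rightarrow> real^'d^'d" and P :: "real^'d^'d"
  assumes Z: "\<And>j. Z j \<in> borel_measurable M" "\<And>j. distr M borel (Z j) = \<mu>"
    and log: "(\<integral>\<^sup>+x. ennreal (log_plus (norm x)) \<partial>\<mu>) < \<infinity>"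
    and P: "\<And>n x. norm (matrix_power P n *v x) \<le> C * r ^ n * norm x" "0 < r" "r < 1" "0 \<le> C"
  shows "AE \<omega> in M. summable (\<lambda>j. matrix_power P j *v (S \<omega> *v Z j \<omega>))"
proof -
  \<comment> \<open>Half of the decay rate is spent on \<open>Z j\<close>: \<open>r * exp e\<close>
    is the square root of \<open>r\<close>.\<close>
  define e where "e = - ln r / 2"
  have e: "e > 0" using P by (simp add: e_def)
  have "r * exp e = exp (ln r / 2)"
    using P exp_add[of "ln r" e] by (simp add: e_def)
  then have q: "r * exp e < 1" using P by simp
  have "AE \<omega> in M. \<forall>\<^sub>F j in sequentially. norm (Z j \<omega>) \<le> exp (e * real (Suc j))"
    using Z log e by (rule AE_norm_le_exp_if_log_moment)
  then show ?thesis
  proof eventually_elim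
    case (elim \<omega>)
    let ?c = "C * norm (S \<omega>) * exp e"
    have "\<forall>\<^sub>F j in sequentially. norm (matrix_power P j *v (S \<omega> *v Z j \<omega>)) \<le> ?c * (r * exp e) ^ j"
      using elim
    proof eventually_elim
      case (elim j)
      have "norm (matrix_power P j *v (S \<omega> *v Z j \<omega>)) \<le> C * r ^ j * norm (S \<omega> *v Z j \<omega>)"
        by (rule P(1))
      also have "\<dots> \<le> C * r ^ j * (norm (S \<omega>) * exp (e * real (Suc j)))"
        using elim P
        by (intro mult_left_mono order_trans[OF norm_matrix_vector_mult_le]) auto
      also have "exp (e * real (Suc j)) = exp e * exp e ^ j"
        by (simp add: exp_add distrib_left exp_of_nat_mult mult.commute flip: exp_of_nat2_mult)
      finally show ?case by (simp add: power_mult_distrib mult_ac)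
    qed
    moreover have "summable (\<lambda>j. ?c * (r * exp e) ^ j)"
      using q P by (intro summable_mult summable_geometric) simp
    ultimately show ?case by (rule summable_comparison_test_ev)
  qed
qed

text \<open>Where \<open>X\<close> and \<open>Y\<close> are within \<open>d\<close>, the exponential
  is Lipschitz; elsewhere two unimodular numbers differ by at most 2.\<close>

lemma expectation_iexp_diff_bound:
  fixes \<zeta> :: "'a \<Rightarrow> complex" and X Y :: "'a \<Rightarrow> 'b::euclidean_space"
  assumes [measurable]: "\<zeta> \<in> borel_measurable M" "X \<in> borel_measurable M" "Y \<in> borel_measurable M"
    and \<zeta>: "\<And>\<omega>. norm (\<zeta> \<omega>) \<le> C" and d: "d \<ge> 0"
  shows "norm ((\<integral>\<omega>. \<zeta> \<omega> * iexp (\<theta> \<bullet> X \<omega>) \<partial>M) - (\<integral>\<omega>. \<zeta> \<omega> * iexp (\<theta> \<bullet> Y \<omega>) \<partial>M)) \<le>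
    C * (norm \<theta> * d + 2 * prob {\<omega> \<in> space M. norm (X \<omega> - Y \<omega>) > d})"
proof -
  let ?A = "{\<omega> \<in> space M. norm (X \<omega> - Y \<omega>) > d}"
  have C: "0 \<le> C" using \<zeta> norm_ge_zero order_trans by blast
  have int: "integrable M (\<lambda>\<omega>. \<zeta> \<omega> * iexp (\<theta> \<bullet> X \<omega>))" "integrable M (\<lambda>\<omega>. \<zeta> \<omega> * iexp (\<theta> \<bullet> Y \<omega>))"
    by (rule integrable_bounded_mult[where C = C and D = 1]; use \<zeta> in simp)+
  have "norm ((\<integral>\<omega>. \<zeta> \<omega> * iexp (\<theta> \<bullet> X \<omega>) \<partial>M) - (\<integral>\<omega>. \<zeta> \<omega> * iexp (\<theta> \<bullet> Y \<omega>) \<partial>M)) =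
      norm (\<integral>\<omega>. \<zeta> \<omega> * iexp (\<theta> \<bullet> X \<omega>) - \<zeta> \<omega> * iexp (\<theta> \<bullet> Y \<omega>) \<partial>M)"
    using int by simp
  also have "\<dots> \<le> (\<integral>\<omega>. C * (norm \<theta> * d + 2 * indicator ?A \<omega>) \<partial>M)"
  proof (rule norm_integral_le_AE)
    show "AE \<omega> in M. norm (\<zeta> \<omega> * iexp (\<theta> \<bullet> X \<omega>) - \<zeta> \<omega> * iexp (\<theta> \<bullet> Y \<omega>))
        \<le> C * (norm \<theta> * d + 2 * indicator ?A \<omega>)"
    proof (rule AE_I2)
      fix \<omega> assume "\<omega> \<in> space M"
      have "norm (\<zeta> \<omega> * iexp (\<theta> \<bullet> X \<omega>) - \<zeta> \<omega> * iexp (\<theta> \<bullet> Y \<omega>)) =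
          norm (\<zeta> \<omega>) * norm (iexp (\<theta> \<bullet> X \<omega>) - iexp (\<theta> \<bullet> Y \<omega>))"
        by (simp flip: right_diff_distrib norm_mult)
      also have "\<dots> \<le> C * (norm \<theta> * d + 2 * indicator ?A \<omega>)"
      proof (intro mult_mono \<zeta> C)
        show "norm (iexp (\<theta> \<bullet> X \<omega>) - iexp (\<theta> \<bullet> Y \<omega>)) \<le> norm \<theta> * d + 2 * indicator ?A \<omega>"
        proof (cases "norm (X \<omega> - Y \<omega>) \<le> d")
          case True
          have "norm (iexp (\<theta> \<bullet> X \<omega>) - iexp (\<theta> \<bullet> Y \<omega>)) \<le> \<bar>\<theta> \<bullet> (X \<omega> - Y \<omega>)\<bar>"
            using norm_iexp_diff_le by (simp add: inner_diff_right)
          also have "\<dots> \<le> norm \<theta> * norm (X \<omega> - Y \<omega>)" by (rule Cauchy_Schwarz_ineq2)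
          also have "\<dots> \<le> norm \<theta> * d" using True by (intro mult_left_mono) auto
          finally show ?thesis by (simp add: add_increasing2)
        next
          case False
          have "norm (iexp (\<theta> \<bullet> X \<omega>) - iexp (\<theta> \<bullet> Y \<omega>)) \<le> 2"
            using norm_triangle_ineq4[of "iexp (\<theta> \<bullet> X \<omega>)" "iexp (\<theta> \<bullet> Y \<omega>)"] by simp
          then show ?thesis using False \<open>\<omega> \<in> space M\<close> d by (simp add: add_increasing)
        qed
      qed simp
      finally show "norm (\<zeta> \<omega> * iexp (\<theta> \<bullet> X \<omega>) - \<zeta> \<omega> * iexp (\<theta> \<bullet> Y \<omega>))
        \<le> C * (norm \<theta> * d + 2 * indicator ?A \<omega>)" .
    qed
    show "integrable M (\<lambda>\<omega>. C * (norm \<theta> * d + 2 * indicator ?A \<omega>))"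
      by (intro integrable_mult_right Bochner_Integration.integrable_add integrable_real_indicator)
         (auto simp: less_top[symmetric])
  qed (use int in simp)
  also have "\<dots> = C * (norm \<theta> * d + 2 * prob ?A)"
    by (subst integral_mult_right_zero, subst Bochner_Integration.integral_add)
       (auto simp: prob_space less_top[symmetric] intro!: integrable_mult_right integrable_real_indicator)
  finally show ?thesis .
qed

text \<open>Slutsky's argument in the presence of a weight; it carries the limit from
  \<open>\<eta> *v W n\<close> over to \<open>Q n *v U n\<close>.\<close>

lemma charfun_tendsto_perturb:
  fixes \<zeta> :: "'a \<Rightarrow> complex" and X Y :: "nat \<Rightarrow> 'a \<Rightarrow> 'b::euclidean_space"
  assumes [measurable]: "\<zeta> \<in> borel_measurable M" "\<And>n. X n \<in> borel_measurable M" "\<And>n. Y n \<in> borel_measurable M"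
    and \<zeta>: "\<And>\<omega>. norm (\<zeta> \<omega>) \<le> C"
    and diff: "converges_in_prob M (\<lambda>n \<omega>. X n \<omega> - Y n \<omega>) (\<lambda>_. 0)"
    and lim: "(\<lambda>n. \<integral>\<omega>. \<zeta> \<omega> * iexp (\<theta> \<bullet> Y n \<omega>) \<partial>M) \<longlonglongrightarrow> l"
  shows "(\<lambda>n. \<integral>\<omega>. \<zeta> \<omega> * iexp (\<theta> \<bullet> X n \<omega>) \<partial>M) \<longlonglongrightarrow> l"
proof (rule tendsto_uniform_approx)
  fix e :: real assume e: "e > 0"
  have C: "0 \<le> C" using \<zeta> norm_ge_zero order_trans by blast
  define E where "E = C * (norm \<theta> + 2) + 1"
  have E: "E \<ge> 1" using C by (simp add: E_def)
  define d where "d = e / E"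
  have d: "d > 0" using e E by (simp add: d_def)
  have "\<forall>\<^sub>F n in sequentially. prob {\<omega> \<in> space M. norm (X n \<omega> - Y n \<omega>) > d} < d"
    by (rule converges_in_prob_zeroD[OF diff d d])
  then have "\<forall>\<^sub>F n in sequentially. norm ((\<integral>\<omega>. \<zeta> \<omega> * iexp (\<theta> \<bullet> X n \<omega>) \<partial>M) -
      (\<integral>\<omega>. \<zeta> \<omega> * iexp (\<theta> \<bullet> Y n \<omega>) \<partial>M)) \<le> e"
  proof eventually_elim
    case (elim n)
    have "norm ((\<integral>\<omega>. \<zeta> \<omega> * iexp (\<theta> \<bullet> X n \<omega>) \<partial>M) - (\<integral>\<omega>. \<zeta> \<omega> * iexp (\<theta> \<bullet> Y n \<omega>) \<partial>M)) \<le>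
        C * (norm \<theta> * d + 2 * prob {\<omega> \<in> space M. norm (X n \<omega> - Y n \<omega>) > d})"
      using d by (intro expectation_iexp_diff_bound \<zeta>) auto
    also have "\<dots> \<le> C * (norm \<theta> * d + 2 * d)"
      using elim C by (intro mult_left_mono) auto
    also have "\<dots> \<le> E * d" using d by (simp add: E_def algebra_simps)
    also have "\<dots> = e" using E by (simp add: d_def)
    finally show ?case .
  qed
  with lim e show "\<exists>b m. b \<longlonglongrightarrow> m \<and>
      (\<forall>\<^sub>F n in sequentially. norm ((\<integral>\<omega>. \<zeta> \<omega> * iexp (\<theta> \<bullet> X n \<omega>) \<partial>M) - b n) \<le> e) \<and> norm (l - m) \<le> e"
    by (intro exI[of _ "\<lambda>n. \<integral>\<omega>. \<zeta> \<omega> * iexp (\<theta> \<bullet> Y n \<omega>) \<partial>M"] exI[of _ l]) auto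
qed

text \<open>Purely algebraic and valid for \<open>r > n\<close> too, since truncated subtraction
  satisfies \<open>n - r - 1 = n - Suc r\<close>. The last sum collects the deviations from the
  exact recursion.\<close>

lemma perturbed_recursion_unfold:
  fixes P :: "real^'d^'d"
  shows "W n = (\<Sum>j<r. matrix_power P j *v Y (n - j)) + matrix_power P r *v W (n - r) +
    (\<Sum>j<r. matrix_power P j *v (W (n - j) - Y (n - j) - P *v W (n - j - 1)))"
proof (induction r)
  case 0
  then show ?case by (simp add: matrix_power_0)
next
  case (Suc r)
  \<comment> \<open>\<open>matrix_power\<close> multiplies on the left, whereas one more unfolding
    puts \<open>P\<close> on the right.\<close>
  have comm: "matrix_power P r ** P = matrix_power P (Suc r)"
    by (induction r) (simp_all add: matrix_power_0 matrix_power_Suc flip: matrix_mul_assoc)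
  show ?case
    by (subst Suc) (simp add: matrix_vector_mult_diff_distrib matrix_vector_mul_assoc comm algebra_simps)
qed

text \<open>Unfolding the recursion \<open>r\<close> times leaves the remainder \<open>P\<^sup>r W (n - r)\<close>, which tightness makes
  small uniformly in \<open>n\<close> for large \<open>r\<close>.\<close>

lemma perturbed_recursion_charfun:
  fixes \<zeta> :: "'a \<Rightarrow> complex" and W Y :: "nat \<Rightarrow> 'a \<Rightarrow> real^'d" and P :: "real^'d^'d"
  assumes [measurable]: "\<zeta> \<in> borel_measurable M" "\<And>n. W n \<in> borel_measurable M"
      "\<And>n. Y n \<in> borel_measurable M" "\<And>n. V n \<in> borel_measurable M"
    and \<zeta>: "\<And>\<omega>. norm (\<zeta> \<omega>) \<le> C"
    and W: "tight_seq M W"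
    and diff: "converges_in_prob M (\<lambda>n \<omega>. W n \<omega> - Y n \<omega> - P *v W (n - 1) \<omega>) (\<lambda>_. 0)"
    and P: "\<And>n x. norm (matrix_power P n *v x) \<le> c * \<rho> ^ n * norm x" "0 < \<rho>" "\<rho> < 1" "0 \<le> c"
    and lim: "\<And>r. (\<lambda>n. \<integral>\<omega>. \<zeta> \<omega> * iexp (\<theta> \<bullet> (\<Sum>j<r. matrix_power P j *v Y (n - j) \<omega>)) \<partial>M) \<longlonglongrightarrow>
      (\<integral>\<omega>. \<zeta> \<omega> * iexp (\<theta> \<bullet> (\<Sum>j<r. matrix_power P j *v V j \<omega>)) \<partial>M)"
    and summable: "AE \<omega> in M. summable (\<lambda>j. matrix_power P j *v V j \<omega>)"
  shows "(\<lambda>n. \<integral>\<omega>. \<zeta> \<omega> * iexp (\<theta> \<bullet> W n \<omega>) \<partial>M) \<longlonglongrightarrow>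
    (\<integral>\<omega>. \<zeta> \<omega> * iexp (\<theta> \<bullet> (\<Sum>j. matrix_power P j *v V j \<omega>)) \<partial>M)"
proof (rule tendsto_uniform_approx)
  fix e :: real assume e: "e > 0"
  have C: "0 \<le> C" using \<zeta> norm_ge_zero order_trans by blast
  \<comment> \<open>The error below is \<open>C * (norm \<theta> * d + 2 * (d + d))\<close>, at most
    \<open>E * d\<close>; the \<open>d + d\<close> bounds the tail of \<open>W (n - r)\<close> and
    that of the accumulated deviations.\<close>
  define E where "E = C * (norm \<theta> + 4) + 1"
  have E: "E \<ge> 1" using C by (simp add: E_def)
  define d where "d = e / E"
  have d: "d > 0" using e E by (simp add: d_def)
  obtain K0 where K0: "\<forall>\<^sub>F n in sequentially. prob {\<omega> \<in> space M. norm (W n \<omega>) > K0} < d"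
    by (rule tight_seqD[OF W d])
  define K where "K = max 1 K0"
  have K: "K > 0" "K0 \<le> K" by (auto simp: K_def)
  let ?V = "\<lambda>r \<omega>. \<Sum>j<r. matrix_power P j *v V j \<omega>"
  let ?Y = "\<lambda>r n \<omega>. \<Sum>j<r. matrix_power P j *v Y (n - j) \<omega>"
  define D where "D n \<omega> = W n \<omega> - Y n \<omega> - P *v W (n - 1) \<omega>" for n \<omega>
  have D_meas [measurable]: "D n \<in> borel_measurable M" for n
    unfolding D_def by measurable
  have "(\<lambda>r. \<integral>\<omega>. \<zeta> \<omega> * iexp (\<theta> \<bullet> ?V r \<omega>) \<partial>M) \<longlonglongrightarrow>
      (\<integral>\<omega>. \<zeta> \<omega> * iexp (\<theta> \<bullet> (\<Sum>j. matrix_power P j *v V j \<omega>)) \<partial>M)"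
  proof (rule integral_dominated_convergence[where w = "\<lambda>_. C"])
    show "AE \<omega> in M. (\<lambda>r. \<zeta> \<omega> * iexp (\<theta> \<bullet> ?V r \<omega>)) \<longlonglongrightarrow>
        \<zeta> \<omega> * iexp (\<theta> \<bullet> (\<Sum>j. matrix_power P j *v V j \<omega>))"
      using summable by eventually_elim (intro tendsto_intros summable_LIMSEQ)
    show "AE \<omega> in M. norm (\<zeta> \<omega> * iexp (\<theta> \<bullet> ?V r \<omega>)) \<le> C" for r
      using \<zeta> by (simp add: norm_mult)
  qed measurable
  then have ev1: "\<forall>\<^sub>F r in sequentially. dist (\<integral>\<omega>. \<zeta> \<omega> * iexp (\<theta> \<bullet> ?V r \<omega>) \<partial>M)
      (\<integral>\<omega>. \<zeta> \<omega> * iexp (\<theta> \<bullet> (\<Sum>j. matrix_power P j *v V j \<omega>)) \<partial>M) < e"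
    using e by (rule tendstoD)
  have "(\<lambda>r. c * \<rho> ^ r * K) \<longlonglongrightarrow> c * 0 * K"
    using P by (intro tendsto_intros LIMSEQ_power_zero) auto
  then have "\<forall>\<^sub>F r in sequentially. c * \<rho> ^ r * K < d / 2"
    using d by (intro order_tendstoD(2)[of _ 0]) auto
  \<comment> \<open>One fixed \<open>r\<close> serves two ends: the series is truncated accurately,
    and the remainder is below \<open>d / 2\<close> whenever \<open>W (n - r)\<close> is at most
    \<open>K\<close>.\<close>
  with ev1 have "\<forall>\<^sub>F r in sequentially. dist (\<integral>\<omega>. \<zeta> \<omega> * iexp (\<theta> \<bullet> ?V r \<omega>) \<partial>M)
      (\<integral>\<omega>. \<zeta> \<omega> * iexp (\<theta> \<bullet> (\<Sum>j. matrix_power P j *v V j \<omega>)) \<partial>M) < e \<and> c * \<rho> ^ r * K < d / 2"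
    by (rule eventually_conj)
  then obtain r where r: "dist (\<integral>\<omega>. \<zeta> \<omega> * iexp (\<theta> \<bullet> ?V r \<omega>) \<partial>M)
      (\<integral>\<omega>. \<zeta> \<omega> * iexp (\<theta> \<bullet> (\<Sum>j. matrix_power P j *v V j \<omega>)) \<partial>M) < e" "c * \<rho> ^ r * K < d / 2"
    by (auto simp: eventually_sequentially)
  let ?R = "\<lambda>n \<omega>. \<Sum>j<r. matrix_power P j *v D (n - j) \<omega>"
  have "converges_in_prob M ?R (\<lambda>_. 0)"
  proof (intro converges_in_prob_zero_sum)
    fix j
    show "converges_in_prob M (\<lambda>n \<omega>. matrix_power P j *v D (n - j) \<omega>) (\<lambda>_. 0)"
    proof (rule converges_in_prob_zero_bound)
      show "converges_in_prob M (\<lambda>n. D (n - j)) (\<lambda>_. 0)"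
        using diff unfolding D_def[symmetric] by (rule converges_in_prob_shift)
      show "\<forall>\<^sub>F n in sequentially. AE \<omega> in M.
          norm (matrix_power P j *v D (n - j) \<omega>) \<le> norm (matrix_power P j) * norm (D (n - j) \<omega>)"
        by (intro always_eventually allI AE_I2 norm_matrix_vector_mult_le)
    qed measurable
  qed simp_all
  then have "\<forall>\<^sub>F n in sequentially. prob {\<omega> \<in> space M. norm (?R n \<omega>) > d / 2} < d"
    using d by (intro converges_in_prob_zeroD) auto
  moreover have "\<forall>\<^sub>F n in sequentially. prob {\<omega> \<in> space M. norm (W (n - r) \<omega>) > K0} < d"
    using K0 by (rule eventually_compose_filterlim) (rule filterlim_minus_const_nat_at_top)
  ultimately have "\<forall>\<^sub>F n in sequentially. norm ((\<integral>\<omega>. \<zeta> \<omega> * iexp (\<theta> \<bullet> W n \<omega>) \<partial>M) -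
      (\<integral>\<omega>. \<zeta> \<omega> * iexp (\<theta> \<bullet> ?Y r n \<omega>) \<partial>M)) \<le> e"
  proof eventually_elim
    case (elim n)
    have "norm ((\<integral>\<omega>. \<zeta> \<omega> * iexp (\<theta> \<bullet> W n \<omega>) \<partial>M) - (\<integral>\<omega>. \<zeta> \<omega> * iexp (\<theta> \<bullet> ?Y r n \<omega>) \<partial>M)) \<le>
        C * (norm \<theta> * d + 2 * prob {\<omega> \<in> space M. norm (W n \<omega> - ?Y r n \<omega>) > d})"
      using d by (intro expectation_iexp_diff_bound \<zeta>) auto
    also have "prob {\<omega> \<in> space M. norm (W n \<omega> - ?Y r n \<omega>) > d} \<le>
        prob {\<omega> \<in> space M. norm (W (n - r) \<omega>) > K0} + prob {\<omega> \<in> space M. norm (?R n \<omega>) > d / 2}"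
    proof (rule prob_le_add; (intro AE_I2 impI)?)
      fix \<omega> assume *: "d < norm (W n \<omega> - ?Y r n \<omega>)"
      show "K0 < norm (W (n - r) \<omega>) \<or> d / 2 < norm (?R n \<omega>)"
      proof (rule ccontr)
        assume not: "\<not> ?thesis"
        have "norm (matrix_power P r *v W (n - r) \<omega>) \<le> c * \<rho> ^ r * norm (W (n - r) \<omega>)"
          by (rule P(1))
        also have "\<dots> \<le> c * \<rho> ^ r * K"
          using not K P by (intro mult_left_mono) auto
        finally have "norm (matrix_power P r *v W (n - r) \<omega>) < d / 2" using r by simp
        moreover have "W n \<omega> - ?Y r n \<omega> = matrix_power P r *v W (n - r) \<omega> + ?R n \<omega>"
          using perturbed_recursion_unfold[of "\<lambda>n. W n \<omega>" n P "\<lambda>n. Y n \<omega>" r] by (simp add: D_def)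
        ultimately show False
          using * not norm_triangle_ineq[of "matrix_power P r *v W (n - r) \<omega>" "?R n \<omega>"] by simp
      qed
    qed measurable
    also have "\<dots> \<le> d + d" using elim by simp
    also have "C * (norm \<theta> * d + 2 * (d + d)) \<le> E * d" using d by (simp add: E_def algebra_simps)
    also have "\<dots> = e" using E by (simp add: d_def)
    finally show ?case using C by (simp add: mult_left_mono)
  qed
  with lim[of r] r(1) show "\<exists>b m. b \<longlonglongrightarrow> m \<and>
      (\<forall>\<^sub>F n in sequentially. norm ((\<integral>\<omega>. \<zeta> \<omega> * iexp (\<theta> \<bullet> W n \<omega>) \<partial>M) - b n) \<le> e) \<and>
      norm ((\<integral>\<omega>. \<zeta> \<omega> * iexp (\<theta> \<bullet> (\<Sum>j. matrix_power P j *v V j \<omega>)) \<partial>M) - m) \<le> e"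
    by (intro exI[of _ "\<lambda>n. \<integral>\<omega>. \<zeta> \<omega> * iexp (\<theta> \<bullet> ?Y r n \<omega>) \<partial>M"]
        exI[of _ "\<integral>\<omega>. \<zeta> \<omega> * iexp (\<theta> \<bullet> ?V r \<omega>) \<partial>M"]) (simp add: dist_norm norm_minus_commute)
qed

text \<open>Conditional expectation is self-adjoint: both sides equal the integral of the product of
  the two conditional expectations. A general \<open>\<xi>\<close> thus gives way to a
  \<open>G\<close>-measurable weight.\<close>

lemma integral_cond_exp_swap:
  fixes \<xi> f :: "'a \<Rightarrow> real"
  assumes G: "subalgebra M G" and \<xi>: "integrable M \<xi>"
    and [measurable]: "f \<in> borel_measurable M" and f: "\<And>x. \<bar>f x\<bar> \<le> D"
  shows "(\<integral>\<omega>. \<xi> \<omega> * real_cond_exp M G f \<omega> \<partial>M) = (\<integral>\<omega>. real_cond_exp M G \<xi> \<omega> * f \<omega> \<partial>M)"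
proof -
  interpret G: sigma_finite_subalgebra M G
    by (rule sigma_finite_subalgebraI[OF G])
  have [measurable]: "\<xi> \<in> borel_measurable M" using \<xi> by simp
  have int_f: "integrable M f"
    using f by (intro integrable_const_bound[where B = D]) auto
  have int_\<xi>: "integrable M (real_cond_exp M G \<xi>)"
    using \<xi> by (rule G.real_cond_exp_int)
  let ?k = "real_cond_exp M G f"
  have "AE x in M. ?k x \<le> D" "AE x in M. ?k x \<ge> - D"
    using f by (auto intro!: G.real_cond_exp_le_c G.real_cond_exp_ge_c int_f simp: abs_le_iff minus_le_iff)
  then have k: "AE x in M. \<bar>?k x\<bar> \<le> D"
    by eventually_elim auto
  have int_bdd: "integrable M (\<lambda>x. g x * h x)"
    if "integrable M h" and [measurable]: "g \<in> borel_measurable M" and g: "AE x in M. \<bar>g x\<bar> \<le> D"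
    for g h :: "'a \<Rightarrow> real"
  proof (rule Bochner_Integration.integrable_bound)
    have D: "0 \<le> D" using f abs_ge_zero order_trans by blast
    show "integrable M (\<lambda>x. D * h x)" using that by simp
    have [measurable]: "h \<in> borel_measurable M" using that by simp
    show "(\<lambda>x. g x * h x) \<in> borel_measurable M" by measurable
    show "AE x in M. norm (g x * h x) \<le> norm (D * h x)"
      using g by eventually_elim (use D in \<open>auto simp: abs_mult intro!: mult_right_mono\<close>)
  qed
  have "(\<integral>\<omega>. \<xi> \<omega> * ?k \<omega> \<partial>M) = (\<integral>\<omega>. ?k \<omega> * real_cond_exp M G \<xi> \<omega> \<partial>M)"
    using G.real_cond_exp_intg(2)[of ?k \<xi>] int_bdd[OF \<xi> _ k] by (simp add: mult.commute)
  also have "\<dots> = (\<integral>\<omega>. real_cond_exp M G \<xi> \<omega> * ?k \<omega> \<partial>M)"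
    by (simp add: mult.commute)
  also have "\<dots> = (\<integral>\<omega>. real_cond_exp M G \<xi> \<omega> * f \<omega> \<partial>M)"
    using int_bdd[OF int_\<xi>, of f] f
    by (intro G.real_cond_exp_intg(2)) (auto simp: mult.commute)
  finally show ?thesis .
qed

text \<open>Once the conditional expectation has moved to \<open>\<xi>\<close>, the weight is
  approximated in L1 by bounded ones, which suffices as \<open>h\<close> is bounded. Weights are
  complex in \<open>main\<close> to match the arguments with characteristic functions.\<close>

lemma converges_stablyI:
  fixes X :: "nat \<Rightarrow> 'a \<Rightarrow> 'b::euclidean_space"
  assumes G: "subalgebra M G"
    and [measurable]: "\<And>n. X n \<in> borel_measurable M" "Y \<in> borel_measurable M"
    and main: "\<And>\<zeta> C h D. \<zeta> \<in> borel_measurable G \<Longrightarrow> (\<And>\<omega>. norm (\<zeta> \<omega> :: complex) \<le> C) \<Longrightarrow>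
      continuous_on UNIV h \<Longrightarrow> (\<And>x. \<bar>h x\<bar> \<le> D) \<Longrightarrow>
      (\<lambda>n. \<integral>\<omega>. \<zeta> \<omega> * of_real (h (X n \<omega>)) \<partial>M) \<longlonglongrightarrow> (\<integral>\<omega>. \<zeta> \<omega> * of_real (h (Y \<omega>)) \<partial>M)"
  shows "converges_stably M G X Y"
  unfolding converges_stably_def
proof (intro allI impI)
  fix \<xi> :: "'a \<Rightarrow> real" and h :: "'b \<Rightarrow> real"
  assume \<xi>: "integrable M \<xi>" and h: "continuous_on UNIV h" and "bounded (range h)"
  then obtain D where D: "\<And>x. \<bar>h x\<bar> \<le> D" by (auto simp: bounded_iff)
  have D0: "0 \<le> D" using D abs_ge_zero order_trans by blast
  have [measurable]: "h \<in> borel_measurable borel"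
    using h by (rule borel_measurable_continuous_onI)
  interpret G: sigma_finite_subalgebra M G
    by (rule sigma_finite_subalgebraI[OF G])
  define z where "z = real_cond_exp M G \<xi>"
  have z_G: "z \<in> borel_measurable G" unfolding z_def by simp
  have z: "integrable M z" unfolding z_def using \<xi> by (rule G.real_cond_exp_int)
  have [measurable]: "z \<in> borel_measurable M" using z by simp
  have swap: "(\<integral>\<omega>. \<xi> \<omega> * real_cond_exp M G (\<lambda>x. h (X' x)) \<omega> \<partial>M) = (\<integral>\<omega>. z \<omega> * h (X' \<omega>) \<partial>M)"
    if [measurable]: "X' \<in> borel_measurable M" for X'
    unfolding z_def by (rule integral_cond_exp_swap[OF G \<xi> _ D]) simp
  \<comment> \<open>Truncation at level \<open>k\<close> keeps the weight measurable for
    \<open>G\<close> and its modulus below that of \<open>z\<close>.\<close>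
  define t where "t k \<omega> = max (- real k) (min (real k) (z \<omega>))" for k \<omega>
  have t_meas [measurable]: "t k \<in> borel_measurable M" for k
    unfolding t_def by measurable
  have t_le: "\<bar>t k \<omega>\<bar> \<le> real k" "\<bar>t k \<omega>\<bar> \<le> \<bar>z \<omega>\<bar>" for k \<omega>
    unfolding t_def by auto
  have int: "integrable M (\<lambda>\<omega>. g \<omega> * h (X' \<omega>))"
    if "integrable M g" and [measurable]: "X' \<in> borel_measurable M" for g X'
  proof (rule Bochner_Integration.integrable_bound)
    show "integrable M (\<lambda>x. D * g x)" using that by simp
    have [measurable]: "g \<in> borel_measurable M" using that by simp
    show "(\<lambda>x. g x * h (X' x)) \<in> borel_measurable M" by measurable
    show "AE x in M. norm (g x * h (X' x)) \<le> norm (D * g x)"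
      using D D0 by (auto simp: abs_mult mult.commute[of D] intro!: mult_left_mono)
  qed
  have t_int: "integrable M (t k)" for k
    using t_le by (intro integrable_const_bound[where B = "real k"]) auto
  have "(\<lambda>k. \<integral>\<omega>. \<bar>z \<omega> - t k \<omega>\<bar> \<partial>M) \<longlonglongrightarrow> (\<integral>\<omega>. 0 \<partial>M)"
  proof (rule integral_dominated_convergence[where w = "\<lambda>\<omega>. 2 * \<bar>z \<omega>\<bar>"])
    show "AE \<omega> in M. (\<lambda>k. \<bar>z \<omega> - t k \<omega>\<bar>) \<longlonglongrightarrow> 0"
    proof (rule AE_I2)
      fix \<omega>
      obtain k0 where "\<bar>z \<omega>\<bar> \<le> real k0" using real_arch_simple by blast
      then have "\<forall>\<^sub>F k in sequentially. \<bar>z \<omega> - t k \<omega>\<bar> = 0"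
        unfolding eventually_sequentially by (intro exI[of _ k0]) (auto simp: t_def)
      then show "(\<lambda>k. \<bar>z \<omega> - t k \<omega>\<bar>) \<longlonglongrightarrow> 0" by (rule tendsto_eventually)
    qed
    show "AE \<omega> in M. norm \<bar>z \<omega> - t k \<omega>\<bar> \<le> 2 * \<bar>z \<omega>\<bar>" for k
      using t_le(2)[of k] by (intro AE_I2) (smt (verit) real_norm_def)
  qed (use z in auto)
  then have trunc: "(\<lambda>k. \<integral>\<omega>. \<bar>z \<omega> - t k \<omega>\<bar> \<partial>M) \<longlonglongrightarrow> 0" by simp
  have "(\<lambda>n. \<integral>\<omega>. z \<omega> * h (X n \<omega>) \<partial>M) \<longlonglongrightarrow> (\<integral>\<omega>. z \<omega> * h (Y \<omega>) \<partial>M)"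
  proof (rule tendsto_uniform_approx)
    fix e :: real assume e: "e > 0"
    then have "\<forall>\<^sub>F k in sequentially. (\<integral>\<omega>. \<bar>z \<omega> - t k \<omega>\<bar> \<partial>M) < e / (D + 1)"
      using D0 by (intro order_tendstoD(2)[OF trunc]) auto
    then obtain k where k: "(\<integral>\<omega>. \<bar>z \<omega> - t k \<omega>\<bar> \<partial>M) < e / (D + 1)"
      by (auto simp: eventually_sequentially)
    have approx: "norm ((\<integral>\<omega>. z \<omega> * h (X' \<omega>) \<partial>M) - (\<integral>\<omega>. t k \<omega> * h (X' \<omega>) \<partial>M)) \<le> e"
      if X': "X' \<in> borel_measurable M" for X'
    proof -
      have "(\<integral>\<omega>. z \<omega> * h (X' \<omega>) \<partial>M) - (\<integral>\<omega>. t k \<omega> * h (X' \<omega>) \<partial>M) =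
          (\<integral>\<omega>. (z \<omega> - t k \<omega>) * h (X' \<omega>) \<partial>M)"
        using int[OF z X'] int[OF t_int X'] by (simp add: left_diff_distrib)
      also have "norm \<dots> \<le> (\<integral>\<omega>. \<bar>z \<omega> - t k \<omega>\<bar> * D \<partial>M)"
      proof (rule norm_integral_le_AE)
        show "integrable M (\<lambda>\<omega>. (z \<omega> - t k \<omega>) * h (X' \<omega>))"
          using z t_int X' by (intro int) auto
        show "AE \<omega> in M. norm ((z \<omega> - t k \<omega>) * h (X' \<omega>)) \<le> \<bar>z \<omega> - t k \<omega>\<bar> * D"
          using D by (auto simp: abs_mult intro!: mult_left_mono)
      qed (use z t_int in auto)
      also have "\<dots> = (\<integral>\<omega>. \<bar>z \<omega> - t k \<omega>\<bar> \<partial>M) * D" by simp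
      also have "\<dots> \<le> e / (D + 1) * D" using k D0 by (intro mult_right_mono) auto
      also have "\<dots> \<le> e" using D0 e by (simp add: field_simps)
      finally show ?thesis .
    qed
    have "(\<lambda>n. \<integral>\<omega>. complex_of_real (t k \<omega>) * of_real (h (X n \<omega>)) \<partial>M) \<longlonglongrightarrow>
        (\<integral>\<omega>. complex_of_real (t k \<omega>) * of_real (h (Y \<omega>)) \<partial>M)"
    proof (rule main[of _ "real k", OF _ _ h D])
      show "(\<lambda>\<omega>. complex_of_real (t k \<omega>)) \<in> borel_measurable G"
        using z_G unfolding t_def by measurable
    qed (use t_le(1) in simp)
    then have "(\<lambda>n. \<integral>\<omega>. t k \<omega> * h (X n \<omega>) \<partial>M) \<longlonglongrightarrow> (\<integral>\<omega>. t k \<omega> * h (Y \<omega>) \<partial>M)"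
      by (simp add: tendsto_of_real_iff flip: of_real_mult)
    then show "\<exists>b m. b \<longlonglongrightarrow> m \<and>
        (\<forall>\<^sub>F n in sequentially. norm ((\<integral>\<omega>. z \<omega> * h (X n \<omega>) \<partial>M) - b n) \<le> e) \<and>
        norm ((\<integral>\<omega>. z \<omega> * h (Y \<omega>) \<partial>M) - m) \<le> e"
      using approx by (intro exI[of _ "\<lambda>n. \<integral>\<omega>. t k \<omega> * h (X n \<omega>) \<partial>M"]
          exI[of _ "\<integral>\<omega>. t k \<omega> * h (Y \<omega>) \<partial>M"]) auto
  qed
  then show "(\<lambda>n. \<integral>\<omega>. \<xi> \<omega> * real_cond_exp M G (\<lambda>x. h (X n x)) \<omega> \<partial>M) \<longlonglongrightarrow>
      (\<integral>\<omega>. \<xi> \<omega> * real_cond_exp M G (\<lambda>x. h (Y x)) \<omega> \<partial>M)"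
    by (simp add: swap)
qed

text \<open>Conditioning on \<open>A\<close> enlarges a probability at most by the factor
  \<open>1 / prob A\<close>.\<close>

lemma converges_in_prob_zero_uniform_measure:
  fixes X :: "nat \<Rightarrow> 'a \<Rightarrow> 'b::euclidean_space"
  assumes A: "A \<in> events" "prob A > 0" and [measurable]: "\<And>n. X n \<in> borel_measurable M"
    and X: "converges_in_prob M X (\<lambda>_. 0)"
  shows "converges_in_prob (uniform_measure M A) X (\<lambda>_. 0)"
  unfolding converges_in_prob_def
proof (intro allI impI)
  fix e :: real assume e: "e > 0"
  let ?B = "\<lambda>n. {\<omega> \<in> space M. e < dist (X n \<omega>) 0}"
  have "(\<lambda>n. prob (?B n) / prob A) \<longlonglongrightarrow> 0"
    using X e by (intro tendsto_divide_zero) (auto simp: converges_in_prob_def)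
  then show "(\<lambda>n. measure (uniform_measure M A) {\<omega> \<in> space (uniform_measure M A). e < dist (X n \<omega>) 0}) \<longlonglongrightarrow> 0"
  proof (rule tendsto_sandwich[rotated 3], goal_cases)
    case 2
    have "measure (uniform_measure M A) (?B n) \<le> prob (?B n) / prob A" for n
    proof -
      have "?B n \<in> events" by measurable
      then have "measure (uniform_measure M A) (?B n) = prob (A \<inter> ?B n) / prob A"
        using A by (intro measure_uniform_measure) (auto simp: emeasure_eq_measure)
      also have "\<dots> \<le> prob (?B n) / prob A"
        using A \<open>?B n \<in> events\<close> by (intro divide_right_mono finite_measure_mono) auto
      finally show ?thesis .
    qed
    then show ?case by simp
  qed auto
qed

end

section \<open>The stable limits\<close>

text \<open>Almost sure summability is part of the conclusion because \<open>suminf\<close> denotes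
  the intended limit only for a convergent series.\<close>

theorem corollary1p10:
  fixes M :: "'a measure"
    and F :: "nat \<Rightarrow> 'a measure"
    and U :: "nat \<Rightarrow> 'a \<Rightarrow> real^'d"
    and B :: "nat \<Rightarrow> 'a \<Rightarrow> real^'d^'d"
    and Q :: "nat \<Rightarrow> real^'d^'d"
    and \<eta> :: "'a \<Rightarrow> real^'d^'d"
    and P :: "real^'d^'d"
    and \<mu> :: "(real^'d) measure"
    and S :: "'a \<Rightarrow> real^'d^'d"
    and Z :: "nat \<Rightarrow> 'a \<Rightarrow> real^'d"
  defines "Finf \<equiv> filtration_limit M F"
    and "Peta \<equiv> uniform_measure M {\<omega> \<in> space M. invertible (\<eta> \<omega>)}"
  assumes "prob_space M"
    and "filtration (space M) F"
    and "\<And>n. subalgebra M (F n)"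
    and "\<And>n. U n \<in> borel_measurable (F n)"
    and "\<And>n. B n \<in> borel_measurable (F n)"
    and B_inv: "\<forall>\<^sub>F n in sequentially. AE \<omega> in M. invertible (B n \<omega>)"
    and "Q \<longlonglongrightarrow> 0"
    and "\<forall>\<^sub>F n in sequentially. invertible (Q n)"
    and i: "\<eta> \<in> borel_measurable Finf"
      "measure M {\<omega> \<in> space M. invertible (\<eta> \<omega>)} > 0"
      "converges_in_prob M (\<lambda>n \<omega>. Q n ** matrix_inv (B n \<omega>)) \<eta>"
    and ii: "((\<lambda>K :: real. SUP n\<in>{1..}. measure Peta {\<omega> \<in> space M. norm (Q n *v U n \<omega>) > K})
      \<longlongrightarrow> 0) at_top"
    and iii: "invertible P" "real_matrix_spectral_radius P < 1"
      "\<And>r. r \<ge> 1 \<Longrightarrow> converges_in_prob M (\<lambda>n \<omega>. B n \<omega> ** matrix_inv (B (n - r) \<omega>))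
        (\<lambda>_. matrix_power P r)"
    and iv: "prob_space \<mu>" "sets \<mu> = sets borel"
      "(\<integral>\<^sup>+x. ennreal (log_plus (norm x)) \<partial>\<mu>) < \<infinity>"
      "S \<in> borel_measurable Finf" "countable (S ` space M)"
      "\<And>\<theta>. converges_in_prob Peta
        (\<lambda>n. complex_cond_exp M (F (n - 1)) (\<lambda>\<omega>. iexp (\<theta> \<bullet> (B n \<omega> *v increment U n \<omega>))))
        (\<lambda>\<omega>. \<integral>x. iexp (\<theta> \<bullet> (S \<omega> *v x)) \<partial>\<mu>)"
    and Z: "prob_space.indep_vars M (\<lambda>_. borel) Z UNIV"
      "\<And>j. distr M borel (Z j) = \<mu>"
      "prob_space.indep_set M (sets (generated_sigma M Z)) (sets Finf)"
  shows "(AE \<omega> in M. summable (\<lambda>j. matrix_power P j *v (S \<omega> *v Z j \<omega>))) \<and>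
    converges_stably Peta Finf (\<lambda>n \<omega>. B n \<omega> *v U n \<omega>)
      (\<lambda>\<omega>. \<Sum>j. matrix_power P j *v (S \<omega> *v Z j \<omega>)) \<and>
    converges_stably Peta Finf (\<lambda>n \<omega>. Q n *v U n \<omega>)
      (\<lambda>\<omega>. \<eta> \<omega> *v (\<Sum>j. matrix_power P j *v (S \<omega> *v Z j \<omega>)))"
proof -
  interpret prob_space M by fact
  interpret filtered_prob_space M F
    by (intro filtered_prob_space.intro filtered_prob_space_axioms.intro prob_space_axioms assms)
  interpret mu: prob_space \<mu> by fact
  note Finf = Finf_def
  have sub: "subalgebra M Finf" unfolding Finf by (rule subalgebra_Finf)
  have [measurable_cong]: "sets \<mu> = sets borel" by fact
  have U_M [measurable]: "U n \<in> borel_measurable M" and B_M [measurable]: "B n \<in> borel_measurable M" for n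
    using measurable_from_subalg[OF subalgebra_F] \<open>\<And>n. U n \<in> borel_measurable (F n)\<close>
      \<open>\<And>n. B n \<in> borel_measurable (F n)\<close> by blast+
  have \<eta>_M [measurable]: "\<eta> \<in> borel_measurable M" and S_M [measurable]: "S \<in> borel_measurable M"
    using measurable_from_subalg[OF sub] i(1) iv(4) by blast+
  have Z_M [measurable]: "Z j \<in> borel_measurable M" for j
    using Z(1) by (simp add: indep_vars_def)
  define A where "A = {\<omega> \<in> space M. invertible (\<eta> \<omega>)}"
  have A_Finf: "A \<in> sets Finf"
    using sets_invertible[OF i(1)] by (simp add: A_def Finf space_Finf)
  have A: "A \<in> events" "prob A > 0"
    using i(2) by (auto simp: A_def)
  have Peta: "Peta = uniform_measure M A"
    by (simp add: A_def Peta_def)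
  interpret N: prob_space Peta
    unfolding Peta using A by (intro prob_space_uniform_measure) (auto simp: emeasure_eq_measure)
  have sets_Peta [measurable_cong]: "sets Peta = sets M" and space_Peta: "space Peta = space M"
    by (simp_all add: Peta)
  have sub_N: "subalgebra Peta Finf"
    using sub by (simp add: subalgebra_def sets_Peta space_Peta)
  have AE_N: "AE \<omega> in Peta. R \<omega>" if "AE \<omega> in M. R \<omega>" for R
    unfolding Peta using that A(1) by (auto intro: AE_uniform_measureI)
  have AE_\<eta>: "AE \<omega> in Peta. invertible (\<eta> \<omega>)"
    unfolding Peta by (rule AE_uniform_measureI[OF A(1)]) (simp add: A_def)
  have prob_N: "converges_in_prob Peta X (\<lambda>_. 0)"
    if "\<And>n. X n \<in> borel_measurable M" "converges_in_prob M X (\<lambda>_. 0)"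
    for X :: "nat \<Rightarrow> 'a \<Rightarrow> real^'d^'d"
    unfolding Peta using A that by (intro converges_in_prob_zero_uniform_measure)

  define W where "W n \<omega> = B n \<omega> *v U n \<omega>" for n \<omega>
  define Y where "Y n \<omega> = B n \<omega> *v increment U n \<omega>" for n \<omega>
  define V where "V n \<omega> = Q n *v U n \<omega>" for n \<omega>
  define L where "L \<omega> = (\<Sum>j. matrix_power P j *v (S \<omega> *v Z j \<omega>))" for \<omega>
  have W_M [measurable]: "W n \<in> borel_measurable M" and V_M [measurable]: "V n \<in> borel_measurable M" for n
    unfolding W_def V_def by measurable
  have L_M [measurable]: "L \<in> borel_measurable M"
    unfolding L_def by measurable
  have Y_F: "Y n \<in> borel_measurable (F n)" for n
  proof -
    have [measurable]: "U n \<in> borel_measurable (F n)" "B n \<in> borel_measurable (F n)"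
      "U (n - 1) \<in> borel_measurable (F n)"
      using assms(6,7) measurable_F_mono[of "U (n - 1)" "n - 1" borel n] by auto
    then have [measurable]: "increment U n \<in> borel_measurable (F n)"
      unfolding increment_def[abs_def] by simp
    show ?thesis unfolding Y_def by measurable
  qed
  then have Y_M [measurable]: "Y n \<in> borel_measurable M" for n
    by (rule measurable_from_subalg[OF subalgebra_F])

  \<comment> \<open>Tightness on the event that \<open>\<eta>\<close> is invertible\<close>
  have V_tight: "tight_seq Peta V"
    unfolding tight_seq_def
  proof (intro allI impI)
    fix e :: real assume "e > 0"
    have "\<forall>\<^sub>F K in at_top. (SUP n\<in>{1..}. measure Peta {\<omega> \<in> space M. norm (Q n *v U n \<omega>) > K}) < e"
      using ii \<open>e > 0\<close> by (rule order_tendstoD(2))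
    then obtain K where K: "(SUP n\<in>{1..}. measure Peta {\<omega> \<in> space M. norm (Q n *v U n \<omega>) > K}) < e"
      by (auto simp: eventually_at_top_linorder)
    have "measure Peta {\<omega> \<in> space Peta. norm (V n \<omega>) > K} < e" if "n \<ge> 1" for n
    proof -
      \<comment> \<open>Probabilities are at most 1, so the real supremum is over a bounded set and
        dominates each member.\<close>
      have "measure Peta {\<omega> \<in> space M. norm (Q n *v U n \<omega>) > K} \<le>
          (SUP n\<in>{1..}. measure Peta {\<omega> \<in> space M. norm (Q n *v U n \<omega>) > K})"
        using that by (intro cSUP_upper bdd_aboveI2[where M = 1]) auto
      with K show ?thesis by (simp add: V_def space_Peta)
    qed
    then show "\<exists>K. \<forall>\<^sub>F n in sequentially. measure Peta {\<omega> \<in> space Peta. norm (V n \<omega>) > K} < e"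
      unfolding eventually_sequentially by blast
  qed

  define E where "E n \<omega> = Q n ** matrix_inv (B n \<omega>) - \<eta> \<omega>" for n \<omega>
  have E_M [measurable]: "E n \<in> borel_measurable M" for n
    unfolding E_def by measurable
  have E: "converges_in_prob Peta E (\<lambda>_. 0)"
    using i(3) unfolding E_def
    by (intro prob_N) (simp_all add: converges_in_prob_diff_zero[symmetric])
  \<comment> \<open>\<open>matrix_inv (B n \<omega>)\<close> undoes \<open>B n\<close> in
    \<open>W n\<close>, so \<open>V n\<close> is \<open>Q n ** matrix_inv (B n \<omega>)\<close>
    applied to \<open>W n\<close>; \<open>E n\<close> is the deviation of that matrix from
    \<open>\<eta>\<close>.\<close>
  have VW: "\<forall>\<^sub>F n in sequentially. AE \<omega> in Peta. V n \<omega> = \<eta> \<omega> *v W n \<omega> + E n \<omega> *v W n \<omega>"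
    using B_inv
  proof eventually_elim
    case (elim n)
    from AE_N[OF this] show ?case
    proof eventually_elim
      case (elim \<omega>)
      have "(Q n ** matrix_inv (B n \<omega>)) *v W n \<omega> = Q n *v ((matrix_inv (B n \<omega>) ** B n \<omega>) *v U n \<omega>)"
        by (simp add: W_def matrix_vector_mul_assoc matrix_mul_assoc)
      also have "\<dots> = V n \<omega>"
        using elim by (simp add: matrix_inv_left_right V_def)
      finally show ?case by (simp add: E_def matrix_vector_mult_diff_rdistrib)
    qed
  qed
  \<comment> \<open>Solving for \<open>W n\<close> with the inverse of \<open>\<eta>\<close> leaves
    \<open>W n\<close> in the error term, whence the self-bounding form.\<close>
  have W_tight: "tight_seq Peta W"
  proof (rule N.tight_seq_self_bound[OF _ _ _ E V_tight])
    show "\<forall>\<^sub>F n in sequentially. AE \<omega> in Peta. norm (W n \<omega>) \<le>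
        norm (matrix_inv (\<eta> \<omega>)) * (norm (V n \<omega>) + norm (E n \<omega>) * norm (W n \<omega>))"
      using VW
    proof eventually_elim
      case (elim n)
      from this AE_\<eta> show ?case
      proof eventually_elim
        case (elim \<omega>)
        have "W n \<omega> = matrix_inv (\<eta> \<omega>) *v (\<eta> \<omega> *v W n \<omega>)"
          using elim(2) by (simp add: matrix_vector_mul_assoc matrix_inv_left_right)
        also have "\<eta> \<omega> *v W n \<omega> = V n \<omega> - E n \<omega> *v W n \<omega>"
          using elim(1) by simp
        finally have "norm (W n \<omega>) \<le> norm (matrix_inv (\<eta> \<omega>)) * norm (V n \<omega> - E n \<omega> *v W n \<omega>)"
          by (metis norm_matrix_vector_mult_le)
        also have "\<dots> \<le> norm (matrix_inv (\<eta> \<omega>)) * (norm (V n \<omega>) + norm (E n \<omega>) * norm (W n \<omega>))"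
          using norm_triangle_ineq4[of "V n \<omega>" "E n \<omega> *v W n \<omega>"] norm_matrix_vector_mult_le[of "E n \<omega>" "W n \<omega>"]
          by (intro mult_left_mono) auto
        finally show ?case .
      qed
    qed
  qed measurable

  \<comment> \<open>The approximate recursion\<close>
  have W_rec: "converges_in_prob Peta (\<lambda>n \<omega>. W n \<omega> - Y n \<omega> - P *v W (n - 1) \<omega>) (\<lambda>_. 0)"
  proof -
    \<comment> \<open>As \<open>W n - Y n\<close> is \<open>B n *v U (n - 1)\<close>, the deviation
      from the recursion is exactly \<open>D n\<close> applied to the tight
      \<open>W (n - 1)\<close>.\<close>
    define D where "D n \<omega> = B n \<omega> ** matrix_inv (B (n - 1) \<omega>) - P" for n \<omega>
    have D_M [measurable]: "D n \<in> borel_measurable M" for n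
      unfolding D_def by measurable
    have "converges_in_prob M (\<lambda>n \<omega>. B n \<omega> ** matrix_inv (B (n - 1) \<omega>)) (\<lambda>_. P)"
      using iii(3)[of 1] by (simp add: matrix_power_Suc matrix_power_0)
    then have "converges_in_prob Peta D (\<lambda>_. 0)"
      unfolding D_def by (intro prob_N) (simp_all add: converges_in_prob_diff_zero[symmetric])
    then have "converges_in_prob Peta (\<lambda>n \<omega>. D n \<omega> *v W (n - 1) \<omega>) (\<lambda>_. 0)"
      by (rule N.converges_in_prob_zero_mult_tight[OF _ _ tight_seq_shift[OF W_tight, of 1]])
         (auto simp: norm_matrix_vector_mult_le)
    then show ?thesis
    proof (rule N.converges_in_prob_zero_bound)
      have "\<forall>\<^sub>F n in sequentially. AE \<omega> in M. invertible (B (n - 1) \<omega>)"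
        using B_inv by (rule eventually_compose_filterlim) (rule filterlim_minus_const_nat_at_top)
      \<comment> \<open>At index 0 the increment is 0 by convention and not a difference, so
        \<open>n \<ge> 1\<close> matters.\<close>
      with eventually_ge_at_top[of 1]
      show "\<forall>\<^sub>F n in sequentially. AE \<omega> in Peta.
          norm (W n \<omega> - Y n \<omega> - P *v W (n - 1) \<omega>) \<le> 1 * norm (D n \<omega> *v W (n - 1) \<omega>)"
      proof eventually_elim
        case (elim n)
        from AE_N[OF elim(2)] show ?case
        proof eventually_elim
          fix \<omega> assume "invertible (B (n - 1) \<omega>)"
          then have "matrix_inv (B (n - 1) \<omega>) *v W (n - 1) \<omega> = U (n - 1) \<omega>"
            by (simp add: W_def matrix_vector_mul_assoc matrix_inv_left_right)
          then have "D n \<omega> *v W (n - 1) \<omega> = B n \<omega> *v U (n - 1) \<omega> - P *v W (n - 1) \<omega>"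
            by (simp add: D_def matrix_vector_mult_diff_rdistrib flip: matrix_vector_mul_assoc)
          also have "B n \<omega> *v U (n - 1) \<omega> = W n \<omega> - Y n \<omega>"
            using elim(1) by (simp add: W_def Y_def increment_def matrix_vector_mult_diff_distrib)
          finally show "norm (W n \<omega> - Y n \<omega> - P *v W (n - 1) \<omega>) \<le> 1 * norm (D n \<omega> *v W (n - 1) \<omega>)"
            by simp
        qed
      qed
    qed measurable
  qed

  \<comment> \<open>Decay of the powers of \<open>P\<close> and the limit series\<close>
  obtain c \<rho> where P: "0 < \<rho>" "\<rho> < 1" "0 \<le> c"
    "\<And>n x. norm (matrix_power P n *v x) \<le> c * \<rho> ^ n * norm x"
    using matrix_power_geometric_bound[OF iii(2)] by blast
  have summable: "AE \<omega> in M. summable (\<lambda>j. matrix_power P j *v (S \<omega> *v Z j \<omega>))"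
    by (rule AE_summable_matrix_power_series[OF Z_M Z(2) iv(3) P(4,1,2,3)])

  define \<phi> where "\<phi> \<theta> \<omega> = (\<integral>x. iexp (\<theta> \<bullet> (S \<omega> *v x)) \<partial>\<mu>)" for \<theta> \<omega>
  have \<phi>: "\<phi> \<theta> \<in> borel_measurable Finf" "norm (\<phi> \<theta> \<omega>) \<le> 1" for \<theta> \<omega>
  proof -
    note [measurable] = iv(4)
    show "\<phi> \<theta> \<in> borel_measurable Finf" unfolding \<phi>_def by measurable
    have "norm (\<phi> \<theta> \<omega>) \<le> (\<integral>x. norm (iexp (\<theta> \<bullet> (S \<omega> *v x))) \<partial>\<mu>)"
      unfolding \<phi>_def by (rule integral_norm_bound)
    then show "norm (\<phi> \<theta> \<omega>) \<le> 1" by (simp add: mu.prob_space)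
  qed

  \<comment> \<open>Weighted characteristic functions of the finite sums and of
    \<open>W n\<close>\<close>
  have finite_sums: "(\<lambda>n. \<integral>\<omega>. \<zeta> \<omega> * iexp (\<theta> \<bullet> (\<Sum>j<r. matrix_power P j *v Y (n - j) \<omega>)) \<partial>Peta) \<longlonglongrightarrow>
      (\<integral>\<omega>. \<zeta> \<omega> * iexp (\<theta> \<bullet> (\<Sum>j<r. matrix_power P j *v (S \<omega> *v Z j \<omega>))) \<partial>Peta)"
    if \<zeta>: "\<zeta> \<in> borel_measurable Finf" "\<And>\<omega>. norm (\<zeta> \<omega> :: complex) \<le> C" for \<zeta> C \<theta> r
  proof -
    \<comment> \<open>\<open>A\<close> belongs to \<open>Finf\<close>, so cutting off outside
      \<open>A\<close> keeps the weight admissible and turns integrals under \<open>Peta\<close>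
      into integrals under \<open>M\<close>.\<close>
    define \<zeta>' where "\<zeta>' \<omega> = indicator A \<omega> * \<zeta> \<omega>" for \<omega>
    have \<zeta>': "\<zeta>' \<in> borel_measurable Finf" "\<And>\<omega>. norm (\<zeta>' \<omega>) \<le> C" "\<And>\<omega>. \<omega> \<notin> A \<Longrightarrow> \<zeta>' \<omega> = 0"
    proof -
      note [measurable] = A_Finf \<zeta>(1)
      show "\<zeta>' \<in> borel_measurable Finf" unfolding \<zeta>'_def by measurable
      show "norm (\<zeta>' \<omega>) \<le> C" for \<omega>
        using \<zeta>(2)[of \<omega>] order_trans[OF norm_ge_zero \<zeta>(2)[of \<omega>]]
        by (auto simp: \<zeta>'_def indicator_def)
    qed (simp add: \<zeta>'_def)
    have [measurable]: "\<zeta> \<in> borel_measurable M"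
      using measurable_from_subalg[OF sub \<zeta>(1)] .
    \<comment> \<open>The transposed power of \<open>P\<close> applied to \<open>\<theta>\<close>:
      the matrices move from the terms to the frequencies.\<close>
    define t where "t j = \<theta> v* matrix_power P j" for j
    have iexp_sum: "iexp (\<theta> \<bullet> (\<Sum>j<r. matrix_power P j *v y j)) = (\<Prod>j<r. iexp (t j \<bullet> y j))" for y
      by (simp add: prod_iexp t_def inner_sum_right dot_lmul_matrix)
    have to_M: "(\<integral>\<omega>. \<zeta> \<omega> * f \<omega> \<partial>Peta) = (\<integral>\<omega>. \<zeta>' \<omega> * f \<omega> \<partial>M) /\<^sub>R prob A"
      if [measurable]: "f \<in> borel_measurable M" for f
    proof -
      have "indicator A \<omega> *\<^sub>R (\<zeta> \<omega> * f \<omega>) = \<zeta>' \<omega> * f \<omega>" for \<omega>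
        by (simp add: \<zeta>'_def indicator_def)
      then show ?thesis
        unfolding Peta using A by (subst integral_uniform_measure[OF prob_space_axioms]) auto
    qed
    have "(\<lambda>n. \<integral>\<omega>. \<zeta>' \<omega> * (\<Prod>j<r. iexp (t j \<bullet> Y (n - j) \<omega>)) \<partial>M) \<longlonglongrightarrow>
        (\<integral>\<omega>. \<zeta>' \<omega> * (\<Prod>j<r. \<phi> (t j) \<omega>) \<partial>M)"
    proof (rule joint_charfun_tendsto[OF A Y_F])
      show "converges_in_prob (uniform_measure M A)
          (\<lambda>n. complex_cond_exp M (F (n - 1)) (\<lambda>\<omega>. iexp (\<theta> \<bullet> Y n \<omega>))) (\<phi> \<theta>)" for \<theta>
        using iv(6)[of \<theta>] unfolding Peta[symmetric] Y_def \<phi>_def[abs_def] .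
    qed (use \<phi> \<zeta>' in \<open>simp_all add: Finf\<close>)
    \<comment> \<open>Independence is read backwards: the product of the conditional limits is
      turned into exponentials of the vectors \<open>S \<omega> *v Z j \<omega>\<close>.\<close>
    also have "(\<integral>\<omega>. \<zeta>' \<omega> * (\<Prod>j<r. \<phi> (t j) \<omega>) \<partial>M) =
        (\<integral>\<omega>. \<zeta>' \<omega> * (\<Prod>j<r. iexp (t j \<bullet> (S \<omega> *v Z j \<omega>))) \<partial>M)"
      unfolding \<phi>_def by (rule indep_charfun_product[OF sub Z iv(4) \<zeta>'(1,2), symmetric])
    finally have lim: "(\<lambda>n. \<integral>\<omega>. \<zeta>' \<omega> * (\<Prod>j<r. iexp (t j \<bullet> Y (n - j) \<omega>)) \<partial>M) \<longlonglongrightarrow>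
        (\<integral>\<omega>. \<zeta>' \<omega> * (\<Prod>j<r. iexp (t j \<bullet> (S \<omega> *v Z j \<omega>))) \<partial>M)" .
    have "(\<lambda>n. (\<integral>\<omega>. \<zeta>' \<omega> * (\<Prod>j<r. iexp (t j \<bullet> Y (n - j) \<omega>)) \<partial>M) /\<^sub>R prob A) \<longlonglongrightarrow>
        (\<integral>\<omega>. \<zeta>' \<omega> * (\<Prod>j<r. iexp (t j \<bullet> (S \<omega> *v Z j \<omega>))) \<partial>M) /\<^sub>R prob A"
      using lim by (intro tendsto_intros)
    then show ?thesis
      by (simp add: iexp_sum to_M)
  qed

  have charfun_W: "(\<lambda>n. \<integral>\<omega>. \<zeta> \<omega> * iexp (\<theta> \<bullet> W n \<omega>) \<partial>Peta) \<longlonglongrightarrow> (\<integral>\<omega>. \<zeta> \<omega> * iexp (\<theta> \<bullet> L \<omega>) \<partial>Peta)"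
    if \<zeta>: "\<zeta> \<in> borel_measurable Finf" "\<And>\<omega>. norm (\<zeta> \<omega> :: complex) \<le> C" for \<zeta> C \<theta>
    unfolding L_def
  proof (rule N.perturbed_recursion_charfun[where Y = Y and V = "\<lambda>j \<omega>. S \<omega> *v Z j \<omega>",
        OF _ _ _ _ \<zeta>(2) W_tight W_rec P(4,1,2,3) finite_sums[OF \<zeta>]])
    show "(\<lambda>\<omega>. S \<omega> *v Z j \<omega>) \<in> borel_measurable Peta" for j
      by measurable
    show "\<zeta> \<in> borel_measurable Peta"
      by (rule measurable_from_subalg[OF sub_N \<zeta>(1)])
    show "AE \<omega> in Peta. summable (\<lambda>j. matrix_power P j *v (S \<omega> *v Z j \<omega>))"
      by (rule AE_N[OF summable])
  qed measurable

  have stable_W: "(\<lambda>n. \<integral>\<omega>. \<zeta> \<omega> * of_real (h (W n \<omega>)) \<partial>Peta) \<longlonglongrightarrow> (\<integral>\<omega>. \<zeta> \<omega> * of_real (h (L \<omega>)) \<partial>Peta)"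
    if \<zeta>: "\<zeta> \<in> borel_measurable Finf" "\<And>\<omega>. norm (\<zeta> \<omega> :: complex) \<le> C"
      and h: "continuous_on UNIV h" "\<And>x. \<bar>h x\<bar> \<le> D" for \<zeta> C h D
  proof (rule N.tight_charfun_imp_expectation_tendsto[OF _ _ _ \<zeta>(2) W_tight charfun_W[OF \<zeta>] h])
    show "\<zeta> \<in> borel_measurable Peta"
      by (rule measurable_from_subalg[OF sub_N \<zeta>(1)])
  qed measurable

  \<comment> \<open>Passage from \<open>W n\<close> to \<open>Q n *v U n\<close>\<close>
  have stable_\<eta>W: "(\<lambda>n. \<integral>\<omega>. \<zeta> \<omega> * of_real (h (\<eta> \<omega> *v W n \<omega>)) \<partial>Peta) \<longlonglongrightarrow>
      (\<integral>\<omega>. \<zeta> \<omega> * of_real (h (\<eta> \<omega> *v L \<omega>)) \<partial>Peta)"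
    if \<zeta>: "\<zeta> \<in> borel_measurable Finf" "\<And>\<omega>. norm (\<zeta> \<omega> :: complex) \<le> C"
      and h: "continuous_on UNIV h" "\<And>x. \<bar>h x\<bar> \<le> D" for \<zeta> C h D
  proof -
    define h' where "h' p = h (fst p *v snd p)" for p :: "(real^'d^'d) \<times> (real^'d)"
    have "continuous_on UNIV (\<lambda>p :: (real^'d^'d) \<times> (real^'d). fst p *v snd p)"
      unfolding matrix_vector_mult_def by (intro continuous_intros)
    then have h': "continuous_on UNIV h'"
      unfolding h'_def by (rule continuous_on_compose2[OF h(1)]) auto
    have [measurable]: "\<zeta> \<in> borel_measurable Peta"
      by (rule measurable_from_subalg[OF sub_N \<zeta>(1)])
    have "(\<lambda>n. \<integral>\<omega>. \<zeta> \<omega> * of_real (h' (\<eta> \<omega>, W n \<omega>)) \<partial>Peta) \<longlonglongrightarrow>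
        (\<integral>\<omega>. \<zeta> \<omega> * of_real (h' (\<eta> \<omega>, L \<omega>)) \<partial>Peta)"
    proof (rule N.tight_charfun_imp_expectation_tendsto[OF _ _ _ \<zeta>(2) _ _ h'])
      show "tight_seq Peta (\<lambda>n \<omega>. (\<eta> \<omega>, W n \<omega>))"
        by (rule N.tight_seq_Pair[OF N.tight_seq_const _ W_tight]) measurable
      fix \<theta> :: "(real^'d^'d) \<times> (real^'d)"
      \<comment> \<open>The \<open>\<eta>\<close>-part of the exponential is a bounded
        \<open>Finf\<close>-measurable factor and goes into the weight, so the limit for
        \<open>W n\<close> alone yields that for the pair.\<close>
      have "(\<lambda>n. \<integral>\<omega>. (\<zeta> \<omega> * iexp (fst \<theta> \<bullet> \<eta> \<omega>)) * iexp (snd \<theta> \<bullet> W n \<omega>) \<partial>Peta) \<longlonglongrightarrow>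
          (\<integral>\<omega>. (\<zeta> \<omega> * iexp (fst \<theta> \<bullet> \<eta> \<omega>)) * iexp (snd \<theta> \<bullet> L \<omega>) \<partial>Peta)"
      proof (rule charfun_W)
        note [measurable] = \<zeta>(1) i(1)
        show "(\<lambda>\<omega>. \<zeta> \<omega> * iexp (fst \<theta> \<bullet> \<eta> \<omega>)) \<in> borel_measurable Finf" by measurable
        show "norm (\<zeta> \<omega> * iexp (fst \<theta> \<bullet> \<eta> \<omega>)) \<le> C" for \<omega>
          using \<zeta>(2) by (simp add: norm_mult)
      qed
      then show "(\<lambda>n. \<integral>\<omega>. \<zeta> \<omega> * iexp (\<theta> \<bullet> (\<eta> \<omega>, W n \<omega>)) \<partial>Peta) \<longlonglongrightarrow>
          (\<integral>\<omega>. \<zeta> \<omega> * iexp (\<theta> \<bullet> (\<eta> \<omega>, L \<omega>)) \<partial>Peta)"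
        by (simp add: inner_prod_def exp_add distrib_left mult.assoc)
      show "\<bar>h' p\<bar> \<le> D" for p using h(2) by (simp add: h'_def)
    qed measurable
    then show ?thesis by (simp add: h'_def)
  qed

  \<comment> \<open>The perturbation \<open>E n *v W n\<close> is treated on exponentials, which are
    Lipschitz; tightness of \<open>V\<close> then leads back to bounded continuous
    functions.\<close>
  have charfun_V: "(\<lambda>n. \<integral>\<omega>. \<zeta> \<omega> * iexp (\<theta> \<bullet> V n \<omega>) \<partial>Peta) \<longlonglongrightarrow>
      (\<integral>\<omega>. \<zeta> \<omega> * iexp (\<theta> \<bullet> (\<eta> \<omega> *v L \<omega>)) \<partial>Peta)"
    if \<zeta>: "\<zeta> \<in> borel_measurable Finf" "\<And>\<omega>. norm (\<zeta> \<omega> :: complex) \<le> C" for \<zeta> C \<theta>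
  proof -
    have \<zeta>_N [measurable]: "\<zeta> \<in> borel_measurable Peta"
      by (rule measurable_from_subalg[OF sub_N \<zeta>(1)])
    have "converges_in_prob Peta (\<lambda>n \<omega>. E n \<omega> *v W n \<omega>) (\<lambda>_. 0)"
      by (rule N.converges_in_prob_zero_mult_tight[OF E _ W_tight]) (auto simp: norm_matrix_vector_mult_le)
    then have diff: "converges_in_prob Peta (\<lambda>n \<omega>. V n \<omega> - \<eta> \<omega> *v W n \<omega>) (\<lambda>_. 0)"
    proof (rule N.converges_in_prob_zero_bound)
      show "\<forall>\<^sub>F n in sequentially. AE \<omega> in Peta.
          norm (V n \<omega> - \<eta> \<omega> *v W n \<omega>) \<le> 1 * norm (E n \<omega> *v W n \<omega>)"
        using VW by (rule eventually_mono) (auto elim!: eventually_mono)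
    qed measurable
    \<comment> \<open>The limit for \<open>\<eta> *v W n\<close> is available for real test
      functions, so the exponential is assembled from \<open>cos\<close> and
      \<open>sin\<close>.\<close>
    have "(\<lambda>n. (\<integral>\<omega>. \<zeta> \<omega> * of_real (cos (\<theta> \<bullet> (\<eta> \<omega> *v W n \<omega>))) \<partial>Peta) +
          \<i> * (\<integral>\<omega>. \<zeta> \<omega> * of_real (sin (\<theta> \<bullet> (\<eta> \<omega> *v W n \<omega>))) \<partial>Peta)) \<longlonglongrightarrow>
        (\<integral>\<omega>. \<zeta> \<omega> * of_real (cos (\<theta> \<bullet> (\<eta> \<omega> *v L \<omega>))) \<partial>Peta) +
          \<i> * (\<integral>\<omega>. \<zeta> \<omega> * of_real (sin (\<theta> \<bullet> (\<eta> \<omega> *v L \<omega>))) \<partial>Peta)"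
      by (intro tendsto_intros stable_\<eta>W[OF \<zeta>, of "\<lambda>x. cos (\<theta> \<bullet> x)" 1]
          stable_\<eta>W[OF \<zeta>, of "\<lambda>x. sin (\<theta> \<bullet> x)" 1]) (auto intro!: continuous_intros)
    moreover have "(\<integral>\<omega>. \<zeta> \<omega> * of_real (cos (\<theta> \<bullet> X \<omega>)) \<partial>Peta) + \<i> * (\<integral>\<omega>. \<zeta> \<omega> * of_real (sin (\<theta> \<bullet> X \<omega>)) \<partial>Peta) =
        (\<integral>\<omega>. \<zeta> \<omega> * iexp (\<theta> \<bullet> X \<omega>) \<partial>Peta)" if [measurable]: "X \<in> borel_measurable Peta" for X
    proof -
      have "integrable Peta (\<lambda>\<omega>. \<zeta> \<omega> * of_real (cos (\<theta> \<bullet> X \<omega>)))"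
        "integrable Peta (\<lambda>\<omega>. \<zeta> \<omega> * of_real (sin (\<theta> \<bullet> X \<omega>)))"
        by (rule N.integrable_bounded_mult[where C = C and D = 1]; use \<zeta>(2) in simp)+
      then have "(\<integral>\<omega>. \<zeta> \<omega> * of_real (cos (\<theta> \<bullet> X \<omega>)) + \<i> * (\<zeta> \<omega> * of_real (sin (\<theta> \<bullet> X \<omega>))) \<partial>Peta) =
          (\<integral>\<omega>. \<zeta> \<omega> * of_real (cos (\<theta> \<bullet> X \<omega>)) \<partial>Peta) +
            \<i> * (\<integral>\<omega>. \<zeta> \<omega> * of_real (sin (\<theta> \<bullet> X \<omega>)) \<partial>Peta)"
        by simp
      moreover have "\<zeta> \<omega> * of_real (cos (\<theta> \<bullet> X \<omega>)) + \<i> * (\<zeta> \<omega> * of_real (sin (\<theta> \<bullet> X \<omega>))) =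
          \<zeta> \<omega> * iexp (\<theta> \<bullet> X \<omega>)" for \<omega>
      proof -
        have "iexp t = of_real (cos t) + \<i> * of_real (sin t)" for t
          by (simp add: complex_eq_iff Re_exp Im_exp)
        then show ?thesis by (simp only: distrib_left mult.left_commute)
      qed
      ultimately show ?thesis by (simp only:)
    qed
    ultimately have "(\<lambda>n. \<integral>\<omega>. \<zeta> \<omega> * iexp (\<theta> \<bullet> (\<eta> \<omega> *v W n \<omega>)) \<partial>Peta) \<longlonglongrightarrow>
        (\<integral>\<omega>. \<zeta> \<omega> * iexp (\<theta> \<bullet> (\<eta> \<omega> *v L \<omega>)) \<partial>Peta)"
      by simp
    from N.charfun_tendsto_perturb[OF \<zeta>_N _ _ \<zeta>(2) diff this] show ?thesis
      by measurable
  qed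

  have stable_V: "(\<lambda>n. \<integral>\<omega>. \<zeta> \<omega> * of_real (h (V n \<omega>)) \<partial>Peta) \<longlonglongrightarrow>
      (\<integral>\<omega>. \<zeta> \<omega> * of_real (h (\<eta> \<omega> *v L \<omega>)) \<partial>Peta)"
    if \<zeta>: "\<zeta> \<in> borel_measurable Finf" "\<And>\<omega>. norm (\<zeta> \<omega> :: complex) \<le> C"
      and h: "continuous_on UNIV h" "\<And>x. \<bar>h x\<bar> \<le> D" for \<zeta> C h D
  proof (rule N.tight_charfun_imp_expectation_tendsto[OF _ _ _ \<zeta>(2) V_tight charfun_V[OF \<zeta>] h])
    show "\<zeta> \<in> borel_measurable Peta"
      by (rule measurable_from_subalg[OF sub_N \<zeta>(1)])
  qed measurable

  have [measurable]: "W n \<in> borel_measurable Peta" "V n \<in> borel_measurable Peta"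
    "L \<in> borel_measurable Peta" "\<eta> \<in> borel_measurable Peta" for n
    by measurable
  have "converges_stably Peta Finf W L"
    by (rule N.converges_stablyI[OF sub_N _ _ stable_W]) simp_all
  moreover have "converges_stably Peta Finf V (\<lambda>\<omega>. \<eta> \<omega> *v L \<omega>)"
    by (rule N.converges_stablyI[OF sub_N _ _ stable_V]) simp_all
  ultimately show ?thesis
    using summable unfolding W_def V_def L_def by simp
qed

end
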